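(* As $x\to\infty$, \[\sum_{n\le x}r_1(n)=\frac{\pi}{2}\,\frac{x}{\log x}\left(1+O\Bigl(\frac{1}{\log x}\Bigr)\right).\]
   Context: The sum is over positive integers $n\le x$, and $r_1(n):=\#\{(a,p)\in\mathbb{Z}_{\ge 0}\times\mathbb{Z}_{\ge 1}:\ a^2+p^2=n,\ p\text{ prime}\}$. The notation $f(x)=O(g(x))$ means there are constants $c>0$ and $x_0$ with $|f(x)|\le c|g(x)|$ for all $x>x_0$. *)

theory Defs
  imports "HOL-Library.Landau_Symbols" "HOL-Computational_Algebra.Primes"
begin

definition r1 :: "nat \<Rightarrow> nat" where
  "r1 n = card {(a :: nat, p :: nat). a\<^sup>2 + p\<^sup>2 = n \<and> prime p}"

end

theory Submission
  imports Defs "HOL-Probability.Probability" "HOL-Complex_Analysis.Complex_Analysis"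
    "HOL-Number_Theory.Prime_Powers" "HOL-Real_Asymp.Real_Asymp"
begin

text \<open>
  Write \<open>y = sqrt x\<close>. Counting lattice points by their prime coordinate, the sum equals
  \<open>\<Sum>p\<le>y. \<lfloor>sqrt (y\<^sup>2 - p\<^sup>2)\<rfloor> + 1\<close>, so by partial summation everything reduces to the prime number
  theorem \<open>\<psi>(x) = x + O(x / log x)\<close> and to the area of a quarter disc.

  For \<open>\<psi>\<close>, average \<open>\<psi>(e\<^sup>v) - e\<^sup>v\<close> against a normal density of width \<open>1 / X\<^sup>2\<close> centred near \<open>X\<close>. The Fourier
  transform of the Gaussian turns this average into an absolutely convergent integral of
  \<open>(-\<zeta>'/\<zeta>(s) - s/(s-1)) / s\<close> over \<open>Re s = 3\<close>, whose Gaussian factor permits truncation at height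
  \<open>T = X\<^sup>3\<close>. The integrand has no pole at \<open>1\<close>, so the contour moves to \<open>Re s = 1 - \<kappa> T powr (-1/6)\<close>, inside
  a zero-free region obtained from \<open>3 + 4 cos + cos 2\<close>. Such a weak region suffices
  since \<open>X T powr (-1/6) = sqrt X\<close> tends to infinity, and it only needs the trivial bound \<open>\<zeta>(s) = O(\<bar>s\<bar> powr (1/30))\<close>
  near the line \<open>Re s = 1\<close>. As \<open>\<psi>\<close> is monotone, the averages centred at \<open>X + 1/X\<close> and \<open>X - 1/X\<close> bound
  \<open>\<psi>(e\<^sup>X)\<close> from both sides.
\<close>

section \<open>Dirichlet series\<close>

text \<open>The parameters are tied together as follows. A relative error of order
  \<open>1 / X\<close> in \<open>psi (exp X)\<close> is all that is wanted, so the centre of the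
  normal density may be displaced by \<open>1 / X\<close>. Monotonicity then needs the mass on the
  wrong side of \<open>X\<close> to beat factors exponential in \<open>X\<close>; width
  \<open>1 / X^2\<close> makes the displacement \<open>X\<close> standard deviations and leaves
  \<open>exp (- X^2 / 2)\<close>. On the transform side the Gaussian has width \<open>X^2\<close>,
  so height \<open>X^3\<close> again leaves \<open>exp\<close> of a negative multiple of
  \<open>X^2\<close>, enough against \<open>exp (3 * X)\<close>. If zeta and its derivative grow
  like \<open>T powr e\<close>, the zero-free width is of order \<open>T powr (- 5 * e)\<close>, and
  at \<open>T = X^3\<close> the contour saves a factor
  \<open>exp (- kappa * X powr (1 - 15 * e))\<close>; every \<open>e < 1/15\<close> would do, and
  \<open>1/30\<close> makes the exponent of \<open>X\<close> equal to \<open>1/2\<close>. In the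
  last section, \<open>1 / ln n\<close> is not uniformly within \<open>O (1 / (ln y)^2)\<close> of
  \<open>1 / ln y\<close>, only on average over \<open>n <= y\<close>; this dictates the splitting
  at \<open>sqrt y\<close> and the weight \<open>1 / sqrt n\<close>.\<close>

definition dirichlet_series :: "(nat \<Rightarrow> real) \<Rightarrow> complex \<Rightarrow> complex" where
  "dirichlet_series a s = (\<Sum>n. of_real (a n) * of_nat n powr (-s))"

text \<open>Valid at \<open>n = 0\<close> too, because \<open>0 powr s = 0\<close>; hence a
  Dirichlet series can be summed from \<open>n = 0\<close> although its terms start at
  \<open>n = 1\<close>.\<close>

lemma norm_nat_powr: "norm (of_nat n powr s :: complex) = real n powr Re s"
  by (cases "n = 0") (simp_all add: norm_powr_real_powr)

text \<open>The exponent exceeds 1 by \<open>2 * e\<close>: one \<open>e\<close> absorbs the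
  logarithm, the other keeps the series convergent.\<close>

lemma ln_mult_powr_le:
  assumes "e > 0"
  shows "ln (real n) * real n powr (-(1 + 2 * e)) \<le> (1 / e) * real n powr (-(1 + e))"
proof (cases "n = 0")
  case False
  then have "ln (real n) \<le> real n powr e / e"
    using assms by (intro ln_powr_bound) auto
  then have "ln (real n) * real n powr (-(1 + 2 * e)) \<le> real n powr e / e * real n powr (-(1 + 2 * e))"
    by (intro mult_right_mono) auto
  also have "\<dots> = (1 / e) * real n powr (-(1 + e))"
    by (simp add: powr_add[symmetric] algebra_simps)
  finally show ?thesis .
qed auto

lemma summable_ln_powr:
  assumes "s > 1"
  shows "summable (\<lambda>n. ln (real n) * real n powr (-s))"
proof (rule summable_comparison_test)
  define e where "e = (s - 1) / 2"
  have e: "e > 0" "s = 1 + 2 * e" using assms by (auto simp: e_def field_simps)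
  show "summable (\<lambda>n. (1 / e) * real n powr (-(1 + e)))"
    using e by (intro summable_mult) (simp add: summable_real_powr_iff)
  show "\<exists>N. \<forall>n\<ge>N. norm (ln (real n) * real n powr (-s)) \<le> (1 / e) * real n powr (-(1 + e))"
  proof (intro exI[of _ 1] allI impI)
    fix n :: nat assume "n \<ge> 1"
    then show "norm (ln (real n) * real n powr (-s)) \<le> (1 / e) * real n powr (-(1 + e))"
      using ln_mult_powr_le[OF e(1), of n] unfolding e(2)
      by (subst real_norm_def, subst abs_of_nonneg) auto
  qed
qed

lemma summable_norm_dirichlet:
  assumes "\<And>n. \<bar>a n\<bar> \<le> 1" "Re s > 1"
  shows "summable (\<lambda>n. norm (of_real (a n) * of_nat n powr (-s) :: complex))"
proof (rule summable_comparison_test)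
  show "summable (\<lambda>n. real n powr (- Re s))"
    using assms by (simp add: summable_real_powr_iff)
  show "\<exists>N. \<forall>n\<ge>N. norm (norm (of_real (a n) * of_nat n powr (-s) :: complex)) \<le> real n powr (- Re s)"
    using mult_right_mono[OF assms(1) powr_ge_zero] by (auto simp: norm_mult norm_nat_powr)
qed

lemma summable_norm_dirichlet_deriv:
  assumes "\<And>n. \<bar>a n\<bar> \<le> 1" "Re s > 1"
  shows "summable (\<lambda>n. norm (of_real (a n * ln (real n)) * of_nat n powr (-s) :: complex))"
proof (rule summable_comparison_test)
  show "summable (\<lambda>n. ln (real n) * real n powr (- Re s))"
    using assms(2) by (rule summable_ln_powr)
  have "norm (norm (of_real (a n * ln (real n)) * of_nat n powr (-s) :: complex)) \<le> ln (real n) * real n powr (- Re s)"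
    if "n \<ge> 1" for n
  proof -
    have "norm (norm (of_real (a n * ln (real n)) * of_nat n powr (-s) :: complex)) =
       \<bar>a n\<bar> * (ln (real n) * real n powr (- Re s))"
      using that by (simp add: norm_mult norm_nat_powr abs_mult)
    also have "\<dots> \<le> 1 * (ln (real n) * real n powr (- Re s))"
      using that by (intro mult_right_mono assms) auto
    finally show ?thesis by simp
  qed
  then show "\<exists>N. \<forall>n\<ge>N. norm (norm (of_real (a n * ln (real n)) * of_nat n powr (-s) :: complex)) \<le> ln (real n) * real n powr (- Re s)"
    by blast
qed

text \<open>Termwise differentiation by locally uniform convergence. The hypothesis on
  \<open>a\<close> covers the two series that matter: the constant 1, whose derivative carries
  \<open>ln n\<close>, and \<open>log_coeff\<close>, whose derivative carries the von Mangoldt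
  function.\<close>

lemma dirichlet_series_has_field_derivative:
  assumes a: "\<And>n. \<bar>a n\<bar> \<le> 1" and s: "Re s > 1"
  shows "(dirichlet_series a has_field_derivative - dirichlet_series (\<lambda>n. a n * ln (real n)) s) (at s)"
proof -
  define f where "f = (\<lambda>n s. of_real (a n) * of_nat n powr (-s) :: complex)"
  define f' where "f' = (\<lambda>n s. - (of_real (a n * ln (real n)) * of_nat n powr (-s)) :: complex)"
  have d: "(f n has_field_derivative f' n z) (at z)" for n z
  proof (cases "n = 0")
    case False
    then show ?thesis unfolding f_def f'_def
      by (auto intro!: derivative_eq_intros DERIV_chain2[OF has_field_derivative_powr_right, where g = uminus, simplified o_def])
  qed (auto simp: f_def f'_def)
  have op: "open {z::complex. Re z > 1}" by (rule open_halfspace_Re_gt)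
  have "\<exists>d h. 0 < d \<and> summable h \<and> range h \<subseteq> \<real>\<^sub>\<ge>\<^sub>0 \<and>
     (\<forall>\<^sub>F n in sequentially. \<forall>y\<in>ball x d \<inter> {z. Re z > 1}. cmod (f n y) \<le> cmod (h n))"
    if x: "x \<in> {z. Re z > 1}" for x
  proof -
    \<comment> \<open>Half the distance to the line \<open>Re = 1\<close>: on the ball every
      abscissa stays at least \<open>1 + e\<close>.\<close>
    define e where "e = (Re x - 1) / 2"
    have e: "e > 0" using x by (auto simp: e_def)
    define h where "h = (\<lambda>n. complex_of_real (real n powr (-(1 + e))))"
    have "summable (\<lambda>n. real n powr (-(1 + e)))"
      using e by (simp add: summable_real_powr_iff)
    then have "summable h" unfolding h_def by (rule summable_of_real)
    moreover have "cmod (f n y) \<le> cmod (h n)" if "y \<in> ball x e" "n > 0" for n y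
    proof -
      have "\<bar>Re y - Re x\<bar> < e"
        using that(1) abs_Re_le_cmod[of "x - y"] by (auto simp: dist_norm)
      then have y: "Re y \<ge> 1 + e" unfolding e_def by (simp add: abs_if field_simps split: if_splits)
      have "cmod (f n y) = \<bar>a n\<bar> * real n powr (- Re y)"
        by (simp add: f_def norm_mult norm_nat_powr)
      also have "\<dots> \<le> 1 * real n powr (-(1 + e))"
        using a y that(2) by (intro mult_mono powr_mono) auto
      finally show ?thesis by (simp add: h_def)
    qed
    ultimately show ?thesis using e
      by (intro exI[of _ e] exI[of _ h] conjI eventually_mono[OF eventually_gt_at_top[of 0]])
         (auto simp: h_def)
  qed
  from series_and_derivative_comparison_complex[OF op d this]
  obtain g g' where g: "\<forall>x\<in>{z. Re z > 1}. (\<lambda>n. f n x) sums g x \<and> (\<lambda>n. f' n x) sums g' x \<and>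
      (g has_field_derivative g' x) (at x)"
    by auto
  have eq: "g x = dirichlet_series a x" if "Re x > 1" for x
    using g that unfolding dirichlet_series_def f_def by (auto simp: sums_iff)
  have "summable (\<lambda>n. of_real (a n * ln (real n)) * of_nat n powr (-s) :: complex)"
    by (rule summable_norm_cancel[OF summable_norm_dirichlet_deriv[OF a s]])
  then have "g' s = - dirichlet_series (\<lambda>n. a n * ln (real n)) s"
    using g s suminf_minus[of "\<lambda>n. of_real (a n * ln (real n)) * of_nat n powr (-s) :: complex"]
    unfolding dirichlet_series_def f'_def by (auto simp: sums_iff)
  moreover have "(g has_field_derivative g' s) (at s)" using g s by auto
  ultimately show ?thesis
    by (metis (no_types, lifting) eq s op mem_Collect_eq has_field_derivative_transform_within_open)
qed

text \<open>Fixes the constant of integration in \<open>zeta_eq_exp\<close>. For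
  \<open>n >= 2\<close> and \<open>x >= 2\<close> a term is at most \<open>2 powr (2 - x)\<close>
  times \<open>n powr (-2)\<close>, so the whole tail dies with the first factor.\<close>

lemma dirichlet_series_tendsto_1:
  assumes a: "\<And>n. \<bar>a n\<bar> \<le> 1"
  shows "((\<lambda>x. dirichlet_series a (of_real x)) \<longlongrightarrow> of_real (a 1)) at_top"
proof -
  define C where "C = (\<Sum>n. real n powr (-2))"
  have sC: "summable (\<lambda>n. real n powr (-2))" by (simp add: summable_real_powr_iff)
  have bnd: "norm (dirichlet_series a (of_real x) - of_real (a 1)) \<le> C * 2 powr (2 - x)" if x: "x \<ge> 2" for x
  proof -
    let ?f = "\<lambda>n. of_real (a n) * of_nat n powr (- of_real x) :: complex"
    have sn: "summable (\<lambda>n. norm (?f n))"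
      using summable_norm_dirichlet[OF a, of "of_real x"] x by simp
    have "dirichlet_series a (of_real x) = (\<Sum>n. ?f (n + 2)) + (\<Sum>n<2. ?f n)"
      unfolding dirichlet_series_def by (rule suminf_split_initial_segment[OF summable_norm_cancel[OF sn]])
    then have "dirichlet_series a (of_real x) - of_real (a 1) = (\<Sum>n. ?f (n + 2))"
      by (simp add: numeral_2_eq_2)
    also have "norm \<dots> \<le> (\<Sum>n. norm (?f (n + 2)))"
      by (rule summable_norm) (use sn in \<open>subst summable_iff_shift\<close>)
    also have "\<dots> \<le> (\<Sum>n. 2 powr (2 - x) * real (n + 2) powr (-2))"
    proof (rule suminf_le)
      fix n
      have "norm (?f (n + 2)) = \<bar>a (n + 2)\<bar> * real (n + 2) powr (- x)"
        unfolding norm_mult norm_nat_powr by simp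
      also have "\<dots> \<le> 1 * real (n + 2) powr (- x)"
        by (intro mult_right_mono a) auto
      also have "\<dots> = real (n + 2) powr (2 - x) * real (n + 2) powr (-2)"
        by (simp add: powr_add[symmetric])
      also have "\<dots> \<le> 2 powr (2 - x) * real (n + 2) powr (-2)"
        using x by (intro mult_right_mono powr_mono2') auto
      finally show "norm (?f (n + 2)) \<le> 2 powr (2 - x) * real (n + 2) powr (-2)" .
    next
      show "summable (\<lambda>n. norm (?f (n + 2)))" using sn by (subst summable_iff_shift)
      show "summable (\<lambda>n. 2 powr (2 - x) * real (n + 2) powr (-2))"
        using sC by (intro summable_mult) (subst summable_iff_shift)
    qed
    also have "\<dots> = 2 powr (2 - x) * (\<Sum>n. real (n + 2) powr (-2))"
      using sC by (intro suminf_mult) (subst summable_iff_shift)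
    also have "(\<Sum>n. real (n + 2) powr (-2)) \<le> C"
      unfolding C_def using suminf_split_initial_segment[OF sC, of 2] by (simp add: sum_nonneg)
    finally show ?thesis by (simp add: mult_ac)
  qed
  have "((\<lambda>x. C * 2 powr (2 - x)) \<longlongrightarrow> 0) at_top"
    by real_asymp
  then have "((\<lambda>x. dirichlet_series a (of_real x) - of_real (a 1)) \<longlongrightarrow> 0) at_top"
    by (rule Lim_null_comparison[rotated]) (use bnd in \<open>auto intro: eventually_mono[OF eventually_ge_at_top[of 2]]\<close>)
  then show ?thesis by (simp add: LIM_zero_iff)
qed

section \<open>The von Mangoldt function and the logarithm of zeta\<close>

abbreviation vonm :: "nat \<Rightarrow> real" where "vonm \<equiv> mangoldt"

text \<open>The coefficients of \<open>log zeta\<close>: \<open>1 / k\<close> at a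
  \<open>k\<close>-th power of a prime, 0 elsewhere. At \<open>n = 0\<close> and
  \<open>n = 1\<close> the denominator is 0 and so is the quotient, by the convention for division
  by zero.\<close>

definition log_coeff :: "nat \<Rightarrow> real" where "log_coeff n = vonm n / ln (real n)"

lemma log_coeff_nonneg: "log_coeff n \<ge> 0"
proof (cases "n = 0")
  case False
  then show ?thesis by (simp add: log_coeff_def mangoldt_nonneg)
qed (simp add: log_coeff_def)

lemma log_coeff_abs_le_1: "\<bar>log_coeff n\<bar> \<le> 1"
proof (cases "n \<le> 1")
  case False
  then show ?thesis
    using mangoldt_le[of n] log_coeff_nonneg[of n] by (simp add: log_coeff_def mangoldt_nonneg)
next
  case True then have "n = 0 \<or> n = 1" by auto
  then show ?thesis by (auto simp: log_coeff_def)
qed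

lemma log_coeff_mult_ln: "log_coeff n * ln (real n) = vonm n"
proof (cases "n \<le> 1")
  case True then have "n = 0 \<or> n = 1" by auto
  then show ?thesis by (auto simp: log_coeff_def)
qed (simp add: log_coeff_def)

lemma summable_norm_mangoldt:
  assumes "Re s > 1"
  shows "summable (\<lambda>n. norm (of_real (vonm n) * of_nat n powr (-s) :: complex))"
  using summable_norm_dirichlet_deriv[of log_coeff, OF log_coeff_abs_le_1 assms] by (simp only: log_coeff_mult_ln)

text \<open>The divisor sum of \<open>vonm\<close> is \<open>ln\<close>, here turned into a product
  of series. Absolute convergence of both factors allows the pairs \<open>(d, e)\<close> to be
  regrouped by their product \<open>d * e\<close>. The index 0 is left out, since its set of
  divisors is infinite.\<close>

lemma mangoldt_dirichlet_convolution:
  assumes s: "Re s > 1"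
  shows "dirichlet_series vonm s * dirichlet_series (\<lambda>_. 1) s = dirichlet_series (\<lambda>n. ln (real n)) s"
proof -
  define A where "A = {0::nat<..}"
  define f where "f = (\<lambda>n. of_real (vonm n) * of_nat n powr (-s) :: complex)"
  define g where "g = (\<lambda>n. of_real 1 * of_nat n powr (-s) :: complex)"
  have sf: "summable (\<lambda>n. norm (f n))" unfolding f_def by (rule summable_norm_mangoldt[OF s])
  have sg: "summable (\<lambda>n. norm (g n))" unfolding g_def by (rule summable_norm_dirichlet) (use s in auto)
  have 0: "f 0 = 0" "g 0 = 0" by (auto simp: f_def g_def)
  have F: "(f has_sum dirichlet_series vonm s) A"
    using norm_summable_imp_has_sum[OF sf summable_sums[OF summable_norm_cancel[OF sf]]] 0
    unfolding dirichlet_series_def f_def[symmetric]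
    by (subst has_sum_cong_neutral[where T = UNIV and f = f and g = f]) (auto simp: A_def)
  have G: "(g has_sum dirichlet_series (\<lambda>_. 1) s) A"
    using norm_summable_imp_has_sum[OF sg summable_sums[OF summable_norm_cancel[OF sg]]] 0
    unfolding dirichlet_series_def g_def[symmetric]
    by (subst has_sum_cong_neutral[where T = UNIV and f = g and g = g]) (auto simp: A_def)
  have nf: "(\<lambda>n. norm (f n)) summable_on A"
    using norm_summable_imp_summable_on[of "\<lambda>n. norm (f n)"] sf
    by (auto intro: summable_on_subset)
  have ng: "(\<lambda>n. norm (g n)) summable_on A"
    using norm_summable_imp_summable_on[of "\<lambda>n. norm (g n)"] sg
    by (auto intro: summable_on_subset)
  define h where "h = (\<lambda>(d, e). f d * g e)"
  have "(\<lambda>x. norm (h x)) summable_on A \<times> A"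
    unfolding Infinite_Sum.abs_summable_on_Sigma_iff h_def
    using nf ng by (auto simp: norm_mult infsum_cmult_right' abs_mult abs_of_nonneg infsum_nonneg
        intro!: summable_on_cmult_right summable_on_cmult_left)
  then have "h summable_on A \<times> A" by (rule abs_summable_summable)
  then have "(h has_sum (dirichlet_series vonm s * dirichlet_series (\<lambda>_. 1) s)) (A \<times> A)"
    using has_sum_cmult_right[OF G] has_sum_cmult_left[OF F]
    by (intro has_sum_SigmaI[where g = "\<lambda>d. f d * dirichlet_series (\<lambda>_. 1) s"]) (auto simp: h_def)
  also have "?this \<longleftrightarrow> ((\<lambda>(n, d). h (d, n div d)) has_sum (dirichlet_series vonm s * dirichlet_series (\<lambda>_. 1) s))
     (SIGMA n:A. {d. d dvd n})"
    by (rule has_sum_reindex_bij_witness[where j = "\<lambda>(d, e). (d * e, d)" and i = "\<lambda>(n, d). (d, n div d)"])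
       (auto simp: A_def)
  finally have "((\<lambda>n. of_real (ln (real n)) * of_nat n powr (-s)) has_sum
     (dirichlet_series vonm s * dirichlet_series (\<lambda>_. 1) s)) A"
  proof (rule has_sum_SigmaD)
    fix n assume n: "n \<in> A"
    have "((\<lambda>d. case (n, d) of (n, d) \<Rightarrow> h (d, n div d)) has_sum (\<Sum>d | d dvd n. h (d, n div d))) {d. d dvd n}"
      using n by (auto simp: A_def intro!: has_sum_finite)
    also have "(\<Sum>d | d dvd n. h (d, n div d)) = (\<Sum>d | d dvd n. of_real (vonm d) * of_nat n powr (-s))"
    proof (rule sum.cong)
      fix d assume "d \<in> {d. d dvd n}"
      then obtain e where e: "n = d * e" by auto
      then have "d > 0" "e > 0" using n by (auto simp: A_def)
      moreover have "(of_real (real d) * of_real (real e)) powr (-s) =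
         of_real (real d) powr (-s) * of_real (real e) powr (-s :: complex)"
        by (rule powr_times_real) auto
      ultimately show "h (d, n div d) = of_real (vonm d) * of_nat n powr (-s)"
        using e by (simp add: h_def f_def g_def)
    qed auto
    also have "\<dots> = of_real (\<Sum>d | d dvd n. vonm d) * of_nat n powr (-s)"
      by (simp add: sum_distrib_right)
    also have "(\<Sum>d | d dvd n. vonm d) = ln (real n)"
      using n mangoldt_sum[of n, where ?'a = real] by (auto simp: A_def)
    finally show "((\<lambda>d. case (n, d) of (n, d) \<Rightarrow> h (d, n div d)) has_sum
       of_real (ln (real n)) * of_nat n powr (-s)) {d. d dvd n}" .
  qed
  then have "((\<lambda>n. of_real (ln (real n)) * of_nat n powr (-s)) has_sum
     (dirichlet_series vonm s * dirichlet_series (\<lambda>_. 1) s)) UNIV"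
    by (subst has_sum_cong_neutral[where T = A]) (auto simp: A_def)
  then show ?thesis
    unfolding dirichlet_series_def by (auto dest!: has_sum_imp_sums simp: sums_iff)
qed

text \<open>Both sides solve \<open>f' = - f \<cdot> (\<Sum>n. \<Lambda>(n) n powr (-s))\<close> and tend to \<open>1\<close> as \<open>s\<close> tends to infinity along the reals.\<close>
lemma zeta_eq_exp:
  assumes s: "Re s > 1"
  shows "dirichlet_series (\<lambda>_. 1) s = exp (dirichlet_series log_coeff s)"
proof -
  let ?Z = "dirichlet_series (\<lambda>_. 1)" and ?L = "dirichlet_series log_coeff"
  let ?S = "{s::complex. Re s > 1}"
  define h where "h = (\<lambda>s. ?Z s * exp (- ?L s))"
  have "(h has_field_derivative 0) (at z)" if "Re z > 1" for z
  proof -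
    have "(?Z has_field_derivative - (dirichlet_series vonm z * ?Z z)) (at z)"
      using dirichlet_series_has_field_derivative[of "\<lambda>_. 1" z] that
      by (simp add: mangoldt_dirichlet_convolution)
    moreover have "(?L has_field_derivative - dirichlet_series vonm z) (at z)"
      using dirichlet_series_has_field_derivative[of log_coeff z] that
      by (simp add: log_coeff_mult_ln log_coeff_abs_le_1)
    ultimately show ?thesis unfolding h_def
      by (auto intro!: derivative_eq_intros simp: algebra_simps)
  qed
  then have "\<exists>c. \<forall>z\<in>?S. h z = c"
    by (intro has_field_derivative_zero_constant convex_halfspace_Re_gt)
       (auto intro: has_field_derivative_at_within)
  then obtain c where c: "\<And>z. Re z > 1 \<Longrightarrow> h z = c" by auto
  have "((\<lambda>x. h (of_real x)) \<longlongrightarrow> of_real 1 * exp (- of_real (log_coeff 1))) at_top"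
    unfolding h_def by (intro tendsto_intros dirichlet_series_tendsto_1 log_coeff_abs_le_1) auto
  moreover have "((\<lambda>x. h (of_real x)) \<longlongrightarrow> c) at_top"
    by (rule tendsto_eventually) (auto intro!: eventually_mono[OF eventually_gt_at_top[of 1]] c)
  ultimately have "c = of_real 1 * exp (- of_real (log_coeff 1))"
    by (intro tendsto_unique[of at_top]) auto
  then have "h s = 1" using c[OF s] by (simp add: log_coeff_def)
  then show ?thesis by (simp add: h_def exp_minus field_simps)
qed

text \<open>The weights 3, 4, 1 combine the real parts of \<open>log zeta\<close> into one series of
  nonnegative terms, a square times \<open>log_coeff n\<close>. The power 4 against 3 is the point:
  a pole of order 3 at the real point cannot compensate a zero of order 4.\<close>

lemma zeta_341:
  fixes x t :: real
  assumes x: "x > 1"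
  shows "norm (dirichlet_series (\<lambda>_. 1) (of_real x)) ^ 3 * norm (dirichlet_series (\<lambda>_. 1) (Complex x t)) ^ 4 *
     norm (dirichlet_series (\<lambda>_. 1) (Complex x (2 * t))) \<ge> 1"
proof -
  have Re_series: "(\<lambda>n. log_coeff n * real n powr (-x) * cos (y * ln (real n))) sums Re (dirichlet_series log_coeff (Complex x y))" for y
  proof -
    have "(\<lambda>n. of_real (log_coeff n) * of_nat n powr (- Complex x y)) sums dirichlet_series log_coeff (Complex x y)"
      unfolding dirichlet_series_def using x
      by (intro summable_sums summable_norm_cancel[OF summable_norm_dirichlet] log_coeff_abs_le_1) auto
    then have "(\<lambda>n. Re (of_real (log_coeff n) * of_nat n powr (- Complex x y))) sums Re (dirichlet_series log_coeff (Complex x y))"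
      by (rule sums_Re)
    moreover have "Re (of_real (log_coeff n) * of_nat n powr (- Complex x y)) = log_coeff n * real n powr (-x) * cos (y * ln (real n))" for n
    proof (cases "n = 0")
      case False
      then have "of_nat n powr (- Complex x y) = exp (Complex (-x * ln (real n)) (- y * ln (real n)))"
        by (auto simp: powr_def Complex_eq algebra_simps)
      then show ?thesis using False
        by (simp add: Re_exp powr_def)
    qed (auto simp: log_coeff_def)
    ultimately show ?thesis by (simp only:)
  qed
  have "(\<lambda>n. 3 * (log_coeff n * real n powr (-x) * cos (0 * ln (real n))) + 4 * (log_coeff n * real n powr (-x) * cos (t * ln (real n)))
     + log_coeff n * real n powr (-x) * cos (2 * t * ln (real n))) sums
     (3 * Re (dirichlet_series log_coeff (Complex x 0)) + 4 * Re (dirichlet_series log_coeff (Complex x t))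
     + Re (dirichlet_series log_coeff (Complex x (2 * t))))"
    by (intro sums_add sums_mult Re_series)
  moreover have "3 * (log_coeff n * real n powr (-x) * cos (0 * ln (real n))) + 4 * (log_coeff n * real n powr (-x) * cos (t * ln (real n)))
     + log_coeff n * real n powr (-x) * cos (2 * t * ln (real n)) = log_coeff n * real n powr (-x) * (2 * (1 + cos (t * ln (real n)))\<^sup>2)" for n
  proof -
    have c: "cos (2 * t * ln (real n)) = 2 * (cos (t * ln (real n)))\<^sup>2 - 1"
      using cos_double_cos[of "t * ln (real n)"] by (simp add: mult.assoc)
    have "3 * (Q * 1) + 4 * (Q * C) + Q * (2 * C\<^sup>2 - 1) = Q * (2 * (1 + C)\<^sup>2)" for Q C :: real
    proof -
      have "2 * (1 + C)\<^sup>2 = 3 + 4 * C + (2 * C\<^sup>2 - 1)" by (simp add: power2_sum)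
      then have "Q * (2 * (1 + C)\<^sup>2) = Q * (3 + 4 * C + (2 * C\<^sup>2 - 1))" by (rule arg_cong)
      also have "\<dots> = Q * 3 + Q * (4 * C) + Q * (2 * C\<^sup>2 - 1)" by (simp only: distrib_left)
      finally show ?thesis by (simp only: mult_ac mult_1_left mult_1_right)
    qed
    from this[of "log_coeff n * real n powr (-x)" "cos (t * ln (real n))"]
    show ?thesis unfolding c by (simp only: mult_zero_left cos_zero)
  qed
  ultimately have "(\<lambda>n. log_coeff n * real n powr (-x) * (2 * (1 + cos (t * ln (real n)))\<^sup>2)) sums
     (3 * Re (dirichlet_series log_coeff (Complex x 0)) + 4 * Re (dirichlet_series log_coeff (Complex x t))
     + Re (dirichlet_series log_coeff (Complex x (2 * t))))" by (simp only:)
  then have "0 \<le> 3 * Re (dirichlet_series log_coeff (Complex x 0)) + 4 * Re (dirichlet_series log_coeff (Complex x t))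
     + Re (dirichlet_series log_coeff (Complex x (2 * t)))"
    by (rule sums_le[OF _ sums_zero, rotated]) (intro mult_nonneg_nonneg log_coeff_nonneg; simp)
  then have "1 \<le> exp (3 * Re (dirichlet_series log_coeff (Complex x 0)) + 4 * Re (dirichlet_series log_coeff (Complex x t))
     + Re (dirichlet_series log_coeff (Complex x (2 * t))))" by simp
  also have "\<dots> = exp (Re (dirichlet_series log_coeff (Complex x 0))) ^ 3 * exp (Re (dirichlet_series log_coeff (Complex x t))) ^ 4
     * exp (Re (dirichlet_series log_coeff (Complex x (2 * t))))"
    by (simp add: exp_add exp_of_nat_mult[symmetric])
  finally show ?thesis using x by (simp add: zeta_eq_exp norm_exp_eq_Re complex_of_real_def)
qed

section \<open>Analytic continuation of the zeta function\<close>

text \<open>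
  \<open>(s - 1) \<zeta>(s)\<close> by Euler--Maclaurin: the \<open>n\<close>-th term is \<open>s - 1\<close> times the integral of
  \<open>k powr (-s) - u powr (-s)\<close> over \<open>k \<le> u \<le> k + 1\<close>, where \<open>k = n + 1\<close>. Multiplying by \<open>s - 1\<close> makes every
  term entire.
\<close>
definition zeta_reg_term :: "nat \<Rightarrow> complex \<Rightarrow> complex" where
  "zeta_reg_term n s = (s - 1) * of_nat (Suc n) powr (-s) - of_nat (Suc n) powr (1 - s) + of_nat (Suc (Suc n)) powr (1 - s)"

text \<open>The leading 1 is \<open>s - 1\<close> times the integral of \<open>u powr (-s)\<close>
  over \<open>u >= 1\<close>, which the terms have subtracted.\<close>

definition zeta_reg :: "complex \<Rightarrow> complex" where
  "zeta_reg s = 1 + (\<Sum>n. zeta_reg_term n s)"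

lemma norm_real_powr:
  assumes "u > 0"
  shows "norm (of_real u powr s :: complex) = u powr Re s"
  using assms by (subst norm_powr_real_powr) auto

lemma powr_neg_diff_bound:
  fixes k u :: real
  assumes k: "k > 0" and u: "k \<le> u" "u \<le> k + 1" and s: "Re s > 0"
  shows "norm (of_real k powr (-s) - of_real u powr (-s) :: complex) \<le> norm s * k powr (- Re s - 1)"
proof -
  let ?S = "closed_segment (of_real k) (of_real u) :: complex set"
  have "norm (of_real k powr (-s) - of_real u powr (-s) :: complex) \<le>
     (norm s * k powr (- Re s - 1)) * norm (of_real k - of_real u :: complex)"
  proof (rule field_differentiable_bound[where S = ?S])
    fix z assume "z \<in> ?S"
    then obtain v where v: "z = of_real v" "v \<in> {k..u}"
      using u by (auto simp: closed_segment_of_real closed_segment_eq_real_ivl)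
    then have z: "z \<notin> \<real>\<^sub>\<le>\<^sub>0" using k by auto
    show "((\<lambda>z. z powr (-s)) has_field_derivative (-s) * z powr (- s - 1)) (at z within ?S)"
      using z by (rule has_field_derivative_at_within[OF has_field_derivative_powr])
    have "norm ((-s) * z powr (- s - 1)) = norm s * v powr (- Re s - 1)"
      using v k by (simp add: norm_mult norm_real_powr)
    also have "\<dots> \<le> norm s * k powr (- Re s - 1)"
      using v k s by (intro mult_left_mono powr_mono2') auto
    finally show "norm ((-s) * z powr (- s - 1)) \<le> norm s * k powr (- Re s - 1)" .
  qed auto
  also have "\<dots> \<le> (norm s * k powr (- Re s - 1)) * 1"
    using u by (intro mult_left_mono) (auto simp flip: of_real_diff)
  finally show ?thesis by simp
qed

text \<open>Interpolates between the mean value bound, good for \<open>k >= norm s\<close>, and the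
  trivial bound by the sum of the norms, good for smaller \<open>k\<close>. A small \<open>a\<close>
  gives up decay in \<open>k\<close> for slow growth in \<open>s\<close>; the growth exponent
  \<open>1/30\<close> of zeta originates here.\<close>

lemma powr_neg_diff_bound_interpolated:
  fixes k u a :: real
  assumes k: "k > 0" and u: "k \<le> u" "u \<le> k + 1" and s: "Re s > 0" and a: "0 \<le> a" "a \<le> 1"
  shows "norm (of_real k powr (-s) - of_real u powr (-s) :: complex) \<le> 2 * norm s powr a * k powr (- Re s - a)"
proof (cases "norm s \<le> k")
  case True
  have s0: "norm s > 0" using s by auto
  have e: "1 - a + (- Re s - 1) = - Re s - a" by simp
  have "norm (of_real k powr (-s) - of_real u powr (-s) :: complex) \<le> norm s * k powr (- Re s - 1)"
    by (rule powr_neg_diff_bound) fact+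
  also have "\<dots> = norm s powr a * norm s powr (1 - a) * k powr (- Re s - 1)"
    using s0 by (simp add: powr_add[symmetric])
  also have "\<dots> \<le> norm s powr a * k powr (1 - a) * k powr (- Re s - 1)"
    using a True by (intro mult_right_mono mult_left_mono powr_mono2) auto
  also have "\<dots> = norm s powr a * k powr (- Re s - a)"
    by (simp only: mult.assoc powr_add[symmetric] e)
  also have "\<dots> \<le> 2 * norm s powr a * k powr (- Re s - a)" by simp
  finally show ?thesis .
next
  case False
  have e2: "a + (- Re s - a) = - Re s" by simp
  have "norm (of_real k powr (-s) - of_real u powr (-s) :: complex) \<le>
      norm (of_real k powr (-s) :: complex) + norm (of_real u powr (-s) :: complex)"
    by (rule norm_triangle_ineq4)
  also have "\<dots> = k powr (- Re s) + u powr (- Re s)" using k u by (simp add: norm_real_powr)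
  also have "u powr (- Re s) \<le> k powr (- Re s)"
    using k u s by (intro powr_mono2') auto
  also have "k powr (- Re s) + k powr (- Re s) = 2 * k powr a * k powr (- Re s - a)"
    by (simp only: mult.assoc powr_add[symmetric] e2)
  also have "\<dots> \<le> 2 * norm s powr a * k powr (- Re s - a)"
    using False a k by (intro mult_right_mono mult_left_mono powr_mono2) auto
  finally show ?thesis by simp
qed

text \<open>The term is the increment from \<open>k\<close> to \<open>k + 1\<close> of the auxiliary
  \<open>g\<close>, whose derivative is \<open>s - 1\<close> times the difference just estimated.
  With this primitive a mean value inequality takes the place of an integral.\<close>

lemma norm_zeta_reg_term_le:
  assumes s: "Re s > 0" and a: "0 \<le> a" "a \<le> 1"
  shows "norm (zeta_reg_term n s) \<le> 2 * norm (s - 1) * norm s powr a * real (Suc n) powr (- Re s - a)"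
proof -
  define k where "k = real (Suc n)"
  have k: "k > 0" by (simp add: k_def)
  let ?S = "closed_segment (of_real k) (of_real (k + 1)) :: complex set"
  define g where "g = (\<lambda>z. (s - 1) * (z - of_real k) * of_real k powr (-s) + z powr (1 - s) :: complex)"
  have "norm (g (of_real (k + 1)) - g (of_real k)) \<le>
     (2 * norm (s - 1) * norm s powr a * k powr (- Re s - a)) * norm (of_real (k + 1) - of_real k :: complex)"
  proof (rule field_differentiable_bound[where S = ?S])
    fix z assume "z \<in> ?S"
    then obtain v where v: "z = of_real v" "v \<in> {k..k+1}"
      by (auto simp: closed_segment_of_real closed_segment_eq_real_ivl simp del: of_real_add)
    then have z: "z \<notin> \<real>\<^sub>\<le>\<^sub>0" using k by auto
    show "(g has_field_derivative (s - 1) * (of_real k powr (-s) - z powr (-s))) (at z within ?S)"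
      unfolding g_def using z
      by (auto intro!: derivative_eq_intros has_field_derivative_at_within[OF has_field_derivative_powr]
          simp: algebra_simps)
    have "norm ((s - 1) * (of_real k powr (-s) - z powr (-s))) =
       norm (s - 1) * norm (of_real k powr (-s) - of_real v powr (-s) :: complex)"
      using v by (simp add: norm_mult)
    also have "\<dots> \<le> norm (s - 1) * (2 * norm s powr a * k powr (- Re s - a))"
      using v k s a by (intro mult_left_mono powr_neg_diff_bound_interpolated) auto
    finally show "norm ((s - 1) * (of_real k powr (-s) - z powr (-s))) \<le> 2 * norm (s - 1) * norm s powr a * k powr (- Re s - a)"
      by (simp add: mult_ac)
  qed auto
  moreover have "g (of_real (k + 1)) - g (of_real k) = zeta_reg_term n s"
    by (simp add: g_def zeta_reg_term_def k_def add_ac)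
  ultimately show ?thesis by (simp add: k_def)
qed

lemma summable_Suc_powr:
  assumes "s > 1"
  shows "summable (\<lambda>n. real (Suc n) powr (-s))"
  using assms by (subst summable_Suc_iff) (simp add: summable_real_powr_iff)

lemma summable_norm_zeta_reg_term:
  assumes "Re s > 0"
  shows "summable (\<lambda>n. norm (zeta_reg_term n s))"
proof (rule summable_comparison_test)
  show "\<exists>N. \<forall>n\<ge>N. norm (norm (zeta_reg_term n s)) \<le> 2 * norm (s - 1) * norm s powr 1 * real (Suc n) powr (- (Re s + 1))"
    using norm_zeta_reg_term_le[of s 1] assms by auto
  show "summable (\<lambda>n. 2 * norm (s - 1) * norm s powr 1 * real (Suc n) powr (- (Re s + 1)))"
    using assms by (intro summable_mult summable_Suc_powr) auto
qed

text \<open>One half of \<open>a\<close> pays for going left of the line \<open>Re s = 1\<close>,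
  the other half keeps the sum over \<open>n\<close> convergent.\<close>

lemma norm_zeta_reg_le:
  assumes a: "0 < a" "a \<le> 1" and s: "Re s \<ge> 1 - a / 2"
  shows "norm (zeta_reg s) \<le> 1 + 2 * norm (s - 1) * norm s powr a * (\<Sum>n. real (Suc n) powr (-(1 + a / 2)))"
proof -
  have s0: "Re s > 0" using a s by auto
  have sm: "summable (\<lambda>n. real (Suc n) powr (-(1 + a / 2)))"
    using a by (intro summable_Suc_powr) auto
  have "norm (zeta_reg s) \<le> 1 + norm (\<Sum>n. zeta_reg_term n s)"
    unfolding zeta_reg_def by (rule order.trans[OF norm_triangle_ineq]) simp
  also have "norm (\<Sum>n. zeta_reg_term n s) \<le> (\<Sum>n. norm (zeta_reg_term n s))"
    by (rule summable_norm[OF summable_norm_zeta_reg_term[OF s0]])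
  also have "\<dots> \<le> (\<Sum>n. 2 * norm (s - 1) * norm s powr a * real (Suc n) powr (-(1 + a / 2)))"
  proof (rule suminf_le)
    fix n
    have "norm (zeta_reg_term n s) \<le> 2 * norm (s - 1) * norm s powr a * real (Suc n) powr (- Re s - a)"
      using a s0 by (intro norm_zeta_reg_term_le) auto
    also have "\<dots> \<le> 2 * norm (s - 1) * norm s powr a * real (Suc n) powr (-(1 + a / 2))"
      using s by (intro mult_left_mono powr_mono) auto
    finally show "norm (zeta_reg_term n s) \<le> 2 * norm (s - 1) * norm s powr a * real (Suc n) powr (-(1 + a / 2))" .
  qed (use sm in \<open>auto intro!: summable_norm_zeta_reg_term s0 summable_mult\<close>)
  also have "\<dots> = 2 * norm (s - 1) * norm s powr a * (\<Sum>n. real (Suc n) powr (-(1 + a / 2)))"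
    by (rule suminf_mult[OF sm])
  finally show ?thesis by simp
qed

lemma zeta_reg_holomorphic: "zeta_reg holomorphic_on {s. Re s > 0}"
proof -
  let ?S = "{s::complex. Re s > 0}"
  have op: "open ?S" by (rule open_halfspace_Re_gt)
  have d: "zeta_reg_term n field_differentiable (at x)" for n x
  proof -
    have "zeta_reg_term n holomorphic_on UNIV" unfolding zeta_reg_term_def by (intro holomorphic_intros)
    then show ?thesis by (simp add: holomorphic_on_def)
  qed
  have "\<exists>d h. 0 < d \<and> summable h \<and> range h \<subseteq> \<real>\<^sub>\<ge>\<^sub>0 \<and>
     (\<forall>\<^sub>F n in sequentially. \<forall>y\<in>ball x d \<inter> ?S. cmod (zeta_reg_term n y) \<le> cmod (h n))"
    if x: "x \<in> ?S" for x
  proof -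
    define e where "e = Re x / 2"
    define R where "R = norm x + e"
    have e: "e > 0" using x by (auto simp: e_def)
    define h where "h = (\<lambda>n. complex_of_real (2 * (R + 1) * R * real (Suc n) powr (-(1 + e))))"
    have "summable h" unfolding h_def using e
      by (intro summable_of_real summable_mult summable_Suc_powr) auto
    moreover have "cmod (zeta_reg_term n y) \<le> cmod (h n)" if "y \<in> ball x e" for n y
    proof -
      have dy: "norm (x - y) < e" using that by (auto simp: dist_norm)
      have "\<bar>Re y - Re x\<bar> < e"
        using dy abs_Re_le_cmod[of "x - y"] by auto
      then have y: "Re y \<ge> e" unfolding e_def by (simp add: abs_if field_simps split: if_splits)
      have yR: "norm y \<le> R" using dy norm_triangle_sub[of y x] by (simp add: R_def norm_minus_commute)
      have y1R: "norm (y - 1) \<le> R + 1" using yR norm_triangle_ineq4[of y 1] by simp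
      have "cmod (zeta_reg_term n y) \<le> 2 * norm (y - 1) * norm y powr 1 * real (Suc n) powr (- Re y - 1)"
        using y e by (intro norm_zeta_reg_term_le) auto
      also have "\<dots> \<le> 2 * (R + 1) * R * real (Suc n) powr (-(1 + e))"
        using y yR y1R e by (intro mult_mono powr_mono) (auto simp: R_def)
      finally show ?thesis unfolding h_def norm_of_real by linarith
    qed
    moreover have "range h \<subseteq> \<real>\<^sub>\<ge>\<^sub>0"
      using e by (auto simp: h_def R_def simp del: of_real_mult of_real_add)
    ultimately show ?thesis using e
      by (intro exI[of _ e] exI[of _ h] conjI always_eventually) auto
  qed
  from series_differentiable_comparison_complex[OF op d this]
  obtain g where g: "\<forall>x\<in>?S. (\<lambda>n. zeta_reg_term n x) sums g x \<and> g field_differentiable (at x)"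
    by auto
  have "(\<lambda>s. 1 + g s) holomorphic_on ?S"
    using g by (intro holomorphic_intros) (auto simp: holomorphic_on_def intro: field_differentiable_at_within)
  moreover have "1 + g s = zeta_reg s" if "s \<in> ?S" for s
    using g that by (auto simp: zeta_reg_def sums_iff)
  ultimately show ?thesis using holomorphic_transform by blast
qed

lemma zeta_reg_1 [simp]: "zeta_reg 1 = 1"
proof -
  have "zeta_reg_term n 1 = 0" for n by (simp add: zeta_reg_term_def del: of_nat_Suc)
  then show ?thesis by (simp add: zeta_reg_def)
qed

lemma zeta_reg_eq_series:
  assumes s: "Re s > 1"
  shows "zeta_reg s = (s - 1) * dirichlet_series (\<lambda>_. 1) s"
proof -
  have sm: "summable (\<lambda>n. of_nat n powr (-s) :: complex)"
    using summable_norm_cancel[OF summable_norm_dirichlet[of "\<lambda>_. 1" s]] s by simp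
  have "(\<lambda>n. of_nat (Suc n) powr (-s)) sums (dirichlet_series (\<lambda>_. 1) s)"
    using summable_sums[OF sm] by (subst sums_Suc_iff) (simp add: dirichlet_series_def)
  then have 1: "(\<lambda>n. (s - 1) * of_nat (Suc n) powr (-s)) sums ((s - 1) * dirichlet_series (\<lambda>_. 1) s)"
    by (rule sums_mult)
  have "((\<lambda>n. real (Suc n) powr (1 - Re s)) \<longlongrightarrow> 0) sequentially"
    using s by real_asymp
  moreover have "norm (of_nat (Suc n) powr (1 - s) :: complex) = real (Suc n) powr (1 - Re s)" for n
    by (subst norm_nat_powr) simp
  ultimately have "(\<lambda>n. of_nat (Suc n) powr (1 - s) :: complex) \<longlonglongrightarrow> 0"
    by (intro tendsto_norm_zero_cancel[of "\<lambda>n. of_nat (Suc n) powr (1 - s) :: complex"]) (simp only:)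
  from telescope_sums[OF this]
  have 2: "(\<lambda>n. of_nat (Suc (Suc n)) powr (1 - s) - of_nat (Suc n) powr (1 - s) :: complex) sums (-1)" by simp
  have "zeta_reg_term n s = (s - 1) * of_nat (Suc n) powr (-s) + (of_nat (Suc (Suc n)) powr (1 - s) - of_nat (Suc n) powr (1 - s))" for n
    by (simp add: zeta_reg_term_def)
  then have "(\<lambda>n. zeta_reg_term n s) sums ((s - 1) * dirichlet_series (\<lambda>_. 1) s + (-1))"
    using sums_add[OF 1 2] by (simp only:)
  then show ?thesis by (simp add: zeta_reg_def sums_iff)
qed

section \<open>A zero-free region\<close>

definition zeta :: "complex \<Rightarrow> complex" where "zeta s = zeta_reg s / (s - 1)"

lemma zeta_holomorphic: "zeta holomorphic_on ({s. Re s > 0} - {1})"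
  unfolding zeta_def
  by (intro holomorphic_intros holomorphic_on_subset[OF zeta_reg_holomorphic]) auto

lemma zeta_eq_series: "Re s > 1 \<Longrightarrow> zeta s = dirichlet_series (\<lambda>_. 1) s"
  by (auto simp: zeta_def zeta_reg_eq_series)

lemma zeta_reg_nonzero_right: "Re s > 1 \<Longrightarrow> zeta_reg s \<noteq> 0"
  by (auto simp: zeta_reg_eq_series zeta_eq_exp)

text \<open>\<open>59/60\<close> is \<open>1 - a / 2\<close> for \<open>a = 1/30\<close>.\<close>

lemma zeta_reg_bound:
  obtains C where "C \<ge> 1" "\<And>s. Re s \<ge> 59/60 \<Longrightarrow> norm (zeta_reg s) \<le> 1 + C * norm (s - 1) * norm s powr (1/30)"
proof -
  define Z where "Z = (\<Sum>n. real (Suc n) powr (-(1 + (1/30::real) / 2)))"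
  have "norm (zeta_reg s) \<le> 1 + max 1 (2 * Z) * norm (s - 1) * norm s powr (1/30)" if "Re s \<ge> 59/60" for s
  proof -
    have "norm (zeta_reg s) \<le> 1 + 2 * norm (s - 1) * norm s powr (1/30) * Z"
      unfolding Z_def using that by (intro norm_zeta_reg_le) auto
    also have "2 * norm (s - 1) * norm s powr (1/30) * Z = (2 * Z) * (norm (s - 1) * norm s powr (1/30))"
      by simp
    also have "\<dots> \<le> max 1 (2 * Z) * (norm (s - 1) * norm s powr (1/30))"
      by (intro mult_right_mono) auto
    finally show ?thesis by (simp add: mult_ac)
  qed
  then show ?thesis by (intro that[of "max 1 (2 * Z)"]) auto
qed

text \<open>The pole of zeta forces a separate argument at low heights, and \<open>t\<close>
  separates the regimes: close to 1 the function \<open>zeta_reg\<close> is used directly, while for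
  \<open>|Im s| >= t\<close> the factor \<open>1 / (s - 1)\<close> is at most \<open>1 / t\<close>
  in norm. The cap \<open>1/240\<close> leaves room for later discs and widths inside
  \<open>Re s >= 59/60\<close>.\<close>

lemma zeta_reg_near_1:
  obtains t where "0 < t" "t \<le> 1/240" "\<And>s. s \<in> cball 1 (2 * t) \<Longrightarrow> norm (zeta_reg s - 1) \<le> 1 / 2"
proof -
  have "isCont zeta_reg 1"
    using holomorphic_on_imp_continuous_on[OF zeta_reg_holomorphic]
    by (auto simp: continuous_on_eq_continuous_at open_halfspace_Re_gt)
  then obtain d where d: "d > 0" "\<And>s. dist s 1 < d \<Longrightarrow> dist (zeta_reg s) (zeta_reg 1) < 1/2"
    unfolding continuous_at_eps_delta by (metis half_gt_zero zero_less_one)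
  show ?thesis
  proof (rule that[of "min (d / 4) (1/240)"])
    fix s :: complex assume "s \<in> cball 1 (2 * min (d / 4) (1/240))"
    then have "dist s 1 < d" using d(1) by (auto simp: dist_commute)
    then show "norm (zeta_reg s - 1) \<le> 1 / 2" using d(2)[of s] by (auto simp: dist_norm)
  qed (use d in auto)
qed

text \<open>The height is written as \<open>p ^ 30\<close> so that \<open>\<bar>s\<bar> powr (1/30)\<close> is comparable to the polynomial \<open>p\<close>.\<close>
lemma zeta_bounds:
  assumes t: "0 < t" "t \<le> 1/240"
  obtains C1 C2 where "C1 \<ge> 1" "C2 \<ge> 1"
    "\<And>p s. p \<ge> 1 \<Longrightarrow> Re s \<ge> 59/60 \<Longrightarrow> Re s \<le> 4 \<Longrightarrow> \<bar>Im s\<bar> \<ge> t / 2 \<Longrightarrow> \<bar>Im s\<bar> \<le> 2 * p ^ 30 + 1 \<Longrightarrow> norm (zeta s) \<le> C1 * p"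
    "\<And>p s. p \<ge> 1 \<Longrightarrow> Re s \<ge> 119/120 \<Longrightarrow> Re s \<le> 3 \<Longrightarrow> \<bar>Im s\<bar> \<ge> t \<Longrightarrow> \<bar>Im s\<bar> \<le> p ^ 30 \<Longrightarrow> norm (deriv zeta s) \<le> C2 * p"
proof -
  obtain C where C: "C \<ge> 1" "\<And>s. Re s \<ge> 59/60 \<Longrightarrow> norm (zeta_reg s) \<le> 1 + C * norm (s - 1) * norm s powr (1/30)"
    using zeta_reg_bound by blast
  define C1 where "C1 = 2 / t + 7 * C"
  have C1: "C1 \<ge> 1" using t C by (auto simp: C1_def field_simps intro: add_increasing)
  have z: "norm (zeta s) \<le> C1 * p"
    if p: "p \<ge> 1" and s: "Re s \<ge> 59/60" "Re s \<le> 4" "\<bar>Im s\<bar> \<ge> t / 2" "\<bar>Im s\<bar> \<le> 2 * p ^ 30 + 1" for p s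
  proof -
    have s1: "norm (s - 1) \<ge> t / 2" using abs_Im_le_cmod[of "s - 1"] s by simp
    have p30: "p ^ 30 \<ge> 1" using p by (rule one_le_power)
    have "norm s \<le> \<bar>Re s\<bar> + \<bar>Im s\<bar>" by (rule cmod_le)
    also have "\<dots> \<le> 7 * p ^ 30" using s p30 by simp
    also have "\<dots> \<le> (7 * p) ^ 30" using p by (simp add: power_mult_distrib)
    finally have "norm s powr (1/30) \<le> ((7 * p) ^ 30) powr (1/30)"
      by (intro powr_mono2) auto
    also have "\<dots> = 7 * p"
    proof -
      have "(q ^ 30) powr (1/30) = q" if "q > 0" for q :: real
      proof -
        have "(q ^ 30) powr (1/30) = (q powr 30) powr (1/30)" using that by simp
        also have "\<dots> = q powr 1" by (simp only: powr_powr) simp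
        finally show ?thesis using that by simp
      qed
      from this[of "7 * p"] show ?thesis using p by linarith
    qed
    finally have sp: "norm s powr (1/30) \<le> 7 * p" .
    have s10: "norm (s - 1) > 0" using s1 t by linarith
    have "norm (zeta s) = norm (zeta_reg s) / norm (s - 1)" by (simp add: zeta_def norm_divide)
    also have "\<dots> \<le> (1 + C * norm (s - 1) * norm s powr (1/30)) / norm (s - 1)"
      using s by (intro divide_right_mono C) auto
    also have "\<dots> = 1 / norm (s - 1) + C * norm s powr (1/30)"
      using s10 by (simp add: add_divide_distrib)
    also have "\<dots> \<le> 1 / (t / 2) + C * (7 * p)"
      using s1 sp t C by (intro add_mono divide_left_mono mult_left_mono mult_pos_pos) auto
    also have "\<dots> \<le> 2 / t * p + C * (7 * p)"
      using p t mult_left_mono[of 1 p "2 / t"] by simp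
    also have "\<dots> = C1 * p" by (simp add: C1_def algebra_simps)
    finally show ?thesis .
  qed
  \<comment> \<open>From Cauchy's inequality on the disc of radius \<open>t / 2\<close>. Its circle
    still satisfies \<open>|Im x| >= t / 2\<close>, which is why zeta was bounded on a wider range
    than its derivative; the doubled height in that range serves the point \<open>2 * t\<close> of
    \<open>zeta_341\<close>.\<close>
  define C2 where "C2 = C1 * 2 / t"
  have "C2 \<ge> 1" using C1 t mult_mono[of 1 C1 1 "2 / t"] by (auto simp: C2_def)
  moreover have "norm (deriv zeta s) \<le> C2 * p"
    if p: "p \<ge> 1" and s: "Re s \<ge> 119/120" "Re s \<le> 3" "\<bar>Im s\<bar> \<ge> t" "\<bar>Im s\<bar> \<le> p ^ 30" for p s
  proof -
    have p30: "p ^ 30 \<ge> 1" using p by (rule one_le_power)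
    have range: "\<bar>Re x - Re s\<bar> \<le> t / 2 \<and> \<bar>Im x - Im s\<bar> \<le> t / 2" if "x \<in> cball s (t / 2)" for x
      using abs_Re_le_cmod[of "x - s"] abs_Im_le_cmod[of "x - s"] that
      by (auto simp: dist_norm norm_minus_commute)
    have sub: "cball s (t / 2) \<subseteq> {s. Re s > 0} - {1}"
    proof
      fix x assume x: "x \<in> cball s (t / 2)"
      have "Re x > 0" using range[OF x] s t by linarith
      moreover have "Im x \<noteq> 0" using range[OF x] s t by (auto simp: abs_if split: if_splits)
      ultimately show "x \<in> {s. Re s > 0} - {1}" by auto
    qed
    then have hol: "zeta holomorphic_on (cball s (t / 2))"
      by (rule holomorphic_on_subset[OF zeta_holomorphic])
    have "norm ((deriv ^^ 1) zeta s) \<le> fact 1 * (C1 * p) / (t / 2) ^ 1"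
    proof (rule Cauchy_inequality)
      show "zeta holomorphic_on ball s (t / 2)" by (rule holomorphic_on_subset[OF hol]) auto
      show "continuous_on (cball s (t / 2)) zeta" by (rule holomorphic_on_imp_continuous_on[OF hol])
      show "0 < t / 2" using t by simp
      fix x assume "norm (s - x) = t / 2"
      then have x: "x \<in> cball s (t / 2)" by (simp add: dist_norm)
      have "Re x \<ge> 59/60" "Re x \<le> 4" using range[OF x] s t by linarith+
      moreover have "\<bar>Im x\<bar> \<ge> t / 2" "\<bar>Im x\<bar> \<le> 2 * p ^ 30 + 1"
        using range[OF x] s t p30 by linarith+
      ultimately show "norm (zeta x) \<le> C1 * p" by (intro z p)
    qed
    then show ?thesis by (simp add: C2_def field_simps)
  qed
  ultimately show ?thesis using that C1 z by blast
qed

text \<open>At distance \<open>w\<close> to the right of \<open>Re s = 1\<close>,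
  \<open>zeta_341\<close> gives \<open>norm (zeta s) ^ 4 >= w ^ 3 / (K * p)\<close>, a lower bound
  of order \<open>w powr (3/4) * p powr (-1/4)\<close>. Going left by at most \<open>2 * w\<close>
  changes zeta by order \<open>w * p\<close> at most. The two orders agree, at
  \<open>p powr (-4)\<close>, when \<open>w\<close> is of order \<open>p powr (-5)\<close>.\<close>

lemma zeta_lower_bound:
  assumes t: "0 < t" "t \<le> 1/240"
  obtains \<kappa> c C2 where "0 < \<kappa>" "\<kappa> \<le> t" "0 < c" "C2 \<ge> 1"
    "\<And>p s. p \<ge> 1 \<Longrightarrow> Re s \<ge> 1 - \<kappa> / p ^ 5 \<Longrightarrow> Re s \<le> 3 \<Longrightarrow> \<bar>Im s\<bar> \<ge> t \<Longrightarrow> \<bar>Im s\<bar> \<le> p ^ 30 \<Longrightarrow> norm (zeta s) \<ge> c / p ^ 4"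
    "\<And>p s. p \<ge> 1 \<Longrightarrow> Re s \<ge> 1 - \<kappa> / p ^ 5 \<Longrightarrow> Re s \<le> 3 \<Longrightarrow> \<bar>Im s\<bar> \<ge> t \<Longrightarrow> \<bar>Im s\<bar> \<le> p ^ 30 \<Longrightarrow> norm (deriv zeta s) \<le> C2 * p"
proof -
  obtain C where C: "C \<ge> 1" "\<And>s. Re s \<ge> 59/60 \<Longrightarrow> norm (zeta_reg s) \<le> 1 + C * norm (s - 1) * norm s powr (1/30)"
    using zeta_reg_bound by blast
  obtain C1 C2 where C12: "C1 \<ge> 1" "C2 \<ge> 1"
    and zb: "\<And>p s. p \<ge> 1 \<Longrightarrow> Re s \<ge> 59/60 \<Longrightarrow> Re s \<le> 4 \<Longrightarrow> \<bar>Im s\<bar> \<ge> t / 2 \<Longrightarrow> \<bar>Im s\<bar> \<le> 2 * p ^ 30 + 1 \<Longrightarrow> norm (zeta s) \<le> C1 * p"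
    and zd: "\<And>p s. p \<ge> 1 \<Longrightarrow> Re s \<ge> 119/120 \<Longrightarrow> Re s \<le> 3 \<Longrightarrow> \<bar>Im s\<bar> \<ge> t \<Longrightarrow> \<bar>Im s\<bar> \<le> p ^ 30 \<Longrightarrow> norm (deriv zeta s) \<le> C2 * p"
    using zeta_bounds[OF t] by blast
  \<comment> \<open>For \<open>1 < x <= 3\<close>, the bounds \<open>x - 1 <= 2\<close> and
    \<open>x powr (1/30) <= 3\<close> account for the 6.\<close>
  define C3 where "C3 = 1 + 6 * C"
  have C3: "C3 \<ge> 1" using C by (simp add: C3_def)
  define K where "K = C3 ^ 3 * C1"
  have K: "K \<ge> 1" using C3 C12 mult_mono[of 1 "C3 ^ 3" 1 C1] by (auto simp: K_def one_le_power)
  have real_bound: "norm (zeta (of_real x)) \<le> C3 / (x - 1)" if x: "1 < x" "x \<le> 3" for x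
  proof -
    have n1: "norm (of_real x - 1 :: complex) = x - 1"
      using x by (metis abs_of_pos diff_gt_0_iff_gt norm_of_real of_real_1 of_real_diff)
    have n2: "norm (of_real x :: complex) = x" using x by simp
    have "norm (zeta_reg (of_real x)) \<le> 1 + C * norm (of_real x - 1 :: complex) * norm (of_real x :: complex) powr (1/30)"
      using x by (intro C) auto
    then have "norm (zeta_reg (of_real x)) \<le> 1 + C * (x - 1) * x powr (1/30)"
      unfolding n1 n2 .
    also have "C * (x - 1) * x powr (1/30) \<le> (C * 2) * 3"
    proof (rule mult_mono)
      have "x powr (1/30) \<le> x powr 1" using x by (intro powr_mono) auto
      then show "x powr (1/30) \<le> 3" using x by simp
      show "C * (x - 1) \<le> C * 2" using x C by (intro mult_left_mono) auto
    qed (use C in auto)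
    finally have "norm (zeta_reg (of_real x)) \<le> C3" by (simp add: C3_def)
    moreover have "norm (zeta (of_real x)) = norm (zeta_reg (of_real x)) / (x - 1)"
      by (simp only: zeta_def norm_divide n1)
    ultimately show ?thesis using x by (simp add: divide_right_mono)
  qed
  have lower: "norm (zeta (Complex x y)) ^ 4 \<ge> (x - 1) ^ 3 / (K * p)"
    if p: "p \<ge> 1" and x: "1 < x" "x \<le> 3" and y: "\<bar>y\<bar> \<ge> t" "\<bar>y\<bar> \<le> p ^ 30" for x y p
  proof -
    have "1 \<le> norm (zeta (of_real x)) ^ 3 * norm (zeta (Complex x y)) ^ 4 * norm (zeta (Complex x (2 * y)))"
      using zeta_341[of x y] x by (simp add: zeta_eq_series)
    also have "\<dots> \<le> (C3 / (x - 1)) ^ 3 * norm (zeta (Complex x y)) ^ 4 * (C1 * p)"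
    proof (intro mult_mono power_mono real_bound)
      show "norm (zeta (Complex x (2 * y))) \<le> C1 * p"
        using x y p t by (intro zb) auto
    qed (use x C3 C12 in auto)
    also have "\<dots> = norm (zeta (Complex x y)) ^ 4 * (K * p) / (x - 1) ^ 3"
      by (simp add: K_def power_divide)
    finally have "1 * (x - 1) ^ 3 \<le> norm (zeta (Complex x y)) ^ 4 * (K * p)"
      using x by (subst (asm) pos_le_divide_eq) auto
    then show ?thesis using p K by (subst pos_divide_le_eq) auto
  qed
  \<comment> \<open>With \<open>\<kappa> = l\<^sup>4\<close>, the lower bound of order \<open>l\<^sup>3\<close> at distance \<open>\<kappa>/p\<^sup>5\<close> right of the line beats the variation of order \<open>l\<^sup>4\<close>.\<close>
  define l where "l = min (1 / (4 * C2 * K)) t"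
  have l: "l > 0" "l \<le> 1 / (4 * C2 * K)" "l \<le> t" using C12 K t by (auto simp: l_def)
  define \<kappa> where "\<kappa> = l ^ 4"
  define c where "c = l ^ 3 / (2 * K)"
  have l1: "l \<le> 1" using l t by simp
  have "\<kappa> > 0" using l by (simp add: \<kappa>_def)
  have "\<kappa> \<le> l" using power_decreasing[of 1 4 l] l1 l by (simp add: \<kappa>_def)
  have c: "c > 0" using l K by (simp add: c_def)
  \<comment> \<open>Compared as fourth powers: at the left end of the range both sides are
    \<open>l ^ 12 / p ^ 16\<close> up to powers of \<open>K\<close>, and \<open>K >= 1\<close>
    decides.\<close>
  have low: "norm (zeta s) \<ge> 2 * c / p ^ 4"
    if p: "p \<ge> 1" and s: "Re s \<ge> 1 + \<kappa> / p ^ 5" "Re s \<le> 3" "\<bar>Im s\<bar> \<ge> t" "\<bar>Im s\<bar> \<le> p ^ 30" for p s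
  proof (rule power_le_imp_le_base)
    have k0: "\<kappa> / p ^ 5 > 0" using \<open>\<kappa> > 0\<close> p by simp
    have "(2 * c / p ^ 4) ^ Suc 3 = (l ^ 3) ^ 4 / (K ^ 4 * (p ^ 4) ^ 4)"
      by (simp add: c_def power_divide power_mult_distrib)
    also have "\<dots> \<le> (l ^ 3) ^ 4 / (K ^ 1 * (p ^ 4) ^ 4)"
      using K l p by (intro divide_left_mono mult_right_mono power_increasing mult_pos_pos) auto
    also have "\<dots> = (\<kappa> / p ^ 5) ^ 3 / (K * p)"
      using p by (simp add: \<kappa>_def power_divide power_mult[symmetric] field_simps flip: power_add power_Suc)
    also have "\<dots> \<le> (Re s - 1) ^ 3 / (K * p)"
      using s k0 p K by (intro divide_right_mono power_mono) auto
    also have "\<dots> \<le> norm (zeta (Complex (Re s) (Im s))) ^ 4"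
      using s k0 p by (intro lower) auto
    finally show "(2 * c / p ^ 4) ^ Suc 3 \<le> norm (zeta s) ^ Suc 3" by simp
  qed auto
  have d: "norm (deriv zeta s) \<le> C2 * p"
    if p: "p \<ge> 1" and s: "Re s \<ge> 1 - \<kappa> / p ^ 5" "Re s \<le> 3" "\<bar>Im s\<bar> \<ge> t" "\<bar>Im s\<bar> \<le> p ^ 30" for p s
  proof -
    have "\<kappa> / p ^ 5 \<le> \<kappa>" using \<open>\<kappa> > 0\<close> p by (simp add: divide_le_eq one_le_power)
    then show ?thesis using s l t \<open>\<kappa> \<le> l\<close> by (intro zd p) auto
  qed
  have "norm (zeta s) \<ge> c / p ^ 4"
    if p: "p \<ge> 1" and s: "Re s \<ge> 1 - \<kappa> / p ^ 5" "Re s \<le> 3" "\<bar>Im s\<bar> \<ge> t" "\<bar>Im s\<bar> \<le> p ^ 30" for p s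
  proof (cases "Re s \<ge> 1 + \<kappa> / p ^ 5")
    case True
    then have "norm (zeta s) \<ge> 2 * c / p ^ 4" using s p by (intro low) auto
    moreover have "2 * c / p ^ 4 \<ge> c / p ^ 4" using c p by (intro divide_right_mono) auto
    ultimately show ?thesis by linarith
  next
    case False
    define w where "w = \<kappa> / p ^ 5"
    have w: "w > 0" using \<open>\<kappa> > 0\<close> p by (simp add: w_def)
    have "w \<le> \<kappa>" using \<open>\<kappa> > 0\<close> p by (simp add: w_def divide_le_eq one_le_power)
    then have w1: "w \<le> 1/240" using \<open>\<kappa> \<le> l\<close> l t by simp
    define s0 where "s0 = Complex (1 + w) (Im s)"
    let ?S = "closed_segment s s0"
    have seg: "Im z = Im s \<and> Re s \<le> Re z \<and> Re z \<le> 1 + w" if "z \<in> ?S" for z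
    proof -
      from that obtain u where u: "0 \<le> u" "u \<le> 1" "z = (1 - u) *\<^sub>R s + u *\<^sub>R s0"
        by (auto simp: closed_segment_def)
      have "Re z = Re s + u * (1 + w - Re s)" unfolding u(3) by (simp add: s0_def algebra_simps)
      moreover have "Im z = Im s" unfolding u(3) by (simp add: s0_def algebra_simps)
      moreover have "0 \<le> u * (1 + w - Re s)" using u False by (auto simp: w_def)
      moreover have "u * (1 + w - Re s) \<le> 1 * (1 + w - Re s)"
        using u False by (intro mult_right_mono) (auto simp: w_def)
      ultimately show ?thesis by simp
    qed
    have "norm (zeta s - zeta s0) \<le> (C2 * p) * norm (s - s0)"
    proof (rule field_differentiable_bound[where S = ?S])
      fix z assume z: "z \<in> ?S"
      have "Re z > 0" "Im z \<noteq> 0" using seg[OF z] s t w1 by (auto simp: w_def[symmetric])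
      then have "z \<in> {s. Re s > 0} - {1}" by auto
      moreover have "open ({s::complex. Re s > 0} - {1})" by (intro open_Diff open_halfspace_Re_gt) auto
      ultimately have "zeta field_differentiable (at z)"
        using zeta_holomorphic holomorphic_on_imp_differentiable_at by blast
      then show "(zeta has_field_derivative deriv zeta z) (at z within ?S)"
        by (rule has_field_derivative_at_within[OF DERIV_deriv_iff_field_differentiable[THEN iffD2]])
      show "norm (deriv zeta z) \<le> C2 * p"
        using seg[OF z] s p w1 by (intro d) (auto simp: w_def[symmetric])
    qed auto
    also have "norm (s - s0) = \<bar>Re s - (1 + w)\<bar>"
      by (simp add: s0_def cmod_def)
    also have "\<dots> \<le> 2 * w" using s False by (auto simp: w_def)
    finally have "norm (zeta s - zeta s0) \<le> (C2 * p) * (2 * w)"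
      using C12 p by (simp add: mult_left_mono)
    also have "(C2 * p) * (2 * w) = (2 * C2 * \<kappa>) / p ^ 4"
      using p by (simp add: w_def field_simps flip: power_Suc)
    \<comment> \<open>The bound \<open>l \<le> 1 / (4 * C2 * K)\<close> was chosen for this: the
      variation uses up only half of \<open>2 * c / p ^ 4\<close>.\<close>
    also have "2 * C2 * \<kappa> \<le> c"
    proof -
      have "2 * C2 * \<kappa> = 2 * C2 * l ^ 3 * l" by (simp add: \<kappa>_def power_numeral_reduce)
      also have "\<dots> \<le> 2 * C2 * l ^ 3 * (1 / (4 * C2 * K))"
        using l C12 by (intro mult_left_mono) auto
      also have "\<dots> = c" using C12 K by (simp add: c_def field_simps)
      finally show ?thesis .
    qed
    then have "(2 * C2 * \<kappa>) / p ^ 4 \<le> c / p ^ 4" using p by (intro divide_right_mono) auto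
    finally have 1: "norm (zeta s - zeta s0) \<le> c / p ^ 4" .
    have "norm (zeta s0) \<ge> 2 * c / p ^ 4"
      using s p w1 by (intro low) (auto simp: s0_def w_def[symmetric])
    moreover have "norm (zeta s0) \<le> norm (zeta s) + norm (zeta s - zeta s0)"
      using norm_triangle_sub[of "zeta s0" "zeta s"] by (simp add: norm_minus_commute)
    ultimately show ?thesis using 1 by linarith
  qed
  then show ?thesis using that[of \<kappa> c C2] \<open>\<kappa> > 0\<close> \<open>\<kappa> \<le> l\<close> l c C12 d by auto
qed

text \<open>The logarithmic derivative is bounded on the horizontal sides and the left side of the
  rectangle across which the contour moves; inside it, nonvanishing suffices. The summand 1 makes
  the bounded quantity \<open>- s * psi_transform s\<close>, and \<open>p ^ 5\<close> is the order
  of the quotient of \<open>C2 * p\<close> by \<open>c / p ^ 4\<close>.\<close>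

lemma zeta_reg_zero_free:
  obtains \<kappa> C where "0 < \<kappa>" "\<kappa> \<le> 1/240" "C \<ge> 0"
    "\<And>p s. p \<ge> 1 \<Longrightarrow> Re s \<ge> 1 - \<kappa> / p ^ 5 \<Longrightarrow> Re s \<le> 3 \<Longrightarrow> \<bar>Im s\<bar> \<le> p ^ 30 \<Longrightarrow> zeta_reg s \<noteq> 0"
    "\<And>p s. p \<ge> 1 \<Longrightarrow> Re s \<ge> 1 - \<kappa> / p ^ 5 \<Longrightarrow> Re s \<le> 3 \<Longrightarrow> \<bar>Im s\<bar> \<le> p ^ 30 \<Longrightarrow>
        \<bar>Im s\<bar> = p ^ 30 \<or> Re s = 1 - \<kappa> / p ^ 5 \<Longrightarrow> norm (deriv zeta_reg s / zeta_reg s + 1) \<le> C * p ^ 5"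
proof -
  obtain t where t: "0 < t" "t \<le> 1/240" and near: "\<And>s. s \<in> cball 1 (2 * t) \<Longrightarrow> norm (zeta_reg s - 1) \<le> 1 / 2"
    using zeta_reg_near_1 by blast
  obtain \<kappa> c C2 where \<kappa>: "0 < \<kappa>" "\<kappa> \<le> t" and c: "0 < c" and C2: "C2 \<ge> 1"
    and lower: "\<And>p s. p \<ge> 1 \<Longrightarrow> Re s \<ge> 1 - \<kappa> / p ^ 5 \<Longrightarrow> Re s \<le> 3 \<Longrightarrow> \<bar>Im s\<bar> \<ge> t \<Longrightarrow> \<bar>Im s\<bar> \<le> p ^ 30 \<Longrightarrow> norm (zeta s) \<ge> c / p ^ 4"
    and d: "\<And>p s. p \<ge> 1 \<Longrightarrow> Re s \<ge> 1 - \<kappa> / p ^ 5 \<Longrightarrow> Re s \<le> 3 \<Longrightarrow> \<bar>Im s\<bar> \<ge> t \<Longrightarrow> \<bar>Im s\<bar> \<le> p ^ 30 \<Longrightarrow> norm (deriv zeta s) \<le> C2 * p"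
    using zeta_lower_bound[OF t] by blast
  have sub: "cball 1 (2 * t) \<subseteq> {s::complex. Re s > 0}"
  proof
    fix s :: complex assume "s \<in> cball 1 (2 * t)"
    then have "\<bar>Re (s - 1)\<bar> \<le> 2 * t" using abs_Re_le_cmod[of "s - 1"] by (simp add: dist_norm norm_minus_commute)
    then show "s \<in> {s. Re s > 0}" using t by (auto simp: abs_if split: if_splits)
  qed
  have near0: "zeta_reg s \<noteq> 0" if "s \<in> cball 1 (2 * t)" for s using near[OF that] by auto
  have hd: "deriv zeta_reg holomorphic_on {s. Re s > 0}"
    by (rule holomorphic_deriv[OF zeta_reg_holomorphic open_halfspace_Re_gt])
  have c1: "continuous_on (cball 1 (2 * t)) (deriv zeta_reg)"
    by (rule holomorphic_on_imp_continuous_on[OF holomorphic_on_subset[OF hd sub]])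
  have c2: "continuous_on (cball 1 (2 * t)) zeta_reg"
    by (rule holomorphic_on_imp_continuous_on[OF holomorphic_on_subset[OF zeta_reg_holomorphic sub]])
  have "continuous_on (cball 1 (2 * t)) (\<lambda>s. deriv zeta_reg s / zeta_reg s + 1)"
    by (rule continuous_on_add[OF continuous_on_divide[OF c1 c2] continuous_on_const]) (use near0 in blast)
  then have "bounded ((\<lambda>s. deriv zeta_reg s / zeta_reg s + 1) ` cball 1 (2 * t))"
    by (intro compact_imp_bounded compact_continuous_image) auto
  then obtain C6 where "\<forall>z\<in>(\<lambda>s. deriv zeta_reg s / zeta_reg s + 1) ` cball 1 (2 * t). norm z \<le> C6"
    unfolding bounded_iff by (rule exE)
  then have C6: "\<And>s. s \<in> cball 1 (2 * t) \<Longrightarrow> norm (deriv zeta_reg s / zeta_reg s + 1) \<le> C6"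
    by (rule bspec) (rule imageI)
  have inball: "s \<in> cball 1 (2 * t)" if "\<bar>Im s\<bar> < t" "Re s \<le> 1" "Re s \<ge> 1 - \<kappa> / p ^ 5" "p \<ge> 1" for s p
  proof -
    have "\<kappa> / p ^ 5 \<le> \<kappa>" using \<kappa> that by (simp add: divide_le_eq one_le_power)
    then have "\<bar>Re (s - 1)\<bar> \<le> t" using that \<kappa> by auto
    then show ?thesis using cmod_le[of "s - 1"] that by (simp add: dist_norm norm_minus_commute)
  qed
  have nz: "zeta_reg s \<noteq> 0" if "p \<ge> 1" "Re s \<ge> 1 - \<kappa> / p ^ 5" "Re s \<le> 3" "\<bar>Im s\<bar> \<le> p ^ 30" for p s
  proof (cases "\<bar>Im s\<bar> \<ge> t")
    case True
    have "0 < c / p ^ 4" using c that by simp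
    also have "c / p ^ 4 \<le> norm (zeta s)" by (rule lower) (use that True in auto)
    finally show ?thesis by (auto simp: zeta_def)
  next
    case False
    then show ?thesis using inball[of s p] that near0[of s] zeta_reg_nonzero_right[of s]
      by (cases "Re s \<le> 1") auto
  qed
  \<comment> \<open>The maximum covers the disc around 1, by compactness; the bracket covers heights
    from \<open>t\<close> on, with one summand each for \<open>1 / (s - 1)\<close>,
    \<open>zeta'/zeta\<close> and 1.\<close>
  define C where "C = max 0 C6 + (1 / t + C2 / c + 1)"
  have C: "C \<ge> 0" using t c C2 by (auto simp: C_def)
  have "norm (deriv zeta_reg s / zeta_reg s + 1) \<le> C * p ^ 5"
    if p: "p \<ge> 1" and s: "Re s \<ge> 1 - \<kappa> / p ^ 5" "Re s \<le> 3" "\<bar>Im s\<bar> \<le> p ^ 30"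
      "\<bar>Im s\<bar> = p ^ 30 \<or> Re s = 1 - \<kappa> / p ^ 5" for p s
  proof (cases "\<bar>Im s\<bar> \<ge> t")
    case True
    have p5: "p ^ 5 \<ge> 1" using p by (rule one_le_power)
    have "\<kappa> / p ^ 5 \<le> \<kappa>" using \<kappa> p by (simp add: divide_le_eq one_le_power)
    then have s0: "Re s > 0" using s \<kappa> t by simp
    have im: "Im s \<noteq> 0" using True t by auto
    then have s1: "s \<noteq> 1" by auto
    have "0 < c / p ^ 4" using c p by simp
    also have low: "c / p ^ 4 \<le> norm (zeta s)" by (rule lower) (use p s True in auto)
    finally have z0: "zeta s \<noteq> 0" by auto
    have "s \<in> {s. Re s > 0} - {1}" using s0 s1 by auto
    moreover have op: "open ({s::complex. Re s > 0} - {1})" by (intro open_Diff open_halfspace_Re_gt) auto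
    ultimately have "zeta field_differentiable (at s)"
      using zeta_holomorphic holomorphic_on_imp_differentiable_at by blast
    then have dz: "(zeta has_field_derivative deriv zeta s) (at s)"
      by (simp add: DERIV_deriv_iff_field_differentiable)
    have "((\<lambda>s. (s - 1) * zeta s) has_field_derivative zeta s + (s - 1) * deriv zeta s) (at s)"
      by (auto intro!: derivative_eq_intros dz)
    then have "(zeta_reg has_field_derivative zeta s + (s - 1) * deriv zeta s) (at s)"
      by (rule has_field_derivative_transform_within_open[OF _ op]) (use s0 s1 in \<open>auto simp: zeta_def\<close>)
    then have 1: "deriv zeta_reg s = zeta s + (s - 1) * deriv zeta s" by (rule DERIV_imp_deriv)
    have 2: "zeta_reg s = (s - 1) * zeta s" using s1 by (simp add: zeta_def)
    have "(zeta s + (s - 1) * deriv zeta s) / ((s - 1) * zeta s) = 1 / (s - 1) + deriv zeta s / zeta s"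
      using s1 z0 by (simp add: add_divide_distrib)
    then have "deriv zeta_reg s / zeta_reg s + 1 = 1 / (s - 1) + deriv zeta s / zeta s + 1"
      by (simp only: 1 2)
    also have "norm \<dots> \<le> norm (1 / (s - 1)) + norm (deriv zeta s / zeta s) + norm (1::complex)"
      by (intro order.trans[OF norm_triangle_ineq] add_right_mono norm_triangle_ineq)
    also have "norm (1 / (s - 1)) \<le> 1 / t"
      using True t abs_Im_le_cmod[of "s - 1"] by (auto simp: norm_divide intro!: divide_left_mono mult_pos_pos)
    also have "norm (deriv zeta s / zeta s) \<le> (C2 * p) / (c / p ^ 4)"
      unfolding norm_divide using p s True low c C2 z0
      by (intro frac_le d) auto
    also have "(C2 * p) / (c / p ^ 4) = C2 / c * p ^ 5"
      by (simp add: field_simps flip: power_Suc)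
    also have "1 / t + C2 / c * p ^ 5 + norm (1::complex) \<le> (1 / t + C2 / c + 1) * p ^ 5"
      using mult_left_mono[OF p5, of "1 / t + 1"] t by (simp add: algebra_simps)
    also have "\<dots> \<le> C * p ^ 5" using p by (intro mult_right_mono) (auto simp: C_def)
    finally show ?thesis by simp
  next
    case False
    have p5: "p ^ 5 \<ge> 1" using p by (rule one_le_power)
    \<comment> \<open>Below height \<open>t\<close> only the left side of the rectangle remains, as
      its horizontal sides are at height at least 1; that portion lies in the disc where
      \<open>C6\<close> applies.\<close>
    have "p ^ 30 \<ge> 1" using p by (rule one_le_power)
    then have "Re s = 1 - \<kappa> / p ^ 5" using False s t by auto
    moreover have "\<kappa> / p ^ 5 \<ge> 0" using \<kappa> p by auto
    ultimately have "s \<in> cball 1 (2 * t)" using False p by (intro inball[of s p]) auto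
    then have "norm (deriv zeta_reg s / zeta_reg s + 1) \<le> C6" by (rule C6)
    also have "C6 \<le> C" using t c C2 by (auto simp: C_def intro!: add_increasing2)
    also have "C \<le> C * p ^ 5" using C p5 mult_left_mono[of 1 "p ^ 5" C] by simp
    finally show ?thesis .
  qed
  then show ?thesis using that[of \<kappa> C] \<kappa> t C nz by auto
qed

section \<open>The smoothed Chebyshev function\<close>

definition psi :: "real \<Rightarrow> real" where "psi x = (\<Sum>n | real n \<le> x. vonm n)"

lemma finite_nat_le: "finite {n. real n \<le> x}"
  by (rule finite_subset[of _ "{..nat \<lfloor>x\<rfloor>}"]) (auto simp: le_nat_floor)

lemma psi_mono: "x \<le> y \<Longrightarrow> psi x \<le> psi y"
  unfolding psi_def by (intro sum_mono2 finite_nat_le) (auto simp: mangoldt_nonneg)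

lemma psi_nonneg: "psi x \<ge> 0"
  unfolding psi_def by (intro sum_nonneg mangoldt_nonneg)

text \<open>Far from sharp; it compares \<open>psi (exp v)\<close> with \<open>exp (2 * v)\<close>,
  which a normal density absorbs, and disposes of small arguments of \<open>theta\<close>.\<close>

lemma psi_le_square: 
  assumes "x \<ge> 0" shows "psi x \<le> x\<^sup>2"
proof -
  have eq: "{n. real n \<le> x \<and> n > 0} = {1..nat \<lfloor>x\<rfloor>}"
    using assms by (auto simp: le_nat_iff le_floor_iff)
  have "psi x = (\<Sum>n | real n \<le> x \<and> n > 0. vonm n)"
    unfolding psi_def by (intro sum.mono_neutral_right finite_nat_le) (auto intro!: Nat.gr0I)
  also have "\<dots> \<le> (\<Sum>n | real n \<le> x \<and> n > 0. x)"
  proof (rule sum_mono)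
    fix n assume n: "n \<in> {n. real n \<le> x \<and> n > 0}"
    then have "vonm n \<le> ln (real n)" by (intro mangoldt_le) auto
    also have "\<dots> \<le> real n" using n ln_bound[of "real n"] by auto
    finally show "vonm n \<le> x" using n by auto
  qed
  also have "\<dots> = of_int \<lfloor>x\<rfloor> * x" using assms by (simp add: eq)
  also have "\<dots> \<le> x * x" using assms by (intro mult_right_mono) auto
  finally show ?thesis by (simp add: power2_eq_square)
qed

text \<open>Substituting \<open>t = x / d\<close> leaves the characteristic function of the standard
  normal law at \<open>y\<close>, and completing the square gives the value. It does not depend on
  \<open>c\<close>, in agreement with the freedom to move the line of integration.\<close>

lemma gaussian_fourier:
  fixes b c d :: real
  assumes d: "d > 0"
  shows "(CLBINT t. exp ((of_real c + \<i> * of_real t) * of_real b + of_real (d\<^sup>2) * (of_real c + \<i> * of_real t)\<^sup>2 / 2))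
     = of_real (2 * pi * normal_density b d 0)"
proof -
  let ?h = "\<lambda>t. exp ((of_real c + \<i> * of_real t) * of_real b + of_real (d\<^sup>2) * (of_real c + \<i> * of_real t)\<^sup>2 / 2) :: complex"
  define y where "y = (b + d\<^sup>2 * c) / d"
  define K where "K = exp (c * b + d\<^sup>2 * c\<^sup>2 / 2) * sqrt (2 * pi)"
  have "char std_normal_distribution y = (CLBINT x. std_normal_density x *\<^sub>R iexp (y * x))"
    unfolding char_def by (subst integral_density) auto
  then have ch: "(CLBINT x. std_normal_density x *\<^sub>R iexp (y * x)) = of_real (exp (- (y\<^sup>2) / 2))"
    by (simp add: char_std_normal_distribution)
  have h: "?h (0 + 1 / d * x) = of_real K * (std_normal_density x *\<^sub>R iexp (y * x))" for x
  proof -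
    have "(of_real c + \<i> * of_real (0 + 1 / d * x)) * of_real b + of_real (d\<^sup>2) * (of_real c + \<i> * of_real (0 + 1 / d * x))\<^sup>2 / 2
       = of_real (c * b + d\<^sup>2 * c\<^sup>2 / 2) + of_real (- x\<^sup>2 / 2) + \<i> * of_real (y * x)"
      using d by (simp add: complex_eq_iff y_def power2_eq_square field_simps)
    then have "?h (0 + 1 / d * x) = of_real (exp (c * b + d\<^sup>2 * c\<^sup>2 / 2)) * of_real (exp (- x\<^sup>2 / 2)) * iexp (y * x)"
      by (simp only: exp_add exp_of_real)
    also have "\<dots> = of_real K * (std_normal_density x *\<^sub>R iexp (y * x))"
      by (simp add: K_def std_normal_density_def scaleR_conv_of_real)
    finally show ?thesis .
  qed
  have "(CLBINT t. ?h t) = \<bar>1 / d\<bar> *\<^sub>R (CLBINT x. ?h (0 + 1 / d * x))"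
    using d by (intro lborel_integral_real_affine) auto
  also have "\<dots> = (1 / d) *\<^sub>R (of_real K * of_real (exp (- (y\<^sup>2) / 2)))"
    using d by (simp only: h integral_mult_right_zero ch abs_of_pos divide_pos_pos zero_less_one)
  also have "\<dots> = of_real (1 / d * (K * exp (- (y\<^sup>2) / 2)))"
    by (simp add: scaleR_conv_of_real)
  also have "1 / d * (K * exp (- (y\<^sup>2) / 2)) = sqrt (2 * pi) / d * exp (c * b + d\<^sup>2 * c\<^sup>2 / 2 + - (y\<^sup>2) / 2)"
    by (simp only: K_def exp_add) simp
  also have "c * b + d\<^sup>2 * c\<^sup>2 / 2 + - (y\<^sup>2) / 2 = - b\<^sup>2 / (2 * d\<^sup>2)"
    using d by (simp add: y_def power2_eq_square field_simps)
  also have "sqrt (2 * pi) / d * exp (- b\<^sup>2 / (2 * d\<^sup>2)) = 2 * pi * normal_density b d 0"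
    using d by (simp add: normal_density_def real_sqrt_mult field_simps)
  finally show ?thesis .
qed

lemma laplace_Ici:
  assumes z: "Re z > 0"
  shows "integrable lborel (\<lambda>v. indicator {a..} v *\<^sub>R exp (- z * of_real v))"
    and "(CLBINT v. indicator {a..} v *\<^sub>R exp (- z * of_real v)) = exp (- z * of_real a) / z"
    and "(LBINT v. norm (indicator {a..} v *\<^sub>R exp (- z * of_real v) :: complex)) = exp (- Re z * a) / Re z"
proof -
  have "(\<integral>\<^sup>+v. ennreal (exp (- Re z * v)) * indicator {a..} v \<partial>lborel) = ennreal (0 - (- exp (- Re z * a) / Re z))"
  proof (rule nn_integral_FTC_atLeast)
    show "((\<lambda>v. - exp (- Re z * v) / Re z) \<longlongrightarrow> 0) at_top"
      using z by real_asymp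
  qed (use z in \<open>auto intro!: derivative_eq_intros\<close>)
  then have "(\<integral>\<^sup>+v. ennreal (exp (- Re z * v) * indicator {a..} v) \<partial>lborel) = ennreal (exp (- Re z * a) / Re z)"
    by (simp add: ennreal_mult' ennreal_indicator)
  then have 1: "has_bochner_integral lborel (\<lambda>v. exp (- Re z * v) * indicator {a..} v) (exp (- Re z * a) / Re z)"
    using z by (intro has_bochner_integral_nn_integral) auto
  have n: "norm (indicator {a..} v *\<^sub>R exp (- z * of_real v) :: complex) = exp (- Re z * v) * indicator {a..} v" for v
    by (auto simp: indicator_def norm_exp_eq_Re)
  have m: "(\<lambda>v. indicator {a..} v *\<^sub>R exp (- z * of_real v)) \<in> borel_measurable lborel"
    by (intro borel_measurable_scaleR borel_measurable_indicator) (auto intro!: borel_measurable_continuous_onI continuous_intros)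
  show i: "integrable lborel (\<lambda>v. indicator {a..} v *\<^sub>R exp (- z * of_real v))"
    by (rule integrable_norm_cancel[OF _ m]) (simp only: n integrable.intros[OF 1])
  show "(LBINT v. norm (indicator {a..} v *\<^sub>R exp (- z * of_real v) :: complex)) = exp (- Re z * a) / Re z"
    unfolding n using 1 by (rule has_bochner_integral_integral_eq)
  have z0: "z \<noteq> 0" using z by auto
  have lim: "((\<lambda>v. - exp (- z * of_real v) / z) \<longlongrightarrow> 0) at_top"
  proof (rule tendsto_norm_zero_cancel)
    have "((\<lambda>v. exp (- Re z * v) / norm z) \<longlongrightarrow> 0) at_top"
      using z z0 by real_asymp
    then show "((\<lambda>v. norm (- exp (- z * of_real v) / z)) \<longlongrightarrow> 0) at_top"
      by (simp add: norm_divide norm_exp_eq_Re)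
  qed
  have "(LBINT v=ereal a..\<infinity>. exp (- z * of_real v)) = 0 - (- exp (- z * of_real a) / z)"
  proof (rule interval_integral_FTC_integrable)
    show "set_integrable lborel (einterval (ereal a) \<infinity>) (\<lambda>v. exp (- z * of_real v))"
      by (rule set_integrable_subset[of lborel "{a..}"]) (use i in \<open>auto simp: set_integrable_def einterval_def\<close>)
    show "(((\<lambda>v. - exp (- z * of_real v) / z) \<circ> real_of_ereal) \<longlongrightarrow> - exp (- z * of_real a) / z) (at_right (ereal a))"
      unfolding ereal_tendsto_simps
      by (intro tendsto_within_subset[OF isCont_tendsto_compose[OF _ tendsto_ident_at]] tendsto_intros) (use z0 in auto)
    show "(((\<lambda>v. - exp (- z * of_real v) / z) \<circ> real_of_ereal) \<longlongrightarrow> 0) (at_left \<infinity>)"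
      unfolding ereal_tendsto_simps by (rule lim)
  next
    fix x
    show "((\<lambda>v. - exp (- z * of_real v) / z) has_vector_derivative exp (- z * of_real x)) (at x)"
      using z0 by (auto intro!: derivative_eq_intros has_vector_derivative_real_field simp: field_simps)
  qed auto
  also have "(LBINT v=ereal a..\<infinity>. exp (- z * of_real v)) = (CLBINT v. indicator {a<..} v *\<^sub>R exp (- z * of_real v))"
    by (simp add: interval_lebesgue_integral_def set_lebesgue_integral_def einterval_def greaterThan_def)
  also have "\<dots> = (CLBINT v. indicator {a..} v *\<^sub>R exp (- z * of_real v))"
  proof (rule integral_cong_AE)
    show "AE v in lborel. indicator {a<..} v *\<^sub>R exp (- z * of_real v) = indicator {a..} v *\<^sub>R exp (- z * of_real v)"
      using AE_lborel_singleton[of a] by eventually_elim (auto simp: indicator_def)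
    show "(\<lambda>v. indicator {a<..} v *\<^sub>R exp (- z * of_real v)) \<in> borel_measurable lborel"
      by (intro borel_measurable_scaleR borel_measurable_indicator) (auto intro!: borel_measurable_continuous_onI continuous_intros)
  qed (rule m)
  finally show "(CLBINT v. indicator {a..} v *\<^sub>R exp (- z * of_real v)) = exp (- z * of_real a) / z"
    by simp
qed

lemma exp_neg_mult_ln: "n > 0 \<Longrightarrow> exp (- s * of_real (ln (real n))) = (of_nat n powr (-s) :: complex)"
  by (simp add: powr_def Ln_of_nat)

text \<open>\<open>psi (exp v)\<close> is a sum of steps of height \<open>vonm n\<close> starting at
  \<open>ln n\<close>. Each \<open>v\<close> sees finitely many steps, and the integrals of the
  norms add up to an absolutely convergent von Mangoldt series divided by \<open>Re s\<close>, so
  sum and integral commute.\<close>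

lemma psi_laplace:
  assumes s: "Re s > 1"
  shows "integrable lborel (\<lambda>v. of_real (psi (exp v)) * exp (- s * of_real v))"
    and "(CLBINT v. of_real (psi (exp v)) * exp (- s * of_real v)) = dirichlet_series vonm s / s"
proof -
  define f where "f = (\<lambda>n v. of_real (vonm n) * (indicator {ln (real n)..} v *\<^sub>R exp (- s * of_real v)) :: complex)"
  have s0: "Re s > 0" using s by simp
  have int: "integrable lborel (f n)" for n
    unfolding f_def by (intro integrable_mult_right laplace_Ici s0)
  have fin: "f n v = 0" if "n \<notin> {n. real n \<le> exp v}" for n v
  proof -
    have "exp v < real n" using that by simp
    then have "v < ln (real n)" by (metis exp_gt_zero less_trans ln_exp ln_less_cancel_iff)
    then show ?thesis by (simp add: f_def)
  qed
  have sum: "(\<Sum>n. f n v) = of_real (psi (exp v)) * exp (- s * of_real v)" for v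
  proof -
    have "(\<Sum>n. f n v) = (\<Sum>n | real n \<le> exp v. f n v)"
      using fin by (intro suminf_finite finite_nat_le) auto
    also have "\<dots> = (\<Sum>n | real n \<le> exp v. of_real (vonm n) * exp (- s * of_real v))"
    proof (rule sum.cong)
      fix n assume n: "n \<in> {n. real n \<le> exp v}"
      show "f n v = of_real (vonm n) * exp (- s * of_real v)"
      proof (cases "n = 0")
        case False
        then have "ln (real n) \<le> ln (exp v)" using n by (subst ln_le_cancel_iff) auto
        then have "ln (real n) \<le> v" by simp
        then show ?thesis by (simp add: f_def)
      qed (simp add: f_def)
    qed auto
    finally show ?thesis by (simp add: psi_def sum_distrib_right)
  qed
  have ni: "(LBINT v. norm (f n v)) = norm (of_real (vonm n) * of_nat n powr (-s) :: complex) / Re s" for n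
  proof (cases "n = 0")
    case False
    have "(LBINT v. norm (f n v)) = vonm n * (LBINT v. norm (indicator {ln (real n)..} v *\<^sub>R exp (- s * of_real v) :: complex))"
      unfolding f_def norm_mult by (subst integral_mult_right_zero) (simp add: mangoldt_nonneg)
    also have "\<dots> = vonm n * (exp (- Re s * ln (real n)) / Re s)"
      by (simp only: laplace_Ici(3)[OF s0])
    also have "exp (- Re s * ln (real n)) = real n powr (- Re s)"
      using False by (simp add: powr_def)
    finally show ?thesis
      by (simp add: norm_mult norm_nat_powr mangoldt_nonneg)
  qed (simp add: f_def)
  have sn: "summable (\<lambda>n. (LBINT v. norm (f n v)))"
    unfolding ni by (intro summable_divide summable_norm_mangoldt s)
  have ae: "AE v in lborel. summable (\<lambda>n. norm (f n v))"
    using fin by (intro always_eventually allI summable_finite[OF finite_nat_le]) auto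
  show "integrable lborel (\<lambda>v. of_real (psi (exp v)) * exp (- s * of_real v))"
    using integrable_suminf[OF int ae sn] by (simp only: sum)
  have "(CLBINT v. of_real (psi (exp v)) * exp (- s * of_real v)) = (\<Sum>n. (CLBINT v. f n v))"
    using integral_suminf[OF int ae sn] by (simp only: sum)
  also have "(CLBINT v. f n v) = of_real (vonm n) * of_nat n powr (-s) / s" for n
  proof (cases "n = 0")
    case False
    have "(CLBINT v. f n v) = of_real (vonm n) * (CLBINT v. indicator {ln (real n)..} v *\<^sub>R exp (- s * of_real v))"
      unfolding f_def by (rule integral_mult_right_zero)
    also have "\<dots> = of_real (vonm n) * (of_nat n powr (-s) / s)"
      using False by (simp only: laplace_Ici(2)[OF s0] exp_neg_mult_ln)
    finally show ?thesis by simp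
  qed (simp add: f_def)
  then have "(\<Sum>n. (CLBINT v. f n v)) = (\<Sum>n. of_real (vonm n) * of_nat n powr (-s) / s)"
    by (simp only:)
  also have "\<dots> = dirichlet_series vonm s / s"
    unfolding dirichlet_series_def by (rule suminf_divide[OF summable_norm_cancel[OF summable_norm_mangoldt[OF s]]])
  finally show "(CLBINT v. of_real (psi (exp v)) * exp (- s * of_real v)) = dirichlet_series vonm s / s" .
qed

text \<open>Subtracting \<open>exp v\<close> cancels the pole of the Laplace transform at \<open>s = 1\<close>, see \<open>psi_err_laplace\<close>.\<close>
definition psi_err :: "real \<Rightarrow> real" where
  "psi_err v = (psi (exp v) - exp v) * indicator {0..} v"

text \<open>Equals \<open>(- zeta'/zeta - s/(s-1)) / s\<close>: passing from zeta to
  \<open>zeta_reg\<close> adds \<open>1/(s-1)\<close> to the logarithmic derivative, and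
  \<open>s/(s-1) = 1 + 1/(s-1)\<close>. In this form the point 1 is visibly regular.\<close>

definition psi_transform :: "complex \<Rightarrow> complex" where
  "psi_transform s = (- deriv zeta_reg s / zeta_reg s - 1) / s"

lemma psi_exp_neg: "v < 0 \<Longrightarrow> psi (exp v) = 0"
proof -
  assume "v < 0"
  then have e: "exp v < 1" by simp
  have "vonm n = 0" if "real n \<le> exp v" for n
  proof -
    have "real n < 1" using that e by linarith
    then have "n = 0" by simp
    then show ?thesis by simp
  qed
  then show ?thesis unfolding psi_def by (intro sum.neutral) auto
qed

lemma psi_transform_eq_series:
  assumes s: "Re s > 1"
  shows "psi_transform s = (dirichlet_series vonm s - 1 / (s - 1) - 1) / s"
proof -
  let ?Z = "dirichlet_series (\<lambda>_. 1)"
  have dZ: "(?Z has_field_derivative - (dirichlet_series vonm s * ?Z s)) (at s)"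
    using dirichlet_series_has_field_derivative[of "\<lambda>_. 1" s] s
    by (simp add: mangoldt_dirichlet_convolution)
  have op: "open {s::complex. Re s > 1}" by (rule open_halfspace_Re_gt)
  have "((\<lambda>s. (s - 1) * ?Z s) has_field_derivative ?Z s + (s - 1) * (- (dirichlet_series vonm s * ?Z s))) (at s)"
    by (auto intro!: derivative_eq_intros dZ)
  then have "(zeta_reg has_field_derivative ?Z s + (s - 1) * (- (dirichlet_series vonm s * ?Z s))) (at s)"
    by (rule has_field_derivative_transform_within_open[OF _ op]) (use s in \<open>auto simp: zeta_reg_eq_series\<close>)
  then have 1: "deriv zeta_reg s = ?Z s + (s - 1) * (- (dirichlet_series vonm s * ?Z s))"
    by (rule DERIV_imp_deriv)
  have 2: "zeta_reg s = (s - 1) * ?Z s" using s by (rule zeta_reg_eq_series)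
  have "?Z s \<noteq> 0" "s \<noteq> 1" using zeta_reg_nonzero_right[OF s] 2 by auto
  then have "- (?Z s + (s - 1) * (- (dirichlet_series vonm s * ?Z s))) / ((s - 1) * ?Z s) = dirichlet_series vonm s - 1 / (s - 1)"
    by (simp add: divide_simps) (simp add: algebra_simps)
  then show ?thesis by (simp only: psi_transform_def 1 2)
qed

lemma psi_err_laplace:
  assumes s: "Re s > 1"
  shows "integrable lborel (\<lambda>v. of_real (psi_err v) * exp (- s * of_real v))"
    and "(CLBINT v. of_real (psi_err v) * exp (- s * of_real v)) = psi_transform s"
proof -
  have s1: "Re (s - 1) > 0" using s by simp
  have eq: "of_real (psi_err v) * exp (- s * of_real v) = of_real (psi (exp v)) * exp (- s * of_real v) -
     indicator {0..} v *\<^sub>R exp (- (s - 1) * of_real v)" for v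
  proof (cases "v \<ge> 0")
    case True
    have "exp (- (s - 1) * of_real v) = exp (- s * of_real v) * of_real (exp v)"
      by (simp add: exp_add[symmetric] algebra_simps flip: exp_of_real)
    then show ?thesis using True by (simp add: psi_err_def algebra_simps)
  qed (simp add: psi_err_def psi_exp_neg)
  show "integrable lborel (\<lambda>v. of_real (psi_err v) * exp (- s * of_real v))"
    unfolding eq by (rule Bochner_Integration.integrable_diff[OF psi_laplace(1)[OF s] laplace_Ici(1)[OF s1]])
  have "(CLBINT v. of_real (psi_err v) * exp (- s * of_real v)) = dirichlet_series vonm s / s - exp (- (s - 1) * of_real 0) / (s - 1)"
    unfolding eq
    by (simp only: Bochner_Integration.integral_diff[OF psi_laplace(1)[OF s] laplace_Ici(1)[OF s1]] psi_laplace(2)[OF s] laplace_Ici(2)[OF s1])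
  \<comment> \<open>Since \<open>1/(s-1) = (1/(s-1) + 1) / s\<close>, the transform of
    \<open>exp v\<close> accounts for the last two terms of the numerator.\<close>
  also have "\<dots> = psi_transform s"
  proof -
    have "s \<noteq> 0" "s \<noteq> 1" using s by auto
    then show ?thesis unfolding psi_transform_eq_series[OF s] by (simp add: divide_simps)
  qed
  finally show "(CLBINT v. of_real (psi_err v) * exp (- s * of_real v)) = psi_transform s" .
qed

lemma psi_err_measurable [measurable]: "psi_err \<in> borel_measurable borel"
proof -
  have "mono (\<lambda>v. psi (exp v))" by (intro monoI psi_mono) simp
  then have "(\<lambda>v. psi (exp v)) \<in> borel_measurable borel" by (rule borel_measurable_mono)
  then show ?thesis unfolding psi_err_def by measurable
qed

section \<open>Gaussian averages as integrals over the line of abscissa 3\<close>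

abbreviation line3 :: "real \<Rightarrow> complex" where "line3 t \<equiv> of_real 3 + \<i> * of_real t"

text \<open>The moment generating function at \<open>s\<close> of the normal law with mean
  \<open>L\<close> and deviation \<open>d\<close>; on vertical lines it decays like
  \<open>exp (- d^2 * t^2 / 2)\<close>.\<close>

definition gauss_kernel :: "real \<Rightarrow> real \<Rightarrow> complex \<Rightarrow> complex" where
  "gauss_kernel d L s = exp (s * of_real L + of_real (d\<^sup>2) * s\<^sup>2 / 2)"

lemma norm_gauss_kernel:
  "norm (gauss_kernel d L s) = exp (Re s * L + d\<^sup>2 * ((Re s)\<^sup>2 - (Im s)\<^sup>2) / 2)"
  by (simp add: gauss_kernel_def norm_exp_eq_Re power2_eq_square algebra_simps)

lemma integrable_exp_neg_square:
  fixes k :: real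
  assumes "k > 0"
  shows "integrable lborel (\<lambda>t. exp (- k * t\<^sup>2))"
proof -
  have "integrable lborel (normal_density 0 (1 / sqrt (2 * k)))"
    using assms by (intro integrable_normal_density) simp
  then have "integrable lborel (\<lambda>t. sqrt (2 * pi * (1 / sqrt (2 * k))\<^sup>2) * normal_density 0 (1 / sqrt (2 * k)) t)"
    by (rule integrable_mult_right)
  also have "(\<lambda>t. sqrt (2 * pi * (1 / sqrt (2 * k))\<^sup>2) * normal_density 0 (1 / sqrt (2 * k)) t) = (\<lambda>t. exp (- k * t\<^sup>2))"
    using assms by (auto simp: normal_density_def field_simps)
  finally show ?thesis .
qed

lemma integrable_norm_gauss_kernel:
  assumes "d > 0"
  shows "integrable lborel (\<lambda>t. norm (gauss_kernel d L (line3 t)))"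
proof -
  have "norm (gauss_kernel d L (line3 t)) = exp (3 * L + 9 * d\<^sup>2 / 2) * exp (- (d\<^sup>2 / 2) * t\<^sup>2)" for t
    by (simp add: norm_gauss_kernel exp_add[symmetric] field_simps)
  then show ?thesis using assms
    by (simp only:) (intro integrable_mult_right integrable_exp_neg_square, simp)
qed

text \<open>The auxiliary \<open>h\<close> is integrated in both orders: over \<open>v\<close> it
  yields the Laplace transform of \<open>psi_err\<close>, over \<open>t\<close> the Gaussian Fourier
  integral with \<open>b = L - v\<close>, hence the normal density. Joint integrability is cheap,
  because \<open>norm (h t v)\<close> is a function of \<open>t\<close> times a function of
  \<open>v\<close>.\<close>

lemma smoothed_psi_err:
  assumes d: "d > 0"
  shows "of_real (LBINT v. psi_err v * normal_density L d v) =
     (CLBINT t. psi_transform (line3 t) * gauss_kernel d L (line3 t)) / (2 * pi)"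
proof -
  define h where "h = (\<lambda>t v. of_real (psi_err v) * exp (- line3 t * of_real v) * gauss_kernel d L (line3 t))"
  have gm [measurable]: "(\<lambda>t. gauss_kernel d L (line3 t)) \<in> borel_measurable borel"
    unfolding gauss_kernel_def by (intro borel_measurable_continuous_onI continuous_intros) auto
  have em: "(\<lambda>x. exp (- line3 (fst x) * of_real (snd x))) \<in> borel_measurable (borel :: (real \<times> real) measure)"
    by (intro borel_measurable_continuous_onI continuous_intros)
  then have em [measurable]: "(\<lambda>x. exp (- line3 (fst x) * of_real (snd x))) \<in> borel_measurable (lborel \<Otimes>\<^sub>M lborel :: (real \<times> real) measure)"
    by (simp add: lborel_prod)
  have nh: "norm (h t v) = norm (gauss_kernel d L (line3 t)) * norm (of_real (psi_err v) * exp (- of_real 3 * of_real v) :: complex)" for t v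
    by (simp add: h_def norm_mult norm_exp_eq_Re)
  have int3: "integrable lborel (\<lambda>v. of_real (psi_err v) * exp (- of_real 3 * of_real v) :: complex)"
    using psi_err_laplace(1)[of "of_real 3"] by simp
  have "integrable (lborel \<Otimes>\<^sub>M lborel) (\<lambda>(t, v). h t v)"
  proof (rule lborel_pair.Fubini_integrable)
    show "(\<lambda>(t, v). h t v) \<in> borel_measurable (lborel \<Otimes>\<^sub>M lborel)"
      unfolding h_def case_prod_beta by measurable
    show "integrable lborel (\<lambda>t. LBINT v. norm (case (t, v) of (t, v) \<Rightarrow> h t v))"
      unfolding prod.case nh by (simp only: integral_mult_right_zero) (intro integrable_mult_left integrable_norm_gauss_kernel d)
    show "AE t in lborel. integrable lborel (\<lambda>v. case (t, v) of (t, v) \<Rightarrow> h t v)"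
    proof (intro always_eventually allI)
      fix t
      show "integrable lborel (\<lambda>v. case (t, v) of (t, v) \<Rightarrow> h t v)"
        unfolding prod.case h_def by (intro integrable_mult_left psi_err_laplace) simp
    qed
  qed
  then have fub: "(CLBINT v. CLBINT t. h t v) = (CLBINT t. CLBINT v. h t v)"
    by (rule lborel_pair.Fubini_integral)
  have i1: "(CLBINT v. h t v) = psi_transform (line3 t) * gauss_kernel d L (line3 t)" for t
    unfolding h_def integral_mult_left_zero by (subst psi_err_laplace(2)) auto
  have i2: "(CLBINT t. h t v) = of_real (2 * pi) * of_real (psi_err v * normal_density L d v)" for v
  proof -
    have "h t v = of_real (psi_err v) * exp (line3 t * of_real (L - v) + of_real (d\<^sup>2) * (line3 t)\<^sup>2 / 2)" for t
      by (simp add: h_def gauss_kernel_def exp_add[symmetric] algebra_simps)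
    then have "(CLBINT t. h t v) = of_real (psi_err v) * of_real (2 * pi * normal_density (L - v) d 0)"
      using gaussian_fourier[OF d, of 3 "L - v"] by (simp only: integral_mult_right_zero)
    also have "normal_density (L - v) d 0 = normal_density L d v"
      by (simp add: normal_density_def power2_commute)
    finally show ?thesis by simp
  qed
  have "of_real (2 * pi) * of_real (LBINT v. psi_err v * normal_density L d v) = (CLBINT t. psi_transform (line3 t) * gauss_kernel d L (line3 t))"
    using fub by (simp only: i1 i2 integral_mult_right_zero integral_complex_of_real)
  then show ?thesis by (simp add: field_simps)
qed

section \<open>Shifting the contour\<close>

text \<open>By Cauchy's theorem the right side of the rectangle is minus the sum of the other three:
  two horizontal sides of length \<open>b - a\<close> and the left side of length
  \<open>2 * T\<close>.\<close>

lemma rectangle_shift_bound: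
  fixes f :: "complex \<Rightarrow> complex"
  assumes hol: "f holomorphic_on cbox (Complex a (-T)) (Complex b T)"
    and ab: "a < b" and T: "T > 0"
    and H: "\<And>s. a \<le> Re s \<Longrightarrow> Re s \<le> b \<Longrightarrow> \<bar>Im s\<bar> = T \<Longrightarrow> norm (f s) \<le> H"
    and V: "\<And>s. Re s = a \<Longrightarrow> \<bar>Im s\<bar> \<le> T \<Longrightarrow> norm (f s) \<le> V"
  shows "norm (integral {-T..T} (\<lambda>t. f (Complex b t))) \<le> 2 * (b - a) * H + 2 * T * V"
proof -
  define a1 where "a1 = Complex a (-T)"
  define a2 where "a2 = Complex b (-T)"
  define a3 where "a3 = Complex b T"
  define a4 where "a4 = Complex a T"
  let ?B = "cbox a1 a3"
  have cont: "continuous_on ?B f"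
    using hol unfolding a1_def a3_def by (rule holomorphic_on_imp_continuous_on)
  have memB: "a1 \<in> ?B" "a2 \<in> ?B" "a3 \<in> ?B" "a4 \<in> ?B"
    using ab T by (auto simp: a1_def a2_def a3_def a4_def in_cbox_complex_iff)
  have seg: "closed_segment x y \<subseteq> ?B" if "x \<in> ?B" "y \<in> ?B" for x y
    using that by (intro closed_segment_subset convex_box)
  have ci: "f contour_integrable_on (linepath x y)" if "x \<in> ?B" "y \<in> ?B" for x y
    by (rule contour_integrable_continuous_linepath[OF continuous_on_subset[OF cont seg[OF that]]])
  have I: "(f has_contour_integral contour_integral (linepath x y) f) (linepath x y)" if "x \<in> ?B" "y \<in> ?B" for x y
    by (rule has_contour_integral_integral[OF ci[OF that]])
  have "(f has_contour_integral (contour_integral (linepath a1 a2) f + (contour_integral (linepath a2 a3) f +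
      (contour_integral (linepath a3 a4) f + contour_integral (linepath a4 a1) f)))) (rectpath a1 a3)"
    unfolding rectpath_def Let_def
    using I memB by (intro has_contour_integral_join valid_path_join) (auto simp: a1_def a2_def a3_def a4_def)
  moreover have "(f has_contour_integral 0) (rectpath a1 a3)"
  proof (rule Cauchy_theorem_convex_simple[where S = ?B])
    show "f holomorphic_on ?B" using hol by (simp add: a1_def a3_def)
    show "path_image (rectpath a1 a3) \<subseteq> ?B"
      by (rule path_image_rectpath_subset_cbox) (use ab T in \<open>auto simp: a1_def a3_def\<close>)
  qed (auto intro: convex_box)
  ultimately have "contour_integral (linepath a1 a2) f + (contour_integral (linepath a2 a3) f +
      (contour_integral (linepath a3 a4) f + contour_integral (linepath a4 a1) f)) = 0"
    by (rule has_contour_integral_unique)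
  then have "contour_integral (linepath a2 a3) f = - (contour_integral (linepath a1 a2) f +
      contour_integral (linepath a3 a4) f + contour_integral (linepath a4 a1) f)"
    by (simp add: algebra_simps eq_neg_iff_add_eq_0)
  then have "norm (contour_integral (linepath a2 a3) f) \<le> norm (contour_integral (linepath a1 a2) f) +
      norm (contour_integral (linepath a3 a4) f) + norm (contour_integral (linepath a4 a1) f)"
    by (simp only: norm_minus_cancel) (intro order.trans[OF norm_triangle_ineq] add_right_mono norm_triangle_ineq)
  moreover have "contour_integral (linepath a2 a3) f = \<i> * integral {-T..T} (\<lambda>t. f (Complex b t))"
    using T by (intro contour_integral_linepath_same_Re) (auto simp: a2_def a3_def)
  moreover have H0: "0 \<le> H" using order.trans[OF norm_ge_zero H[of "Complex a T"]] ab T by simp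
  moreover have V0: "0 \<le> V" using order.trans[OF norm_ge_zero V[of "Complex a T"]] ab T by simp
  moreover have "norm (contour_integral (linepath a1 a2) f) \<le> H * norm (a2 - a1)"
  proof (rule has_contour_integral_bound_linepath[OF I[OF memB(1,2)] H0])
    fix s assume "s \<in> closed_segment a1 a2"
    then have "s \<in> closed_segment (Complex a (-T)) (Complex b (-T))" by (simp add: a1_def a2_def)
    then show "norm (f s) \<le> H" using ab T
      by (intro H) (auto simp: closed_segment_same_Im closed_segment_eq_real_ivl)
  qed
  moreover have "norm (contour_integral (linepath a3 a4) f) \<le> H * norm (a4 - a3)"
  proof (rule has_contour_integral_bound_linepath[OF I[OF memB(3,4)] H0])
    fix s assume "s \<in> closed_segment a3 a4"
    then have "s \<in> closed_segment (Complex b T) (Complex a T)" by (simp add: a3_def a4_def)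
    then show "norm (f s) \<le> H" using ab T
      by (intro H) (auto simp: closed_segment_same_Im closed_segment_eq_real_ivl)
  qed
  moreover have "norm (contour_integral (linepath a4 a1) f) \<le> V * norm (a1 - a4)"
  proof (rule has_contour_integral_bound_linepath[OF I[OF memB(4,1)] V0])
    fix s assume "s \<in> closed_segment a4 a1"
    then have "s \<in> closed_segment (Complex a T) (Complex a (-T))" by (simp add: a1_def a4_def)
    then show "norm (f s) \<le> V" using ab T
      by (intro V) (auto simp: closed_segment_same_Re closed_segment_eq_real_ivl)
  qed
  moreover have "norm (a2 - a1) = b - a" "norm (a4 - a3) = b - a" "norm (a1 - a4) = 2 * T"
    using ab T by (auto simp: a1_def a2_def a3_def a4_def cmod_def real_sqrt_mult)
  ultimately show ?thesis
    by (simp add: norm_mult algebra_simps)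
qed

lemma integral_exp_neg_square:
  fixes k :: real
  assumes "k > 0"
  shows "(LBINT t. exp (- k * t\<^sup>2)) = sqrt (pi / k)"
proof -
  let ?s = "1 / sqrt (2 * k)"
  have "(LBINT t. sqrt (2 * pi * ?s\<^sup>2) * normal_density 0 ?s t) = sqrt (2 * pi * ?s\<^sup>2) * 1"
    by (subst integral_mult_right_zero, subst integral_normal_density) (use assms in auto)
  also have "(\<lambda>t. sqrt (2 * pi * ?s\<^sup>2) * normal_density 0 ?s t) = (\<lambda>t. exp (- k * t\<^sup>2))"
    using assms by (auto simp: normal_density_def field_simps)
  finally show ?thesis using assms by (simp add: field_simps)
qed

text \<open>A constant is enough, since \<open>gauss_kernel\<close> makes the integral converge. In
  \<open>M + 2\<close>, \<open>M\<close> bounds the von Mangoldt series and the other two terms of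
  the numerator give 1 each.\<close>

lemma psi_transform_bound_line3:
  obtains C where "C \<ge> 0" "\<And>t. norm (psi_transform (line3 t)) \<le> C"
proof -
  define M where "M = (\<Sum>n. norm (of_real (vonm n) * of_nat n powr (- of_real 3) :: complex))"
  have sm: "summable (\<lambda>n. norm (of_real (vonm n) * of_nat n powr (- of_real 3) :: complex))"
    by (rule summable_norm_mangoldt) auto
  have M0: "M \<ge> 0" unfolding M_def by (intro suminf_nonneg sm) auto
  have "norm (psi_transform (line3 t)) \<le> M + 2" for t
  proof -
    let ?s = "line3 t"
    have eq: "norm (of_real (vonm n) * of_nat n powr (- ?s) :: complex) = norm (of_real (vonm n) * of_nat n powr (- of_real 3) :: complex)" for n
      by (simp add: norm_mult norm_nat_powr)
    have "norm (dirichlet_series vonm ?s) \<le> M"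
      using summable_norm[of "\<lambda>n. of_real (vonm n) * of_nat n powr (- ?s) :: complex"] sm
      unfolding eq dirichlet_series_def M_def by blast
    moreover have "norm (1 / (?s - 1)) \<le> 1"
      using abs_Re_le_cmod[of "?s - 1"] by (simp add: norm_divide divide_le_eq)
    ultimately have "norm (dirichlet_series vonm ?s - 1 / (?s - 1) - 1) \<le> M + 1 + norm (1::complex)"
      by (intro order.trans[OF norm_triangle_ineq4] add_mono order.trans[OF norm_triangle_ineq4[of "dirichlet_series vonm ?s"]]) auto
    moreover have "norm ?s \<ge> 1" using abs_Re_le_cmod[of ?s] by simp
    moreover have "norm (psi_transform ?s) = norm (dirichlet_series vonm ?s - 1 / (?s - 1) - 1) / norm ?s"
      by (subst psi_transform_eq_series) (auto simp: norm_divide)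
    ultimately show ?thesis using M0
      by (simp add: divide_le_eq) (smt (verit) mult_left_mono mult_cancel_left1)
  qed
  then show ?thesis using that[of "M + 2"] M0 by auto
qed

text \<open>The three terms are, in order, the part of the line beyond height
  \<open>T = p ^ 30\<close>, the horizontal sides and the left side of the rectangle;
  \<open>p ^ 35\<close> is a length of order \<open>T\<close> times the bound of order
  \<open>p ^ 5\<close>.\<close>

lemma smoothed_psi_err_bound_explicit:
  obtains \<kappa> C where "\<kappa> > 0" "C \<ge> 0"
    "\<And>p d L. p \<ge> 1 \<Longrightarrow> 0 < d \<Longrightarrow> d \<le> 1 \<Longrightarrow> L \<ge> 0 \<Longrightarrow> \<bar>LBINT v. psi_err v * normal_density L d v\<bar> \<le>
       C * exp (3 * L) * exp (- (d\<^sup>2 / 4) * (p ^ 30)\<^sup>2) / d + C * p ^ 5 * exp (3 * L) * exp (- (d\<^sup>2 / 4) * (p ^ 30)\<^sup>2)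
       + C * p ^ 35 * exp ((1 - \<kappa> / p ^ 5) * L)"
proof -
  obtain \<kappa> C0 where \<kappa>: "0 < \<kappa>" "\<kappa> \<le> 1/240" and C0: "C0 \<ge> 0"
    and nz: "\<And>p s. p \<ge> 1 \<Longrightarrow> Re s \<ge> 1 - \<kappa> / p ^ 5 \<Longrightarrow> Re s \<le> 3 \<Longrightarrow> \<bar>Im s\<bar> \<le> p ^ 30 \<Longrightarrow> zeta_reg s \<noteq> 0"
    and bnd: "\<And>p s. p \<ge> 1 \<Longrightarrow> Re s \<ge> 1 - \<kappa> / p ^ 5 \<Longrightarrow> Re s \<le> 3 \<Longrightarrow> \<bar>Im s\<bar> \<le> p ^ 30 \<Longrightarrow>
        \<bar>Im s\<bar> = p ^ 30 \<or> Re s = 1 - \<kappa> / p ^ 5 \<Longrightarrow> norm (deriv zeta_reg s / zeta_reg s + 1) \<le> C0 * p ^ 5"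
    using zeta_reg_zero_free by blast
  obtain CF where CF: "CF \<ge> 0" "\<And>t. norm (psi_transform (line3 t)) \<le> CF" using psi_transform_bound_line3 by blast
  \<comment> \<open>Bounds \<open>exp (d^2 * (Re s)^2 / 2)\<close> for \<open>d <= 1\<close> and
    \<open>|Re s| <= 3\<close>.\<close>
  define E where "E = exp (9 / 2 :: real)"
  \<comment> \<open>Tail, horizontal sides, left side. In 12 a total length of at most 6 meets the
    factor 2 that comes from \<open>norm s >= 1/2\<close>; in 4 the length \<open>2 * T\<close>
    meets the same factor.\<close>
  define C where "C = CF * E * (2 * sqrt pi) + 12 * C0 * E + 4 * C0 * E"
  have E: "E \<ge> 0" by (simp add: E_def)
  have C: "C \<ge> 0" "C \<ge> CF * E * (2 * sqrt pi)" "C \<ge> 12 * C0 * E" "C \<ge> 4 * C0 * E"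
    using CF C0 E by (auto simp: C_def)
  have "\<bar>LBINT v. psi_err v * normal_density L d v\<bar> \<le>
       C * exp (3 * L) * exp (- (d\<^sup>2 / 4) * (p ^ 30)\<^sup>2) / d + C * p ^ 5 * exp (3 * L) * exp (- (d\<^sup>2 / 4) * (p ^ 30)\<^sup>2)
       + C * p ^ 35 * exp ((1 - \<kappa> / p ^ 5) * L)"
    if p: "p \<ge> 1" and d: "0 < d" "d \<le> 1" and L: "L \<ge> 0" for p d L
  proof -
    define T where "T = p ^ 30"
    define w where "w = \<kappa> / p ^ 5"
    define f where "f = (\<lambda>s. psi_transform s * gauss_kernel d L s)"
    have T: "T \<ge> 1" using p by (simp add: T_def one_le_power)
    have w: "0 < w" using \<kappa> p by (simp add: w_def)
    have "w \<le> \<kappa>" using \<kappa> p by (simp add: w_def divide_le_eq one_le_power)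
    then have w1: "w \<le> 1/2" using \<kappa> by simp
    have d2: "d\<^sup>2 \<le> 1" using d by (simp add: power_le_one)
    have trb: "norm (psi_transform s) \<le> 2 * C0 * p ^ 5" if "Re s \<ge> 1 - w" "Re s \<le> 3" "\<bar>Im s\<bar> \<le> T" "\<bar>Im s\<bar> = T \<or> Re s = 1 - w" for s
    proof -
      have "norm s \<ge> 1/2" using abs_Re_le_cmod[of s] that w1 by simp
      moreover have "norm (- deriv zeta_reg s / zeta_reg s - 1) \<le> C0 * p ^ 5"
        using bnd[of p s] that p by (simp add: T_def w_def norm_minus_commute[of "- (deriv zeta_reg s / zeta_reg s)"] add.commute)
      ultimately have "norm (psi_transform s) \<le> (C0 * p ^ 5) / (1/2)"
        unfolding psi_transform_def norm_divide using C0 p by (intro frac_le) auto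
      then show ?thesis by simp
    qed
    have "f holomorphic_on cbox (Complex (1 - w) (-T)) (Complex 3 T)"
    proof -
      let ?B = "cbox (Complex (1 - w) (-T)) (Complex 3 T)"
      have sub: "?B \<subseteq> {s. Re s > 0}" using w1 by (auto simp: in_cbox_complex_iff)
      have "zeta_reg s \<noteq> 0" if "s \<in> ?B" for s
        using that by (intro nz[OF p]) (auto simp: in_cbox_complex_iff w_def T_def)
      moreover have "s \<noteq> 0" if "s \<in> ?B" for s using that sub by auto
      ultimately show ?thesis unfolding f_def psi_transform_def gauss_kernel_def
        by (intro holomorphic_intros holomorphic_on_subset[OF zeta_reg_holomorphic sub]
            holomorphic_on_subset[OF holomorphic_deriv[OF zeta_reg_holomorphic open_halfspace_Re_gt] sub]) auto
    qed
    then have "norm (integral {-T..T} (\<lambda>t. f (Complex 3 t))) \<le>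
        2 * (3 - (1 - w)) * (2 * C0 * p ^ 5 * (exp (3 * L) * E * exp (- (d\<^sup>2 / 4) * T\<^sup>2))) +
        2 * T * (2 * C0 * p ^ 5 * (exp ((1 - w) * L) * E))"
    proof (rule rectangle_shift_bound)
      fix s assume s: "1 - w \<le> Re s" "Re s \<le> 3" "\<bar>Im s\<bar> = T"
      have im2: "(Im s)\<^sup>2 = T\<^sup>2" using s by (metis power2_abs)
      have "(Re s)\<^sup>2 \<le> 3\<^sup>2" using s w1 by (intro power_mono) auto
      then have "d\<^sup>2 * (Re s)\<^sup>2 \<le> 1 * 9" using d2 by (intro mult_mono) auto
      moreover have "Re s * L \<le> 3 * L" using s L by (intro mult_right_mono) auto
      moreover have "d\<^sup>2 * T\<^sup>2 \<ge> 0" by simp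
      moreover have "d\<^sup>2 * ((Re s)\<^sup>2 - T\<^sup>2) / 2 = d\<^sup>2 * (Re s)\<^sup>2 / 2 - d\<^sup>2 * T\<^sup>2 / 2"
        by (simp add: right_diff_distrib diff_divide_distrib)
      moreover have "- (d\<^sup>2 / 4) * T\<^sup>2 = - (d\<^sup>2 * T\<^sup>2 / 4)" by simp
      ultimately have "Re s * L + d\<^sup>2 * ((Re s)\<^sup>2 - (Im s)\<^sup>2) / 2 \<le> 3 * L + 9 / 2 + - (d\<^sup>2 / 4) * T\<^sup>2"
        unfolding im2 by linarith
      then have "norm (gauss_kernel d L s) \<le> exp (3 * L) * E * exp (- (d\<^sup>2 / 4) * T\<^sup>2)"
        unfolding norm_gauss_kernel E_def exp_add[symmetric] by simp
      moreover have "norm (psi_transform s) \<le> 2 * C0 * p ^ 5" using s by (intro trb) auto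
      ultimately show "norm (f s) \<le> 2 * C0 * p ^ 5 * (exp (3 * L) * E * exp (- (d\<^sup>2 / 4) * T\<^sup>2))"
        unfolding f_def norm_mult using C0 p by (intro mult_mono) auto
    next
      fix s assume s: "Re s = 1 - w" "\<bar>Im s\<bar> \<le> T"
      have "(Re s)\<^sup>2 \<le> 3\<^sup>2" using s w w1 by (intro power_mono) auto
      then have "d\<^sup>2 * (Re s)\<^sup>2 \<le> 1 * 9" using d2 by (intro mult_mono) auto
      moreover have "d\<^sup>2 * (Im s)\<^sup>2 \<ge> 0" by simp
      moreover have "d\<^sup>2 * ((Re s)\<^sup>2 - (Im s)\<^sup>2) / 2 = d\<^sup>2 * (Re s)\<^sup>2 / 2 - d\<^sup>2 * (Im s)\<^sup>2 / 2"
        by (simp add: right_diff_distrib diff_divide_distrib)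
      ultimately have "Re s * L + d\<^sup>2 * ((Re s)\<^sup>2 - (Im s)\<^sup>2) / 2 \<le> (1 - w) * L + 9 / 2"
        unfolding s(1) by linarith
      then have "norm (gauss_kernel d L s) \<le> exp ((1 - w) * L) * E"
        unfolding norm_gauss_kernel E_def exp_add[symmetric] by simp
      moreover have "norm (psi_transform s) \<le> 2 * C0 * p ^ 5" using s w1 w by (intro trb) auto
      ultimately show "norm (f s) \<le> 2 * C0 * p ^ 5 * (exp ((1 - w) * L) * E)"
        unfolding f_def norm_mult using C0 p by (intro mult_mono) auto
    qed (use w T in auto)
    also have "2 * (3 - (1 - w)) * (2 * C0 * p ^ 5 * (exp (3 * L) * E * exp (- (d\<^sup>2 / 4) * T\<^sup>2))) \<le>
       6 * (2 * C0 * p ^ 5 * (exp (3 * L) * E * exp (- (d\<^sup>2 / 4) * T\<^sup>2)))"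
      using w1 C0 p E by (intro mult_right_mono mult_nonneg_nonneg) auto
    also have "\<dots> = (12 * C0 * E) * (p ^ 5 * exp (3 * L) * exp (- (d\<^sup>2 / 4) * T\<^sup>2))" by simp
    also have "\<dots> \<le> C * (p ^ 5 * exp (3 * L) * exp (- (d\<^sup>2 / 4) * T\<^sup>2))"
      using C p by (intro mult_right_mono mult_nonneg_nonneg) auto
    also have "2 * T * (2 * C0 * p ^ 5 * (exp ((1 - w) * L) * E)) = (4 * C0 * E) * (p ^ 35 * exp ((1 - w) * L))"
    proof -
      have "p ^ 35 = T * p ^ 5" by (simp add: T_def power_add[symmetric])
      then show ?thesis by simp
    qed
    also have "\<dots> \<le> C * (p ^ 35 * exp ((1 - w) * L))"
      using C p by (intro mult_right_mono mult_nonneg_nonneg) auto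
    finally have rect: "norm (integral {-T..T} (\<lambda>t. f (Complex 3 t))) \<le>
       C * (p ^ 5 * exp (3 * L) * exp (- (d\<^sup>2 / 4) * T\<^sup>2)) + C * (p ^ 35 * exp ((1 - w) * L))" by simp
    define g where "g = (\<lambda>t. f (line3 t))"
    have gC: "f (Complex 3 t) = g t" for t by (simp add: g_def Complex_eq)
    have gm: "g \<in> borel_measurable lborel"
    proof -
      have "continuous_on UNIV (\<lambda>t. psi_transform (line3 t))"
      proof -
        have sub: "range line3 \<subseteq> {s. Re s > 0}" by auto
        have nzl: "zeta_reg (line3 t) \<noteq> 0" for t by (rule zeta_reg_nonzero_right) simp
        have nz0: "line3 t \<noteq> 0" for t by (simp add: complex_eq_iff)
        have "continuous_on (range line3) psi_transform"
          unfolding psi_transform_def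
          by (intro continuous_intros holomorphic_on_imp_continuous_on[OF holomorphic_on_subset[OF zeta_reg_holomorphic sub]]
              holomorphic_on_imp_continuous_on[OF holomorphic_on_subset[OF holomorphic_deriv[OF zeta_reg_holomorphic open_halfspace_Re_gt] sub]])
            (use nzl nz0 in auto)
        then show ?thesis by (rule continuous_on_compose2) (auto intro!: continuous_intros)
      qed
      then have "continuous_on UNIV g" unfolding g_def f_def gauss_kernel_def
        by (intro continuous_intros) auto
      then show ?thesis by (simp add: borel_measurable_continuous_onI)
    qed
    have gb: "norm (g t) \<le> CF * norm (gauss_kernel d L (line3 t))" for t
      unfolding g_def f_def norm_mult by (intro mult_right_mono CF) auto
    have gi: "integrable lborel g"
      by (rule Bochner_Integration.integrable_bound[OF integrable_mult_right[OF integrable_norm_gauss_kernel[OF d(1), of L], of CF] gm])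
         (use gb CF in \<open>auto intro!: always_eventually simp: abs_mult\<close>)
    have split: "g t = indicator {-T..T} t *\<^sub>R g t + indicator (- {-T..T}) t *\<^sub>R g t" for t
      by (auto simp: indicator_def)
    have i1: "integrable lborel (\<lambda>t. indicator {-T..T} t *\<^sub>R g t)"
      by (rule integrable_mult_indicator[OF _ gi]) auto
    have i2: "integrable lborel (\<lambda>t. indicator (- {-T..T}) t *\<^sub>R g t)"
      by (rule integrable_mult_indicator[OF _ gi]) auto
    have e1: "(CLBINT t. g t) = (CLBINT t. indicator {-T..T} t *\<^sub>R g t) + (CLBINT t. indicator (- {-T..T}) t *\<^sub>R g t)"
      by (subst split) (rule Bochner_Integration.integral_add[OF i1 i2])
    have e2: "(CLBINT t. indicator {-T..T} t *\<^sub>R g t) = integral {-T..T} g"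
      using set_borel_integral_eq_integral(2)[of "{-T..T}" g] i1
      by (simp add: set_integrable_def set_lebesgue_integral_def)
    have e3: "(CLBINT t. g t) = integral {-T..T} g + (CLBINT t. indicator (- {-T..T}) t *\<^sub>R g t)"
      using e1 unfolding e2 .
    \<comment> \<open>Beyond height \<open>T\<close> the exponent \<open>- d^2 * t^2 / 2\<close> is
      split in halves: one is evaluated at \<open>T\<close> and gives the smallness, the other keeps
      \<open>t\<close> and gives integrability.\<close>
    have "norm (CLBINT t. indicator (- {-T..T}) t *\<^sub>R g t) \<le>
        (LBINT t. CF * E * exp (3 * L) * exp (- (d\<^sup>2 / 4) * T\<^sup>2) * exp (- (d\<^sup>2 / 4) * t\<^sup>2))"
    proof (rule order.trans[OF integral_norm_bound], rule Bochner_Integration.integral_mono)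
      show "integrable lborel (\<lambda>t. norm (indicator (- {-T..T}) t *\<^sub>R g t))"
        by (rule integrable_norm[OF i2])
      show "integrable lborel (\<lambda>t. CF * E * exp (3 * L) * exp (- (d\<^sup>2 / 4) * T\<^sup>2) * exp (- (d\<^sup>2 / 4) * t\<^sup>2))"
        using d by (intro integrable_mult_right integrable_exp_neg_square) auto
      fix t
      show "norm (indicator (- {-T..T}) t *\<^sub>R g t) \<le> CF * E * exp (3 * L) * exp (- (d\<^sup>2 / 4) * T\<^sup>2) * exp (- (d\<^sup>2 / 4) * t\<^sup>2)"
      proof (cases "t \<in> {-T..T}")
        case False
        then have "\<bar>t\<bar> \<ge> T" by auto
        then have "t\<^sup>2 \<ge> T\<^sup>2" using T by (metis abs_ge_zero order.trans power2_abs power_mono zero_le_one)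
        then have "d\<^sup>2 * T\<^sup>2 \<le> d\<^sup>2 * t\<^sup>2" by (intro mult_left_mono) auto
        moreover have "d\<^sup>2 * (3\<^sup>2 - t\<^sup>2) / 2 = 9 * d\<^sup>2 / 2 - d\<^sup>2 * t\<^sup>2 / 2"
          by (simp add: right_diff_distrib diff_divide_distrib)
        moreover have "- (d\<^sup>2 / 4) * T\<^sup>2 = - (d\<^sup>2 * T\<^sup>2 / 4)" "- (d\<^sup>2 / 4) * t\<^sup>2 = - (d\<^sup>2 * t\<^sup>2 / 4)" by simp_all
        ultimately have "3 * L + d\<^sup>2 * (3\<^sup>2 - t\<^sup>2) / 2 \<le> 9 / 2 + 3 * L + - (d\<^sup>2 / 4) * T\<^sup>2 + - (d\<^sup>2 / 4) * t\<^sup>2"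
          using d2 by linarith
        then have "norm (gauss_kernel d L (line3 t)) \<le> E * exp (3 * L) * exp (- (d\<^sup>2 / 4) * T\<^sup>2) * exp (- (d\<^sup>2 / 4) * t\<^sup>2)"
          unfolding norm_gauss_kernel E_def exp_add[symmetric] by simp
        then have "norm (g t) \<le> CF * (E * exp (3 * L) * exp (- (d\<^sup>2 / 4) * T\<^sup>2) * exp (- (d\<^sup>2 / 4) * t\<^sup>2))"
          using gb[of t] CF by (smt (verit) mult_left_mono)
        then show ?thesis using False by (simp add: mult.assoc)
      qed (use CF E in auto)
    qed
    moreover have "(LBINT t. CF * E * exp (3 * L) * exp (- (d\<^sup>2 / 4) * T\<^sup>2) * exp (- (d\<^sup>2 / 4) * t\<^sup>2))
        = CF * E * exp (3 * L) * exp (- (d\<^sup>2 / 4) * T\<^sup>2) * (2 * sqrt pi / d)"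
    proof -
      have "sqrt (pi / (d\<^sup>2 / 4)) = 2 * sqrt pi / d"
        using d by (simp add: real_sqrt_divide real_sqrt_mult)
      then show ?thesis using d integral_exp_neg_square[of "d\<^sup>2 / 4"]
        by (simp only: integral_mult_right_zero) simp
    qed
    moreover have "CF * E * exp (3 * L) * exp (- (d\<^sup>2 / 4) * T\<^sup>2) * (2 * sqrt pi / d) \<le> C * exp (3 * L) * exp (- (d\<^sup>2 / 4) * T\<^sup>2) / d"
    proof -
      have "CF * E * exp (3 * L) * exp (- (d\<^sup>2 / 4) * T\<^sup>2) * (2 * sqrt pi / d) =
         (CF * E * (2 * sqrt pi)) * (exp (3 * L) * exp (- (d\<^sup>2 / 4) * T\<^sup>2) / d)" by simp
      also have "\<dots> \<le> C * (exp (3 * L) * exp (- (d\<^sup>2 / 4) * T\<^sup>2) / d)"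
        using C d by (intro mult_right_mono) auto
      finally show ?thesis by simp
    qed
    ultimately have "norm (CLBINT t. g t) \<le> C * exp (3 * L) * exp (- (d\<^sup>2 / 4) * T\<^sup>2) / d +
       (C * (p ^ 5 * exp (3 * L) * exp (- (d\<^sup>2 / 4) * T\<^sup>2)) + C * (p ^ 35 * exp ((1 - w) * L)))" (is "_ \<le> ?R")
      using rect norm_triangle_ineq[of "integral {-T..T} g" "CLBINT t. indicator (- {-T..T}) t *\<^sub>R g t"]
      unfolding gC e3 by linarith
    moreover have "\<bar>LBINT v. psi_err v * normal_density L d v\<bar> = norm (CLBINT t. g t) / (2 * pi)"
    proof -
      have "\<bar>LBINT v. psi_err v * normal_density L d v\<bar> = norm (of_real (LBINT v. psi_err v * normal_density L d v) :: complex)"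
        by (simp only: norm_of_real)
      then show ?thesis unfolding smoothed_psi_err[OF d(1)] g_def f_def
        by (simp add: norm_divide norm_mult)
    qed
    moreover have "norm (CLBINT t. g t) / (2 * pi) \<le> norm (CLBINT t. g t)"
      using pi_gt3 mult_left_mono[of 1 "2 * pi" "norm (CLBINT t. g t)"] by (simp add: divide_le_eq)
    ultimately show ?thesis by (simp add: T_def w_def mult.assoc)
  qed
  then show ?thesis using that \<kappa> C by blast
qed

section \<open>The prime number theorem\<close>

text \<open>Exponential tilting: completing the square turns the weight \<open>exp (a * v)\<close>
  into a shift of the mean by \<open>a * d^2\<close>.\<close>

lemma exp_times_normal_density:
  assumes d: "d > 0"
  shows "exp (a * v) * normal_density L d v = exp (a * L + a\<^sup>2 * d\<^sup>2 / 2) * normal_density (L + a * d\<^sup>2) d v"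
proof -
  have "a * v + - (v - L)\<^sup>2 / (2 * d\<^sup>2) = a * L + a\<^sup>2 * d\<^sup>2 / 2 + - (v - (L + a * d\<^sup>2))\<^sup>2 / (2 * d\<^sup>2)"
    using d by (simp add: field_simps power2_eq_square)
  then have "exp (a * v) * exp (- (v - L)\<^sup>2 / (2 * d\<^sup>2)) = exp (a * L + a\<^sup>2 * d\<^sup>2 / 2) * exp (- (v - (L + a * d\<^sup>2))\<^sup>2 / (2 * d\<^sup>2))"
    by (simp only: exp_add[symmetric])
  then show ?thesis by (simp add: normal_density_def)
qed

lemma normal_exp_moment:
  assumes d: "d > 0"
  shows "has_bochner_integral lborel (\<lambda>v. exp (a * v) * normal_density L d v) (exp (a * L + a\<^sup>2 * d\<^sup>2 / 2))"
proof -
  have "has_bochner_integral lborel (normal_density (L + a * d\<^sup>2) d) 1"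
    using integrable_normal_density[OF d] integral_normal_density[OF d]
    by (simp add: has_bochner_integral_iff)
  from has_bochner_integral_mult_right[OF this, of "exp (a * L + a\<^sup>2 * d\<^sup>2 / 2)"]
  show ?thesis by (simp add: exp_times_normal_density[OF d])
qed

lemma integrable_psi_err_normal:
  assumes d: "d > 0"
  shows "integrable lborel (\<lambda>v. psi_err v * normal_density L d v)"
proof (rule Bochner_Integration.integrable_bound[OF has_bochner_integral_iff[THEN iffD1, THEN conjunct1, OF normal_exp_moment[OF d, of 2 L]]])
  show "AE v in lborel. norm (psi_err v * normal_density L d v) \<le> norm (exp (2 * v) * normal_density L d v)"
  proof (intro always_eventually allI)
    fix v
    have "\<bar>psi_err v\<bar> \<le> exp (2 * v)"
    proof (cases "v \<ge> 0")
      case True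
      have "psi (exp v) \<le> (exp v)\<^sup>2" by (rule psi_le_square) simp
      also have "(exp v)\<^sup>2 = exp (2 * v)" by (rule exp_double[symmetric])
      finally have "psi (exp v) \<le> exp (2 * v)" .
      moreover have "exp v \<le> exp (2 * v)" using True by simp
      moreover have "psi (exp v) \<ge> 0" by (rule psi_nonneg)
      moreover have "exp v \<ge> 0" by simp
      ultimately have "\<bar>psi (exp v) - exp v\<bar> \<le> exp (2 * v)" by linarith
      then show ?thesis using True by (simp add: psi_err_def)
    qed (simp add: psi_err_def)
    then show "norm (psi_err v * normal_density L d v) \<le> norm (exp (2 * v) * normal_density L d v)"
      using d by (simp add: abs_mult mult_right_mono)
  qed
qed simp

text \<open>The indicator of \<open>v >= X\<close> is replaced by the minorant
  \<open>1 - exp (k * (X - v))\<close>, at most 1 to the right of \<open>X\<close> and nonpositive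
  to the left. With it, monotonicity of \<open>psi\<close> becomes a pointwise inequality in
  \<open>v\<close> whose Gaussian integral is explicit; \<open>k\<close> stays free for
  optimisation.\<close>

lemma psi_upper_smoothed:
  assumes d: "d > 0" and k: "k \<ge> 0"
  shows "psi (exp X) * (1 - exp (k * (X - L) + k\<^sup>2 * d\<^sup>2 / 2)) \<le> (LBINT v. psi_err v * normal_density L d v) + exp (L + d\<^sup>2 / 2)"
proof -
  let ?P = "psi (exp X)"
  have hb: "has_bochner_integral lborel (\<lambda>v. ?P * (exp (0 * v) * normal_density L d v) - (?P * exp (k * X)) * (exp ((-k) * v) * normal_density L d v) - exp (1 * v) * normal_density L d v)
     (?P * exp (0 * L + 0\<^sup>2 * d\<^sup>2 / 2) - (?P * exp (k * X)) * exp ((-k) * L + (-k)\<^sup>2 * d\<^sup>2 / 2) - exp (1 * L + 1\<^sup>2 * d\<^sup>2 / 2))"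
    by (intro has_bochner_integral_diff has_bochner_integral_mult_right normal_exp_moment d)
  have val: "?P * exp (0 * L + 0\<^sup>2 * d\<^sup>2 / 2) - (?P * exp (k * X)) * exp ((-k) * L + (-k)\<^sup>2 * d\<^sup>2 / 2) - exp (1 * L + 1\<^sup>2 * d\<^sup>2 / 2)
     = ?P * (1 - exp (k * (X - L) + k\<^sup>2 * d\<^sup>2 / 2)) - exp (L + d\<^sup>2 / 2)"
  proof -
    have e: "exp (k * (X - L) + k\<^sup>2 * d\<^sup>2 / 2) = exp (k * X) * exp ((-k) * L + (-k)\<^sup>2 * d\<^sup>2 / 2)"
      by (simp add: exp_add[symmetric] right_diff_distrib)
    show ?thesis unfolding e by (simp add: right_diff_distrib)
  qed
  have le: "?P * (exp (0 * v) * normal_density L d v) - (?P * exp (k * X)) * (exp ((-k) * v) * normal_density L d v) - exp (1 * v) * normal_density L d v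
     \<le> psi_err v * normal_density L d v" for v
  proof -
    have P: "?P \<ge> 0" by (rule psi_nonneg)
    have "?P * (1 - exp (k * (X - v))) - exp v \<le> psi_err v"
    proof (cases "v \<ge> max 0 X")
      case True
      have "?P * (1 - exp (k * (X - v))) \<le> ?P * 1" using P by (intro mult_left_mono) auto
      also have "?P \<le> psi (exp v)" using True by (intro psi_mono) auto
      finally show ?thesis using True by (simp add: psi_err_def)
    next
      case False
      have "?P * (1 - exp (k * (X - v))) \<le> 0"
      proof (cases "v < X")
        case True
        then have "exp (k * (X - v)) \<ge> 1" using k by simp
        then show ?thesis using P by (intro mult_nonneg_nonpos) auto
      next
        case F: False
        \<comment> \<open>The remaining case has \<open>X <= v < 0\<close>, and there
          \<open>psi (exp X)\<close> vanishes.\<close>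
        then have "X < 0" using False by auto
        then show ?thesis by (simp add: psi_exp_neg)
      qed
      moreover have "psi_err v \<ge> - exp v"
        using psi_nonneg[of "exp v"] by (auto simp: psi_err_def indicator_def)
      ultimately show ?thesis by linarith
    qed
    then have "(?P * (1 - exp (k * (X - v))) - exp v) * normal_density L d v \<le> psi_err v * normal_density L d v"
      using d by (intro mult_right_mono) auto
    moreover have "exp (k * (X - v)) = exp (k * X) * exp ((-k) * v)"
      by (simp add: exp_add[symmetric] right_diff_distrib)
    ultimately show ?thesis by (simp add: left_diff_distrib right_diff_distrib mult.assoc)
  qed
  have "?P * (1 - exp (k * (X - L) + k\<^sup>2 * d\<^sup>2 / 2)) - exp (L + d\<^sup>2 / 2) \<le> (LBINT v. psi_err v * normal_density L d v)"
    using Bochner_Integration.integral_mono[OF integrable.intros[OF hb] integrable_psi_err_normal[OF d, of L] le]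
    unfolding has_bochner_integral_integral_eq[OF hb] val .
  then show ?thesis by linarith
qed

text \<open>To the right of \<open>X\<close>, where \<open>psi (exp v)\<close> may exceed
  \<open>psi (exp X)\<close>, it is at most \<open>exp (2 * v)\<close>, hence at most
  \<open>exp ((2 + k) * v - k * X)\<close>, whose Gaussian moment is explicit. The summand 1 pays
  for \<open>v < 0\<close>, where \<open>psi_err\<close> is 0 while \<open>- exp v\<close> may be
  close to -1.\<close>

lemma psi_lower_smoothed:
  assumes d: "d > 0" and k: "k \<ge> 0"
  shows "(LBINT v. psi_err v * normal_density L d v) + exp (L + d\<^sup>2 / 2) \<le> psi (exp X) + 1 + exp ((2 + k) * L + (2 + k)\<^sup>2 * d\<^sup>2 / 2 - k * X)"
proof -
  let ?P = "psi (exp X)"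
  have hb: "has_bochner_integral lborel (\<lambda>v. (?P + 1) * (exp (0 * v) * normal_density L d v) - exp (1 * v) * normal_density L d v + exp (- k * X) * (exp ((2 + k) * v) * normal_density L d v))
     ((?P + 1) * exp (0 * L + 0\<^sup>2 * d\<^sup>2 / 2) - exp (1 * L + 1\<^sup>2 * d\<^sup>2 / 2) + exp (- k * X) * exp ((2 + k) * L + (2 + k)\<^sup>2 * d\<^sup>2 / 2))"
    by (intro has_bochner_integral_diff has_bochner_integral_add has_bochner_integral_mult_right normal_exp_moment d)
  have val: "(?P + 1) * exp (0 * L + 0\<^sup>2 * d\<^sup>2 / 2) - exp (1 * L + 1\<^sup>2 * d\<^sup>2 / 2) + exp (- k * X) * exp ((2 + k) * L + (2 + k)\<^sup>2 * d\<^sup>2 / 2)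
     = ?P + 1 - exp (L + d\<^sup>2 / 2) + exp ((2 + k) * L + (2 + k)\<^sup>2 * d\<^sup>2 / 2 - k * X)"
    by (simp add: exp_add[symmetric])
  have le: "psi_err v * normal_density L d v \<le> (?P + 1) * (exp (0 * v) * normal_density L d v) - exp (1 * v) * normal_density L d v + exp (- k * X) * (exp ((2 + k) * v) * normal_density L d v)" for v
  proof -
    have P: "?P \<ge> 0" by (rule psi_nonneg)
    have "psi_err v \<le> ?P + 1 - exp v + exp ((2 + k) * v - k * X)"
    proof (cases "v \<ge> 0")
      case True
      have "psi (exp v) \<le> ?P + exp ((2 + k) * v - k * X)"
      proof (cases "v \<le> X")
        case True
        then have "psi (exp v) \<le> ?P" by (intro psi_mono) simp
        then show ?thesis by (simp add: add_increasing2)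
      next
        case False
        have "psi (exp v) \<le> (exp v)\<^sup>2" by (rule psi_le_square) simp
        also have "\<dots> = exp (2 * v)" by (rule exp_double[symmetric])
        also have "\<dots> \<le> exp ((2 + k) * v - k * X)"
          using False k mult_left_mono[of X v k] by (simp add: algebra_simps)
        finally show ?thesis using P by linarith
      qed
      then show ?thesis using True by (simp add: psi_err_def)
    next
      case False
      then have "exp v \<le> 1" by simp
      moreover have "psi_err v = 0" using False by (simp add: psi_err_def)
      moreover have "exp ((2 + k) * v - k * X) > 0" by simp
      ultimately show ?thesis using P by linarith
    qed
    then have "psi_err v * normal_density L d v \<le> (?P + 1 - exp v + exp ((2 + k) * v - k * X)) * normal_density L d v"
      using d by (intro mult_right_mono) auto
    moreover have "exp ((2 + k) * v - k * X) = exp (- k * X) * exp ((2 + k) * v)"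
      by (simp add: exp_add[symmetric])
    ultimately show ?thesis by (simp add: distrib_right left_diff_distrib mult.assoc)
  qed
  have "(LBINT v. psi_err v * normal_density L d v) \<le> ?P + 1 - exp (L + d\<^sup>2 / 2) + exp ((2 + k) * L + (2 + k)\<^sup>2 * d\<^sup>2 / 2 - k * X)"
    using Bochner_Integration.integral_mono[OF integrable_psi_err_normal[OF d, of L] integrable.intros[OF hb] le]
    unfolding has_bochner_integral_integral_eq[OF hb] val .
  then show ?thesis by linarith
qed

text \<open>Taking \<open>p = X powr (1/10)\<close> gives \<open>T = X^3\<close> and width
  \<open>kappa / sqrt X\<close>. Then \<open>(d^2 / 4) * T^2\<close> is \<open>X^2 / 4\<close>,
  which beats \<open>3 * L\<close>, and the left side saves \<open>exp (- kappa * sqrt X)\<close> up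
  to a bounded factor, which beats \<open>X powr (7/2)\<close>. Uniformity in \<open>L\<close>
  serves the two centres \<open>X + 1 / X\<close> and \<open>X - 1 / X\<close>.\<close>

lemma smoothed_psi_err_bound:
  "\<forall>\<^sub>F X in at_top. \<forall>L. \<bar>L - X\<bar> \<le> 1 \<longrightarrow> \<bar>LBINT v. psi_err v * normal_density L (1 / X\<^sup>2) v\<bar> \<le> exp X / X"
proof -
  obtain \<kappa> C0 where \<kappa>: "\<kappa> > 0" and C0: "C0 \<ge> 0"
    and b: "\<And>p d L. p \<ge> 1 \<Longrightarrow> 0 < d \<Longrightarrow> d \<le> 1 \<Longrightarrow> L \<ge> 0 \<Longrightarrow> \<bar>LBINT v. psi_err v * normal_density L d v\<bar> \<le>
       C0 * exp (3 * L) * exp (- (d\<^sup>2 / 4) * (p ^ 30)\<^sup>2) / d + C0 * p ^ 5 * exp (3 * L) * exp (- (d\<^sup>2 / 4) * (p ^ 30)\<^sup>2)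
       + C0 * p ^ 35 * exp ((1 - \<kappa> / p ^ 5) * L)"
    using smoothed_psi_err_bound_explicit by blast
  define C where "C = C0 + 1"
  have C: "C > 0" using C0 by (simp add: C_def)
  have ev: "\<forall>\<^sub>F X in at_top. C * exp (3 * (X + 1)) * exp (- (X\<^sup>2 / 4)) * X\<^sup>2 + C * X powr (1/2) * exp (3 * (X + 1)) * exp (- (X\<^sup>2 / 4))
     + C * X powr (7/2) * exp (X + 1 - \<kappa> * X powr (-1/2) * (X - 1)) \<le> exp X / X"
    using C \<kappa> by real_asymp
  show ?thesis using ev eventually_ge_at_top[of 1]
  proof eventually_elim
    case (elim X)
    show ?case
    proof (intro allI impI)
      fix L assume L: "\<bar>L - X\<bar> \<le> 1"
      define p where "p = X powr (1/10)"
      define d where "d = 1 / X\<^sup>2"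
      have X: "X \<ge> 1" by (rule elim(2))
      have p: "p \<ge> 1" using X by (simp add: p_def ge_one_powr_ge_zero)
      have pw: "p ^ n = X powr (real n / 10)" for n
        using X by (simp add: p_def powr_powr flip: powr_realpow)
      have d: "0 < d" "d \<le> 1" using X by (auto simp: d_def divide_le_eq one_le_power)
      have p30: "(p ^ 30)\<^sup>2 = X ^ 6"
      proof -
        have "(p ^ 30)\<^sup>2 = p ^ 60" by (simp flip: power_mult)
        also have "\<dots> = X powr real 6" unfolding pw by simp
        also have "\<dots> = X ^ 6" using X by (intro powr_realpow) auto
        finally show ?thesis .
      qed
      have e1: "(d\<^sup>2 / 4) * (p ^ 30)\<^sup>2 = X\<^sup>2 / 4"
        unfolding p30 d_def using X by (simp add: power_divide field_simps flip: power_add power_mult)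
      have L0: "L \<ge> 0" "L \<le> X + 1" "L \<ge> X - 1" using L X by auto
      have p5: "p ^ 5 = X powr (1/2)" unfolding pw by simp
      have p35: "p ^ 35 = X powr (7/2)" unfolding pw by simp
      have w: "\<kappa> / p ^ 5 = \<kappa> * X powr (-1/2)" unfolding p5 by (simp add: powr_minus_divide)
      have e3: "exp (3 * L) \<le> exp (3 * (X + 1))" using L0 by simp
      have "(1 - \<kappa> * X powr (-1/2)) * L = L - \<kappa> * X powr (-1/2) * L" by (simp add: left_diff_distrib)
      also have "\<dots> \<le> X + 1 - \<kappa> * X powr (-1/2) * (X - 1)"
        using L0 \<kappa> by (intro diff_mono mult_left_mono) auto
      finally have e2: "exp ((1 - \<kappa> / p ^ 5) * L) \<le> exp (X + 1 - \<kappa> * X powr (-1/2) * (X - 1))"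
        unfolding w by simp
      have "\<bar>LBINT v. psi_err v * normal_density L d v\<bar> \<le>
         C0 * exp (3 * L) * exp (- (X\<^sup>2 / 4)) / d + C0 * p ^ 5 * exp (3 * L) * exp (- (X\<^sup>2 / 4))
         + C0 * p ^ 35 * exp ((1 - \<kappa> / p ^ 5) * L)"
        using b[OF p d L0(1)] unfolding minus_mult_left[symmetric] e1 .
      also have "C0 * exp (3 * L) * exp (- (X\<^sup>2 / 4)) / d = C0 * exp (3 * L) * exp (- (X\<^sup>2 / 4)) * X\<^sup>2"
        by (simp add: d_def)
      also have "\<dots> \<le> C * exp (3 * (X + 1)) * exp (- (X\<^sup>2 / 4)) * X\<^sup>2"
        using C0 e3 by (intro mult_right_mono mult_mono) (auto simp: C_def)
      also have "C0 * p ^ 5 * exp (3 * L) * exp (- (X\<^sup>2 / 4)) \<le> C * X powr (1/2) * exp (3 * (X + 1)) * exp (- (X\<^sup>2 / 4))"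
        unfolding p5 using C0 e3 by (intro mult_right_mono mult_mono) (auto simp: C_def)
      also have "C0 * p ^ 35 * exp ((1 - \<kappa> / p ^ 5) * L) \<le> C * X powr (7/2) * exp (X + 1 - \<kappa> * X powr (-1/2) * (X - 1))"
        using C0 e2 unfolding p35 by (intro mult_mono) (auto simp: C_def)
      also note elim(1)
      finally show "\<bar>LBINT v. psi_err v * normal_density L (1 / X\<^sup>2) v\<bar> \<le> exp X / X"
        by (simp add: d_def)
    qed
  qed
qed

text \<open>Of the three units of \<open>exp X / X\<close>, one bounds the smoothed error, one the
  displacement of the main term by \<open>1 / X\<close> in the exponent, and the third absorbs all
  lower order terms.\<close>

theorem psi_asymp_exp: "\<forall>\<^sub>F X in at_top. \<bar>psi (exp X) - exp X\<bar> \<le> 3 * exp X / X"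
proof -
  have u: "\<forall>\<^sub>F X::real in at_top. exp X / X + exp (X + 1 / X + (1 / X\<^sup>2)\<^sup>2 / 2) \<le> (exp X + 3 * exp X / X) * (1 - exp (- (X\<^sup>2 / 2)))"
    by real_asymp
  have l: "\<forall>\<^sub>F X::real in at_top. exp X - 3 * exp X / X \<le> - (exp X / X) + exp (X - 1 / X + (1 / X\<^sup>2)\<^sup>2 / 2) - 1 - exp (2 * X - X\<^sup>2 / 2)"
    by real_asymp
  show ?thesis using smoothed_psi_err_bound u l eventually_ge_at_top[of 2]
  proof eventually_elim
    case (elim X)
    have X: "X \<ge> 2" by (rule elim(4))
    let ?d = "1 / X\<^sup>2"
    have d: "?d > 0" using X by simp
    \<comment> \<open>Tilting by \<open>k = X\<^sup>3\<close> (resp. \<open>2 + k = X\<^sup>3\<close>) is the optimal Chernoff bound: the shift \<open>1/X\<close> is \<open>X\<close> standard deviations.\<close>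
    have X1: "\<bar>1 / X\<bar> \<le> 1" using X by simp
    have X3: "X ^ 3 \<ge> 2" using X power_increasing[of 1 3 X] by simp
    have k2: "(X ^ 3)\<^sup>2 * ?d\<^sup>2 = X\<^sup>2" using X by (simp add: field_simps flip: power_mult power_add)
    have xx: "X ^ 3 * (1 / X) = X\<^sup>2" using X by (simp add: power2_eq_square power3_eq_cube)
    have "psi (exp X) * (1 - exp (X ^ 3 * (X - (X + 1 / X)) + (X ^ 3)\<^sup>2 * ?d\<^sup>2 / 2)) \<le>
        (LBINT v. psi_err v * normal_density (X + 1 / X) ?d v) + exp (X + 1 / X + ?d\<^sup>2 / 2)"
      using X by (intro psi_upper_smoothed d) auto
    also have "(LBINT v. psi_err v * normal_density (X + 1 / X) ?d v) \<le> exp X / X"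
      using elim(1) X1 by (auto dest!: spec[of _ "X + 1 / X"])
    also note elim(2)
    also have "X ^ 3 * (X - (X + 1 / X)) + (X ^ 3)\<^sup>2 * ?d\<^sup>2 / 2 = - (X\<^sup>2 / 2)"
      unfolding k2 using xx by (simp add: right_diff_distrib distrib_left)
    finally have "psi (exp X) * (1 - exp (- (X\<^sup>2 / 2))) \<le> (exp X + 3 * exp X / X) * (1 - exp (- (X\<^sup>2 / 2)))" by simp
    moreover have "1 - exp (- (X\<^sup>2 / 2)) > 0" using X by simp
    ultimately have 1: "psi (exp X) \<le> exp X + 3 * exp X / X" by (simp only: mult_le_cancel_right_pos)
    have low: "(LBINT v. psi_err v * normal_density (X - 1 / X) ?d v) + exp (X - 1 / X + ?d\<^sup>2 / 2) \<le>
       psi (exp X) + 1 + exp ((2 + (X ^ 3 - 2)) * (X - 1 / X) + (2 + (X ^ 3 - 2))\<^sup>2 * ?d\<^sup>2 / 2 - (X ^ 3 - 2) * X)"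
      using X3 by (intro psi_lower_smoothed d) auto
    have e: "(2 + (X ^ 3 - 2)) * (X - 1 / X) + (2 + (X ^ 3 - 2))\<^sup>2 * ?d\<^sup>2 / 2 - (X ^ 3 - 2) * X = 2 * X - X\<^sup>2 / 2"
    proof -
      have "2 + (X ^ 3 - 2) = X ^ 3" by simp
      then show ?thesis using xx by (simp only: k2) (simp add: right_diff_distrib left_diff_distrib)
    qed
    have "\<bar>LBINT v. psi_err v * normal_density (X - 1 / X) ?d v\<bar> \<le> exp X / X"
      using elim(1) X1 by (auto dest!: spec[of _ "X - 1 / X"])
    then have 2: "psi (exp X) \<ge> exp X - 3 * exp X / X" using elim(3) low unfolding e by linarith
    from 1 2 show ?case by linarith
  qed
qed

theorem psi_asymp: "\<forall>\<^sub>F x in at_top. \<bar>psi x - x\<bar> \<le> 3 * x / ln x"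
proof -
  have "\<forall>\<^sub>F x in at_top. \<bar>psi (exp (ln x)) - exp (ln x)\<bar> \<le> 3 * exp (ln x) / ln x"
    using psi_asymp_exp ln_at_top by (rule eventually_compose_filterlim)
  then show ?thesis using eventually_gt_at_top[of 0]
    by eventually_elim simp
qed

section \<open>From primes to sums of two squares\<close>

definition theta :: "real \<Rightarrow> real" where
  "theta x = (\<Sum>n | real n \<le> x \<and> prime n. ln (real n))"

lemma finite_nat_le_conj: "finite {n. real n \<le> x \<and> P n}"
  by (rule finite_subset[OF _ finite_nat_le[of x]]) auto

lemma primepow_nonprimeE:
  assumes "primepow n" "\<not> prime n"
  obtains p k where "prime p" "n = p ^ k" "k \<ge> 2"
proof -
  from assms(1) obtain p k where pk: "prime p" "k > 0" "n = p ^ k" by (auto simp: primepow_def)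
  have "k \<noteq> 1" using pk assms(2) by auto
  then show ?thesis using that[of p k] pk by auto
qed

text \<open>A nonprime prime power \<open>p ^ k <= x\<close> has \<open>p <= sqrt x\<close> and
  \<open>k <= log 2 x\<close>. Anything below \<open>x / ln x\<close> is good enough, hence the
  crude count by pairs \<open>(p, k)\<close> and the bound \<open>ln x\<close> for each
  term.\<close>

lemma psi_minus_theta_bounds:
  assumes x: "x \<ge> 1"
  shows "theta x \<le> psi x" and "psi x - theta x \<le> (sqrt x + 1) * (log 2 x + 1) * ln x"
proof -
  define S where "S = {n. real n \<le> x \<and> primepow n \<and> \<not> prime n}"
  have finS: "finite S" unfolding S_def by (rule finite_nat_le_conj)
  have "psi x = (\<Sum>n\<in>{n. real n \<le> x \<and> prime n} \<union> S. vonm n)"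
    unfolding psi_def
    by (intro sum.mono_neutral_right finite_nat_le) (auto simp: S_def mangoldt_def)
  also have "\<dots> = (\<Sum>n | real n \<le> x \<and> prime n. vonm n) + (\<Sum>n\<in>S. vonm n)"
    by (intro sum.union_disjoint finite_nat_le_conj finS) (auto simp: S_def)
  also have "(\<Sum>n | real n \<le> x \<and> prime n. vonm n) = theta x"
    unfolding theta_def by (intro sum.cong) auto
  finally have eq: "psi x = theta x + (\<Sum>n\<in>S. vonm n)" .
  then show "theta x \<le> psi x" by (simp add: sum_nonneg mangoldt_nonneg)
  define P where "P = {..nat \<lfloor>sqrt x\<rfloor>} \<times> {..nat \<lfloor>log 2 x\<rfloor>}"
  have "S \<subseteq> (\<lambda>(p, k). p ^ k) ` P"
  proof
    fix n assume "n \<in> S"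
    then have n: "real n \<le> x" "primepow n" "\<not> prime n" by (auto simp: S_def)
    from n(2,3) obtain p k where pk: "prime p" "n = p ^ k" "k \<ge> 2" by (rule primepow_nonprimeE)
    have p2: "p \<ge> 2" using pk(1) by (rule prime_ge_2_nat)
    have "p ^ 2 \<le> n" using pk p2 by (auto intro!: power_increasing)
    then have "real p ^ 2 \<le> x" using n(1) by (metis of_nat_le_iff of_nat_power order.trans)
    then have "real p \<le> sqrt x" by (rule real_le_rsqrt)
    then have "p \<le> nat \<lfloor>sqrt x\<rfloor>" by (rule le_nat_floor)
    moreover have "2 ^ k \<le> n" using pk p2 by (auto intro!: power_mono)
    then have "2 ^ k \<le> x" using n(1) by (metis of_nat_le_iff of_nat_numeral of_nat_power order.trans)
    then have "real k \<le> log 2 x" using x by (subst le_log_iff) (auto simp: powr_realpow)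
    then have "k \<le> nat \<lfloor>log 2 x\<rfloor>" by (rule le_nat_floor)
    ultimately show "n \<in> (\<lambda>(p, k). p ^ k) ` P" using pk by (force simp: P_def)
  qed
  then have "card S \<le> card P" by (rule surj_card_le[rotated]) (simp add: P_def)
  also have "card P = (nat \<lfloor>sqrt x\<rfloor> + 1) * (nat \<lfloor>log 2 x\<rfloor> + 1)" by (simp add: P_def)
  finally have "real (card S) \<le> real ((nat \<lfloor>sqrt x\<rfloor> + 1) * (nat \<lfloor>log 2 x\<rfloor> + 1))" by (simp only: of_nat_le_iff)
  also have "\<dots> = (real (nat \<lfloor>sqrt x\<rfloor>) + 1) * (real (nat \<lfloor>log 2 x\<rfloor>) + 1)" by (simp only: of_nat_mult of_nat_add of_nat_1)
  also have "\<dots> \<le> (sqrt x + 1) * (log 2 x + 1)"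
    using x by (intro mult_mono add_mono of_nat_floor) auto
  finally have card: "real (card S) \<le> (sqrt x + 1) * (log 2 x + 1)" .
  have "(\<Sum>n\<in>S. vonm n) \<le> (\<Sum>n\<in>S. ln x)"
  proof (rule sum_mono)
    fix n assume "n \<in> S"
    then have n: "real n \<le> x" "n > 0" by (auto simp: S_def intro!: Nat.gr0I)
    then have "vonm n \<le> ln (real n)" by (intro mangoldt_le)
    also have "\<dots> \<le> ln x" using n by (intro ln_mono) auto
    finally show "vonm n \<le> ln x" .
  qed
  also have "\<dots> = real (card S) * ln x" by simp
  also have "\<dots> \<le> (sqrt x + 1) * (log 2 x + 1) * ln x"
    using card x by (intro mult_right_mono) auto
  finally show "psi x - theta x \<le> (sqrt x + 1) * (log 2 x + 1) * ln x" using eq by simp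
qed

lemma theta_asymp: "\<forall>\<^sub>F x in at_top. \<bar>theta x - x\<bar> \<le> 4 * x / ln x"
proof -
  have "\<forall>\<^sub>F x::real in at_top. (sqrt x + 1) * (log 2 x + 1) * ln x \<le> x / ln x"
    by real_asymp
  then show ?thesis using psi_asymp eventually_ge_at_top[of 1]
  proof eventually_elim
    case (elim x)
    then show ?case using psi_minus_theta_bounds[of x] by linarith
  qed
qed

text \<open>Partial summation requires an error in terms of \<open>y\<close> at every
  \<open>m <= y\<close>. Above \<open>y powr (1/3)\<close>, \<open>ln m >= ln y / 3\<close> turns
  the constant 4 into 12; below, \<open>theta m\<close> and \<open>m\<close> both lie between 0 and
  \<open>m^2\<close>, which is at most \<open>y powr (2/3)\<close>.\<close>

lemma theta_uniform:
  "\<forall>\<^sub>F y in at_top. \<forall>m::nat. real m \<le> y \<longrightarrow> \<bar>theta (real m) - real m\<bar> \<le> 12 * y / ln y"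
proof -
  obtain x0 where x0: "\<And>x. x \<ge> x0 \<Longrightarrow> \<bar>theta x - x\<bar> \<le> 4 * x / ln x"
    using theta_asymp by (auto simp: eventually_at_top_linorder)
  have "\<forall>\<^sub>F y::real in at_top. y powr (1/3) \<ge> max x0 2" by real_asymp
  moreover have "\<forall>\<^sub>F y::real in at_top. (y powr (1/3))\<^sup>2 \<le> 12 * y / ln y" by real_asymp
  ultimately show ?thesis using eventually_ge_at_top[of 2]
  proof eventually_elim
    case (elim y)
    show ?case
    proof (intro allI impI)
      fix m :: nat assume m: "real m \<le> y"
      show "\<bar>theta (real m) - real m\<bar> \<le> 12 * y / ln y"
      proof (cases "real m \<ge> y powr (1/3)")
        case True
        then have m2: "real m \<ge> x0" "real m \<ge> 2" using elim(1) by auto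
        have "ln y / 3 = ln (y powr (1/3))" using elim(3) by (simp add: ln_powr)
        also have "\<dots> \<le> ln (real m)" using True elim(3) m2 by (subst ln_le_cancel_iff) auto
        finally have ln: "ln y / 3 \<le> ln (real m)" .
        have "\<bar>theta (real m) - real m\<bar> \<le> 4 * real m / ln (real m)" by (rule x0[OF m2(1)])
        also have "\<dots> \<le> 4 * y / (ln y / 3)"
          using ln m elim(3) by (intro frac_le) auto
        finally show ?thesis by simp
      next
        case False
        have "theta (real m) \<le> (real m)\<^sup>2"
        proof (cases "m = 0")
          case False
          then have "theta (real m) \<le> psi (real m)" by (intro psi_minus_theta_bounds) auto
          also have "\<dots> \<le> (real m)\<^sup>2" by (rule psi_le_square) simp
          finally show ?thesis .
        next
          case True
          have "{n. real n \<le> real m \<and> prime n} = {}" using True by auto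
          then show ?thesis using True by (simp add: theta_def)
        qed
        moreover have "theta (real m) \<ge> 0"
          unfolding theta_def by (intro sum_nonneg) (auto dest!: prime_gt_0_nat)
        moreover have "real m \<le> (real m)\<^sup>2"
          by (cases "m = 0") (auto simp: power2_eq_square)
        moreover have "(real m)\<^sup>2 \<le> (y powr (1/3))\<^sup>2" using False by (intro power_mono) auto
        ultimately show ?thesis using elim(2) by linarith
      qed
    qed
  qed
qed

text \<open>Monotonicity of \<open>g\<close> makes the increments in summation by parts telescope,
  so the variation and the last value together cost the first value of \<open>g\<close>. The
  induction carries the sum without its boundary term \<open>T m * g m\<close>, which is put back at
  \<open>m = N\<close>.\<close>

lemma abel_sum_bound:
  fixes b g :: "nat \<Rightarrow> real"
  assumes N: "M < N"
    and S: "\<And>m. M < m \<Longrightarrow> m \<le> N \<Longrightarrow> \<bar>\<Sum>n\<in>{M<..m}. b n\<bar> \<le> K"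
    and g: "\<And>n. M < n \<Longrightarrow> n < N \<Longrightarrow> g (Suc n) \<le> g n" and g0: "g N \<ge> 0"
  shows "\<bar>\<Sum>n\<in>{M<..N}. b n * g n\<bar> \<le> K * g (Suc M)"
proof -
  define T where "T = (\<lambda>m. \<Sum>n\<in>{M<..m}. b n)"
  have ins: "{M<..Suc m} = insert (Suc m) {M<..m}" if "M \<le> m" for m using that by auto
  have "m \<le> N \<longrightarrow> \<bar>(\<Sum>n\<in>{M<..m}. b n * g n) - T m * g m\<bar> \<le> K * (g (Suc M) - g m)" if "Suc M \<le> m" for m
    using that
  proof (induction m rule: dec_induct)
    case base
    have "{M<..Suc M} = {Suc M}" by auto
    then show ?case by (simp add: T_def)
  next
    case (step m)
    show ?case
    proof
      assume m: "Suc m \<le> N"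
      have "(\<Sum>n\<in>{M<..Suc m}. b n * g n) - T (Suc m) * g (Suc m) =
         ((\<Sum>n\<in>{M<..m}. b n * g n) - T m * g m) + T m * (g m - g (Suc m))"
        using step(1) by (simp add: T_def ins algebra_simps)
      also have "\<bar>\<dots>\<bar> \<le> K * (g (Suc M) - g m) + \<bar>T m * (g m - g (Suc m))\<bar>"
        using step m by (intro order.trans[OF abs_triangle_ineq] add_right_mono) auto
      also have "\<bar>T m * (g m - g (Suc m))\<bar> \<le> K * (g m - g (Suc m))"
        unfolding abs_mult using g[of m] S[of m] step(1) m by (intro mult_mono) (auto simp: T_def)
      finally show "\<bar>(\<Sum>n\<in>{M<..Suc m}. b n * g n) - T (Suc m) * g (Suc m)\<bar> \<le> K * (g (Suc M) - g (Suc m))"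
        by (simp add: algebra_simps)
    qed
  qed
  from this[of N] N have "\<bar>(\<Sum>n\<in>{M<..N}. b n * g n) - T N * g N\<bar> \<le> K * (g (Suc M) - g N)" by auto
  moreover have "\<bar>T N * g N\<bar> \<le> K * g N"
    unfolding abs_mult using S[of N] N g0 by (intro mult_mono) (auto simp: T_def)
  ultimately show ?thesis by (simp add: right_diff_distrib)
qed

text \<open>Termwise \<open>1 / sqrt n <= 2 * (sqrt n - sqrt (n - 1))\<close>, and this telescopes.
  It serves to average the weight \<open>1 / sqrt n\<close> of
  \<open>inverse_ln_diff\<close>.\<close>

lemma sum_inverse_sqrt_le: "(\<Sum>n\<in>{1..N}. 1 / sqrt (real n)) \<le> 2 * sqrt (real N)"
proof (induction N)
  case (Suc N)
  have "1 / sqrt (real (Suc N)) \<le> 2 * (sqrt (real (Suc N)) - sqrt (real N))"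
  proof -
    let ?a = "sqrt (real (Suc N))" and ?b = "sqrt (real N)"
    have a: "?a > 0" "?b \<ge> 0" "?b \<le> ?a" by auto
    have e: "(?a - ?b) * (?a + ?b) = 1" by (simp add: algebra_simps)
    have "(?a - ?b) * (?a + ?b) \<le> (?a - ?b) * (2 * ?a)" using a by (intro mult_left_mono) auto
    then have "1 \<le> 2 * (?a - ?b) * ?a" unfolding e by (simp only: mult_ac)
    then show ?thesis using a(1) by (simp only: pos_divide_le_eq)
  qed
  then show ?case using Suc by simp
qed simp

text \<open>\<open>F\<close> is the classical primitive of \<open>sqrt (y^2 - u^2)\<close>. As the
  integrand decreases from \<open>y\<close>, sum and integral over \<open>[0, N]\<close> differ by
  at most \<open>y\<close>; the last piece \<open>[N, y]\<close> adds at most another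
  \<open>y\<close>.\<close>

lemma quarter_disc_sum:
  assumes y: "y \<ge> 1"
  shows "\<bar>(\<Sum>n\<in>{1..nat \<lfloor>y\<rfloor>}. sqrt (y\<^sup>2 - (real n)\<^sup>2)) - pi / 4 * y\<^sup>2\<bar> \<le> 2 * y"
proof -
  define h where "h = (\<lambda>u. sqrt (y\<^sup>2 - u\<^sup>2))"
  define F where "F = (\<lambda>u. (u * h u + y\<^sup>2 * arcsin (u / y)) / 2)"
  have dF: "(F has_real_derivative h u) (at u)" if u: "0 < u" "u < y" for u
  proof -
    have pos: "y\<^sup>2 - u\<^sup>2 > 0" using u by (simp add: power_strict_mono)
    have hpos: "h u > 0" using pos by (simp add: h_def)
    have hh: "h u * h u = y\<^sup>2 - u\<^sup>2" using pos by (simp add: h_def)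
    have dh: "(h has_real_derivative - u / h u) (at u)"
      unfolding h_def using pos by (auto intro!: derivative_eq_intros simp: field_simps)
    have s: "sqrt (1 - (u / y)\<^sup>2) = h u / y"
    proof -
      have "1 - (u / y)\<^sup>2 = (y\<^sup>2 - u\<^sup>2) / y\<^sup>2" using y by (simp add: field_simps)
      then show ?thesis using y by (simp add: real_sqrt_divide h_def)
    qed
    have da: "((\<lambda>u. arcsin (u / y)) has_real_derivative 1 / h u) (at u)"
    proof -
      have "(arcsin has_real_derivative inverse (sqrt (1 - (u / y)\<^sup>2))) (at (u / y))"
        by (rule DERIV_arcsin) (use u y in \<open>auto simp: field_simps\<close>)
      moreover have "((\<lambda>u. u / y) has_real_derivative 1 / y) (at u)"
        using y by (auto intro!: derivative_eq_intros)
      ultimately have "((\<lambda>u. arcsin (u / y)) has_real_derivative inverse (sqrt (1 - (u / y)\<^sup>2)) * (1 / y)) (at u)"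
        by (rule DERIV_chain2)
      then show ?thesis unfolding s using y by (simp add: field_simps)
    qed
    have d1: "(F has_real_derivative (1 * h u + (- u / h u) * u + y\<^sup>2 * (1 / h u)) / 2) (at u)"
      unfolding F_def by (intro DERIV_cdivide DERIV_add DERIV_mult DERIV_cmult dh da DERIV_ident)
    have e1: "(1 * h u + (- u / h u) * u + y\<^sup>2 * (1 / h u)) / 2 = h u"
    proof -
      have "(1 * h u + (- u / h u) * u + y\<^sup>2 * (1 / h u)) = h u + (y\<^sup>2 - u\<^sup>2) / h u"
        by (simp add: diff_divide_distrib power2_eq_square)
      also have "\<dots> = 2 * h u" using hpos by (simp flip: hh)
      finally show ?thesis by simp
    qed
    show ?thesis using d1 unfolding e1 .
  qed
  \<comment> \<open>At \<open>u = y\<close> the derivatives of \<open>h\<close> and of the arcsine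
    term blow up, so the endpoint is reached by continuity.\<close>
  have contF: "continuous_on {0..y} F"
    unfolding F_def h_def using y by (intro continuous_intros) (auto simp: divide_le_eq le_divide_eq)
  have hmono: "h v \<le> h u" if "0 \<le> u" "u \<le> v" for u v
    using that by (auto simp: h_def intro!: power_mono)
  have step: "h v * (v - u) \<le> F v - F u \<and> F v - F u \<le> h u * (v - u)" if uv: "0 \<le> u" "u < v" "v \<le> y" for u v
  proof -
    have "\<exists>l z. u < z \<and> z < v \<and> (F has_real_derivative l) (at z) \<and> F v - F u = (v - u) * l"
    proof (rule MVT)
      show "continuous_on {u..v} F" by (rule continuous_on_subset[OF contF]) (use uv in auto)
      show "F differentiable (at z)" if "u < z" "z < v" for z
        using dF[of z] that uv by (auto simp: real_differentiable_def)
    qed (use uv in auto)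
    then obtain l z where z: "u < z" "z < v" "(F has_real_derivative l) (at z)" "F v - F u = (v - u) * l" by blast
    have "l = h z" using z dF[of z] uv by (intro DERIV_unique[of F l z]) auto
    then show ?thesis using z uv hmono[of u z] hmono[of z v]
      by (auto simp: mult.commute[of "v - u"] intro!: mult_right_mono)
  qed
  have Fy: "F y = pi / 4 * y\<^sup>2" using y by (simp add: F_def h_def)
  have F0: "F 0 = 0" by (simp add: F_def)
  have h0: "h u \<le> y" if "u \<ge> 0" for u
    using y that hmono[of 0 u] by (auto simp: h_def)
  define N where "N = nat \<lfloor>y\<rfloor>"
  have Ny: "real N \<le> y" "y < real N + 1" using y by (auto simp: N_def)
  have "m \<le> N \<Longrightarrow> (\<Sum>n\<in>{1..m}. h (real n)) \<le> F (real m) \<and> F (real m) \<le> (\<Sum>n\<in>{1..m}. h (real n)) + h 0 - h (real m)" for m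
  proof (induction m)
    case 0
    then show ?case by (simp add: F0)
  next
    case (Suc m)
    have "h (real (Suc m)) * (real (Suc m) - real m) \<le> F (real (Suc m)) - F (real m) \<and>
        F (real (Suc m)) - F (real m) \<le> h (real m) * (real (Suc m) - real m)"
      using Suc.prems Ny by (intro step) auto
    then show ?case using Suc by simp
  qed
  from this[of N] have 1: "(\<Sum>n\<in>{1..N}. h (real n)) \<le> F (real N)" "F (real N) \<le> (\<Sum>n\<in>{1..N}. h (real n)) + h 0 - h (real N)" by auto
  have 2: "0 \<le> F y - F (real N) \<and> F y - F (real N) \<le> y"
  proof (cases "real N = y")
    case False
    then have "h y * (y - real N) \<le> F y - F (real N) \<and> F y - F (real N) \<le> h (real N) * (y - real N)"
      using Ny by (intro step) auto
    moreover have "h y = 0" by (simp add: h_def)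
    moreover have "h (real N) * (y - real N) \<le> y * 1"
      using h0[of "real N"] Ny y by (intro mult_mono) auto
    ultimately show ?thesis by simp
  qed (use y in auto)
  have "h 0 = y" using y by (simp add: h_def)
  moreover have "h (real N) \<ge> 0" using Ny by (simp add: h_def power_mono)
  ultimately have "\<bar>(\<Sum>n\<in>{1..N}. h (real n)) - pi / 4 * y\<^sup>2\<bar> \<le> 2 * y"
    using 1 2 Fy by linarith
  then show ?thesis by (simp add: h_def N_def)
qed

lemma sum_nat_le_filter:
  fixes f :: "nat \<Rightarrow> real"
  assumes "\<not> P 0"
  shows "(\<Sum>n | real n \<le> x \<and> P n. f n) = (\<Sum>n\<in>{0<..nat \<lfloor>x\<rfloor>}. if P n then f n else 0)"
proof -
  have "(\<Sum>n\<in>{0<..nat \<lfloor>x\<rfloor>}. if P n then f n else 0) = sum f {n\<in>{0<..nat \<lfloor>x\<rfloor>}. P n}"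
    by (rule sum.inter_filter[symmetric]) simp
  also have "{n\<in>{0<..nat \<lfloor>x\<rfloor>}. P n} = {n. real n \<le> x \<and> P n}"
  proof (intro equalityI subsetI)
    fix n assume n: "n \<in> {n. real n \<le> x \<and> P n}"
    then have "n \<noteq> 0" using assms by (metis mem_Collect_eq)
    then show "n \<in> {n\<in>{0<..nat \<lfloor>x\<rfloor>}. P n}" using n by (auto intro: le_nat_floor)
  next
    fix n assume n: "n \<in> {n\<in>{0<..nat \<lfloor>x\<rfloor>}. P n}"
    then have "int n \<le> \<lfloor>x\<rfloor>" by auto
    then show "n \<in> {n. real n \<le> x \<and> P n}" using n by (auto simp: le_floor_iff)
  qed
  finally show ?thesis ..
qed

lemma sum_split_at:
  fixes f :: "nat \<Rightarrow> real"
  assumes "M \<le> N"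
  shows "(\<Sum>n\<in>{0<..N}. f n) = (\<Sum>n\<in>{0<..M}. f n) + (\<Sum>n\<in>{M<..N}. f n)"
proof -
  have "{0<..N} = {0<..M} \<union> {M<..N}" using assms by auto
  then show ?thesis by (simp only:) (rule sum.union_disjoint; auto)
qed

text \<open>The difference is \<open>ln (y / n)\<close> over a product of two logarithms, one of
  which is at least \<open>ln y / 2\<close> because \<open>n >= sqrt y\<close>. The numerator is
  estimated by \<open>ln z <= 2 * sqrt z\<close>, since \<open>sqrt (y / n)\<close> still sums to
  order \<open>y\<close> over \<open>n <= y\<close>.\<close>

lemma inverse_ln_diff:
  assumes n: "sqrt y \<le> real n" "real n \<le> y" and y: "y > 1"
  shows "0 \<le> 1 / ln (real n) - 1 / ln y" "1 / ln (real n) - 1 / ln y \<le> 4 * sqrt y / (ln y)\<^sup>2 * (1 / sqrt (real n))"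
proof -
  have sy: "sqrt y > 1" using y by simp
  then have n1: "real n > 1" using n by linarith
  then have n0: "real n > 0" "n > 0" by auto
  have L: "ln y > 0" using y by simp
  have "ln y / 2 = ln (sqrt y)" using y by (simp add: ln_sqrt)
  also have "\<dots> \<le> ln (real n)" using n(1) sy by (intro ln_mono) linarith+
  finally have low: "ln y / 2 \<le> ln (real n)" .
  have up: "ln (real n) \<le> ln y" using n(2) n0(1) y by (intro ln_mono) linarith+
  have pos: "ln (real n) > 0" using n1 by simp
  show "0 \<le> 1 / ln (real n) - 1 / ln y" using up pos L by (simp add: frac_le)
  have "1 / ln (real n) - 1 / ln y = (ln y - ln (real n)) / (ln (real n) * ln y)"
    using pos L by (simp add: field_simps)
  also have "\<dots> \<le> (ln y - ln (real n)) / (ln y / 2 * ln y)"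
    using low up pos L by (intro divide_left_mono mult_right_mono) auto
  also have "ln y - ln (real n) = ln (y / real n)" using n0 y by (simp add: ln_div)
  also have "\<dots> \<le> (y / real n) powr (1/2) / (1/2)"
    using n n0 by (intro ln_powr_bound) auto
  also have "(y / real n) powr (1/2) = sqrt y / sqrt (real n)"
    using n0 y by (simp add: powr_half_sqrt real_sqrt_divide)
  finally show "1 / ln (real n) - 1 / ln y \<le> 4 * sqrt y / (ln y)\<^sup>2 * (1 / sqrt (real n))"
    using L by (simp add: divide_right_mono power2_eq_square mult_ac)
qed

text \<open>The constant 60 is 48 + 8 + 4: 48 from partial summation against \<open>theta\<close>, 8
  from replacing \<open>ln n\<close> by \<open>ln y\<close>, and 4 for the indices up to
  \<open>sqrt y\<close> together with the error of the area.\<close>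

lemma prime_sum_asymp:
  "\<forall>\<^sub>F y in at_top. \<bar>(\<Sum>p | real p \<le> y \<and> prime p. sqrt (y\<^sup>2 - (real p)\<^sup>2)) - pi / 4 * y\<^sup>2 / ln y\<bar> \<le> 60 * y\<^sup>2 / (ln y)\<^sup>2"
proof -
  have ev: "\<forall>\<^sub>F y::real in at_top. sqrt y * y + (sqrt y * y + 2 * y) / ln y \<le> 4 * y\<^sup>2 / (ln y)\<^sup>2"
    by real_asymp
  show ?thesis using ev theta_uniform eventually_ge_at_top[of 9]
  proof eventually_elim
    case (elim y)
    have y: "y \<ge> 9" by (rule elim(3))
    define L where "L = ln y"
    have L: "L > 0" using y by (simp add: L_def)
    define M where "M = nat \<lfloor>sqrt y\<rfloor>"
    define N where "N = nat \<lfloor>y\<rfloor>"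
    have M: "real M \<le> sqrt y" "sqrt y < real (Suc M)" using y by (auto simp: M_def) linarith
    have N: "real N \<le> y" "y < real (Suc N)" using y by (auto simp: N_def) linarith
    \<comment> \<open>The threshold 9 is there for \<open>3 * sqrt y <= y\<close>, which makes the
      range above \<open>M\<close> nonempty.\<close>
    have s3: "sqrt y \<ge> 3" using y by (simp add: real_le_rsqrt)
    have "sqrt y * 3 \<le> sqrt y * sqrt y" using s3 y by (intro mult_left_mono) auto
    then have sy: "3 * sqrt y \<le> y" using y by simp
    have MN: "M < N"
    proof -
      have "real M + 1 < real (Suc N)" using M N sy s3 by linarith
      then show ?thesis by simp
    qed
    define s where "s = (\<lambda>n::nat. sqrt (y\<^sup>2 - (real n)\<^sup>2))"
    have s: "0 \<le> s n" "s n \<le> y" if "n \<le> N" for n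
    proof -
      have "real n \<le> y" using that N by linarith
      then have "(real n)\<^sup>2 \<le> y\<^sup>2" by (intro power_mono) auto
      then show "0 \<le> s n" by (simp add: s_def)
      have "s n \<le> sqrt (y\<^sup>2)" unfolding s_def by (intro real_sqrt_le_mono) simp
      then show "s n \<le> y" using y by simp
    qed
    define t where "t = (\<lambda>n::nat. if prime n then ln (real n) else 0)"
    define u where "u = (\<lambda>n. if prime n then s n else 0)"
    \<comment> \<open>The partial sums of \<open>b\<close> are differences of values of
      \<open>theta m - m\<close>, and above \<open>M\<close> the weight \<open>g\<close> cancels the
      logarithm: \<open>b n * g n\<close> is the prime term \<open>u n\<close> minus the smooth term
      \<open>g n\<close>.\<close>
    define b where "b = (\<lambda>n. t n - 1)"
    define g where "g = (\<lambda>n. s n / ln (real n))"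
    have theta: "theta (real m) = (\<Sum>n\<in>{0<..m}. t n)" for m
      unfolding theta_def t_def by (subst sum_nat_le_filter) auto
    have large: "sqrt y \<le> real n \<and> real n \<le> y \<and> 1 < real n \<and> n \<le> N" if "n \<in> {M<..N}" for n
    proof -
      have "Suc M \<le> n" "n \<le> N" using that by auto
      then have "real (Suc M) \<le> real n" "real n \<le> real N" by (simp_all only: of_nat_le_iff)
      then show ?thesis using M N s3 \<open>n \<le> N\<close> by auto
    qed
    have lnlow: "L / 2 \<le> ln (real n)" if "n \<in> {M<..N}" for n
    proof -
      have "L / 2 = ln (sqrt y)" using y by (simp add: L_def ln_sqrt)
      also have "\<dots> \<le> ln (real n)" using large[OF that] s3 by (intro ln_mono) linarith+
      finally show ?thesis .
    qed
    have B: "\<bar>\<Sum>n\<in>{M<..m}. b n\<bar> \<le> 24 * y / L" if m: "M < m" "m \<le> N" for m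
    proof -
      have "(\<Sum>n\<in>{M<..m}. b n) = (theta (real m) - real m) - (theta (real M) - real M)"
        unfolding theta using sum_split_at[of M m t] m by (simp add: b_def sum_subtractf of_nat_diff)
      moreover have "\<bar>theta (real m) - real m\<bar> \<le> 12 * y / L" "\<bar>theta (real M) - real M\<bar> \<le> 12 * y / L"
        using elim(2) m N by (auto simp: L_def)
      ultimately show ?thesis by linarith
    qed
    have lnN: "ln (real N) \<ge> 0" using MN by (intro ln_ge_zero) simp
    have "\<bar>\<Sum>n\<in>{M<..N}. b n * g n\<bar> \<le> 24 * y / L * g (Suc M)"
    proof (rule abel_sum_bound[OF MN B])
      fix n assume n: "M < n" "n < N"
      then have "n \<in> {M<..N}" by auto
      then have n1: "1 < real n" using large by blast
      have "s (Suc n) \<le> s n" by (auto simp: s_def intro!: power_mono)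
      then show "g (Suc n) \<le> g n"
        unfolding g_def using n n1 s[of n] by (intro frac_le) auto
    qed (use s[of N] lnN in \<open>auto simp: g_def\<close>)
    also have "g (Suc M) \<le> y / (L / 2)"
      unfolding g_def using s[of "Suc M"] MN L lnlow[of "Suc M"] by (intro frac_le) auto
    then have "24 * y / L * g (Suc M) \<le> 24 * y / L * (y / (L / 2))"
      using y L by (intro mult_left_mono) auto
    finally have 1: "\<bar>\<Sum>n\<in>{M<..N}. b n * g n\<bar> \<le> 48 * y\<^sup>2 / L\<^sup>2"
      by (simp add: power2_eq_square)
    have "(\<Sum>n\<in>{M<..N}. b n * g n) = (\<Sum>n\<in>{M<..N}. u n - g n)"
    proof (rule sum.cong)
      fix n assume n: "n \<in> {M<..N}"
      then have "ln (real n) \<noteq> 0" using lnlow L by fastforce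
      then show "b n * g n = u n - g n" by (simp add: b_def g_def t_def u_def left_diff_distrib diff_divide_distrib)
    qed auto
    then have 2: "(\<Sum>n\<in>{M<..N}. b n * g n) = (\<Sum>n\<in>{M<..N}. u n) - (\<Sum>n\<in>{M<..N}. g n)"
      by (simp add: sum_subtractf)
    have gs: "0 \<le> g n - s n / L \<and> g n - s n / L \<le> 4 * y * sqrt y / L\<^sup>2 * (1 / sqrt (real n))" if n: "n \<in> {M<..N}" for n
    proof -
      have d: "0 \<le> 1 / ln (real n) - 1 / L" "1 / ln (real n) - 1 / L \<le> 4 * sqrt y / L\<^sup>2 * (1 / sqrt (real n))"
        using inverse_ln_diff[of y n] large[OF n] y by (auto simp: L_def)
      have "g n - s n / L = s n * (1 / ln (real n) - 1 / L)" by (simp add: g_def right_diff_distrib)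
      moreover have "s n * (1 / ln (real n) - 1 / L) \<le> y * (4 * sqrt y / L\<^sup>2 * (1 / sqrt (real n)))"
        using d s[of n] large[OF n] y by (intro mult_mono) auto
      moreover have "0 \<le> s n * (1 / ln (real n) - 1 / L)"
        using d s[of n] large[OF n] by (intro mult_nonneg_nonneg) auto
      ultimately show ?thesis by (simp add: mult_ac)
    qed
    have "(\<Sum>n\<in>{M<..N}. g n - s n / L) \<le> (\<Sum>n\<in>{M<..N}. 4 * y * sqrt y / L\<^sup>2 * (1 / sqrt (real n)))"
      using gs by (intro sum_mono) auto
    also have "\<dots> \<le> (\<Sum>n\<in>{1..N}. 4 * y * sqrt y / L\<^sup>2 * (1 / sqrt (real n)))"
      using y by (intro sum_mono2) auto
    also have "\<dots> = 4 * y * sqrt y / L\<^sup>2 * (\<Sum>n\<in>{1..N}. 1 / sqrt (real n))"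
      by (rule sum_distrib_left[symmetric])
    also have "\<dots> \<le> 4 * y * sqrt y / L\<^sup>2 * (2 * sqrt y)"
    proof (rule mult_left_mono)
      have "sqrt (real N) \<le> sqrt y" using N by simp
      then show "(\<Sum>n\<in>{1..N}. 1 / sqrt (real n)) \<le> 2 * sqrt y"
        using sum_inverse_sqrt_le[of N] by linarith
    qed (use y in auto)
    also have "\<dots> = 8 * y\<^sup>2 / L\<^sup>2" using y by (simp add: power2_eq_square)
    finally have 3: "(\<Sum>n\<in>{M<..N}. g n) - (\<Sum>n\<in>{M<..N}. s n) / L \<le> 8 * y\<^sup>2 / L\<^sup>2"
      by (simp add: sum_subtractf sum_divide_distrib)
    have "0 \<le> (\<Sum>n\<in>{M<..N}. g n - s n / L)" using gs by (intro sum_nonneg) auto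
    then have 4: "0 \<le> (\<Sum>n\<in>{M<..N}. g n) - (\<Sum>n\<in>{M<..N}. s n) / L"
      by (simp add: sum_subtractf sum_divide_distrib)
    have small: "0 \<le> (\<Sum>n\<in>{0<..M}. f n) \<and> (\<Sum>n\<in>{0<..M}. f n) \<le> sqrt y * y"
      if "\<And>n. n \<le> N \<Longrightarrow> 0 \<le> f n \<and> f n \<le> y" for f
    proof -
      have "(\<Sum>n\<in>{0<..M}. f n) \<le> (\<Sum>n\<in>{0<..M}. y)"
        using that MN by (intro sum_mono) auto
      also have "\<dots> = real M * y" by simp
      also have "\<dots> \<le> sqrt y * y" using M y by (intro mult_right_mono) auto
      finally show ?thesis using that MN by (auto intro!: sum_nonneg)
    qed
    have 5: "0 \<le> (\<Sum>n\<in>{0<..M}. u n) \<and> (\<Sum>n\<in>{0<..M}. u n) \<le> sqrt y * y"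
      using s y by (intro small) (auto simp: u_def)
    have 6: "0 \<le> (\<Sum>n\<in>{0<..M}. s n) \<and> (\<Sum>n\<in>{0<..M}. s n) \<le> sqrt y * y"
      using s by (intro small) auto
    have "{1..N} = {0<..N}" by auto
    then have 7: "\<bar>(\<Sum>n\<in>{0<..N}. s n) - pi / 4 * y\<^sup>2\<bar> \<le> 2 * y"
      using quarter_disc_sum[of y] y by (simp add: s_def N_def)
    have P: "(\<Sum>p | real p \<le> y \<and> prime p. sqrt (y\<^sup>2 - (real p)\<^sup>2)) = (\<Sum>n\<in>{0<..N}. u n)"
      by (subst sum_nat_le_filter) (auto simp: u_def s_def N_def cong: if_cong)
    have Q: "(\<Sum>n\<in>{M<..N}. s n) / L - pi / 4 * y\<^sup>2 / L = ((\<Sum>n\<in>{0<..N}. s n) - pi / 4 * y\<^sup>2 - (\<Sum>n\<in>{0<..M}. s n)) / L"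
      using sum_split_at[of M N s] MN by (simp add: diff_divide_distrib add_divide_distrib)
    have "\<bar>(\<Sum>n\<in>{0<..N}. s n) - pi / 4 * y\<^sup>2 - (\<Sum>n\<in>{0<..M}. s n)\<bar> \<le> sqrt y * y + 2 * y"
      using 6 7 by linarith
    then have 8: "\<bar>(\<Sum>n\<in>{M<..N}. s n) / L - pi / 4 * y\<^sup>2 / L\<bar> \<le> (sqrt y * y + 2 * y) / L"
      unfolding Q using L by (simp add: divide_right_mono)
    have 9: "sqrt y * y + (sqrt y * y + 2 * y) / L \<le> 4 * y\<^sup>2 / L\<^sup>2" using elim(1) by (simp add: L_def)
    have "\<bar>(\<Sum>n\<in>{0<..N}. u n) - pi / 4 * y\<^sup>2 / L\<bar> \<le> 48 * y\<^sup>2 / L\<^sup>2 + 8 * y\<^sup>2 / L\<^sup>2 + 4 * y\<^sup>2 / L\<^sup>2"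
      using sum_split_at[of M N u] MN 1 2 3 4 5 8 9 by linarith
    also have "\<dots> = 60 * y\<^sup>2 / L\<^sup>2" by (simp flip: add_divide_distrib)
    finally show ?case unfolding P L_def .
  qed
qed

section \<open>Lattice points with a prime coordinate\<close>

lemma card_square_le:
  assumes "z \<ge> 0"
  shows "card {a::nat. (real a)\<^sup>2 \<le> z} = nat \<lfloor>sqrt z\<rfloor> + 1"
proof -
  have "{a::nat. (real a)\<^sup>2 \<le> z} = {..nat \<lfloor>sqrt z\<rfloor>}"
  proof (intro equalityI subsetI)
    fix a :: nat assume "a \<in> {a. (real a)\<^sup>2 \<le> z}"
    then have "real a \<le> sqrt z" by (intro real_le_rsqrt) auto
    then show "a \<in> {..nat \<lfloor>sqrt z\<rfloor>}" by (auto intro: le_nat_floor)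
  next
    fix a assume "a \<in> {..nat \<lfloor>sqrt z\<rfloor>}"
    then have "real a \<le> real (nat \<lfloor>sqrt z\<rfloor>)" by simp
    also have "\<dots> \<le> sqrt z" using assms by (intro of_nat_floor) auto
    finally have "(real a)\<^sup>2 \<le> (sqrt z)\<^sup>2" by (intro power_mono) auto
    then show "a \<in> {a. (real a)\<^sup>2 \<le> z}" using assms by simp
  qed
  then show ?thesis by simp
qed

text \<open>Both sides count the finite set \<open>A\<close>, grouped by the value of
  \<open>a^2 + p^2\<close> or by \<open>p\<close>. Excluding \<open>n = 0\<close> loses nothing,
  since a prime makes the value positive; the added 1 on the right is the point with
  \<open>a = 0\<close>.\<close>

lemma sum_r1_eq:
  assumes x: "x \<ge> 0"
  shows "(\<Sum>n | 0 < n \<and> real n \<le> x. real (r1 n)) =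
     (\<Sum>p | real p \<le> sqrt x \<and> prime p. real (nat \<lfloor>sqrt (x - (real p)\<^sup>2)\<rfloor>) + 1)"
proof -
  define A where "A = {(a :: nat, p :: nat). real (a\<^sup>2 + p\<^sup>2) \<le> x \<and> prime p}"
  define I where "I = {n. 0 < n \<and> real n \<le> x}"
  define J where "J = {p. real p \<le> sqrt x \<and> prime p}"
  have finI: "finite I" unfolding I_def by (rule finite_subset[OF _ finite_nat_le[of x]]) auto
  have finJ: "finite J" unfolding J_def by (rule finite_nat_le_conj)
  have sub: "A \<subseteq> {n. real n \<le> x} \<times> {n. real n \<le> x}"
  proof
    fix z assume "z \<in> A"
    then obtain a p where z: "z = (a, p)" "real (a\<^sup>2 + p\<^sup>2) \<le> x" by (auto simp: A_def)
    have "a \<le> a\<^sup>2 + p\<^sup>2" "p \<le> a\<^sup>2 + p\<^sup>2"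
      by (simp_all add: power2_eq_square trans_le_add1 trans_le_add2)
    then have "real a \<le> x" "real p \<le> x" using z(2) by (metis of_nat_le_iff order.trans)+
    then show "z \<in> {n. real n \<le> x} \<times> {n. real n \<le> x}" using z by simp
  qed
  have finA: "finite A" by (rule finite_subset[OF sub]) (intro finite_cartesian_product finite_nat_le)
  have "(\<Sum>n\<in>I. \<Sum>z\<in>{z\<in>A. (\<lambda>(a, p). a\<^sup>2 + p\<^sup>2) z = n}. 1) = (\<Sum>z\<in>A. 1::real)"
    by (rule sum.group[OF finA finI]) (auto simp: A_def I_def prime_gt_0_nat)
  moreover have "(\<Sum>p\<in>J. \<Sum>z\<in>{z\<in>A. snd z = p}. 1) = (\<Sum>z\<in>A. 1::real)"
  proof (rule sum.group[OF finA finJ])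
    show "snd ` A \<subseteq> J"
    proof
      fix p assume "p \<in> snd ` A"
      then obtain a where a: "real (a\<^sup>2 + p\<^sup>2) \<le> x" "prime p" by (auto simp: A_def)
      have "(real p)\<^sup>2 \<le> real (a\<^sup>2 + p\<^sup>2)" by simp
      also note a(1)
      finally show "p \<in> J" using a(2) by (auto simp: J_def intro: real_le_rsqrt)
    qed
  qed
  moreover have "(\<Sum>z\<in>{z\<in>A. (\<lambda>(a, p). a\<^sup>2 + p\<^sup>2) z = n}. 1) = real (r1 n)" if "n \<in> I" for n
  proof -
    have "{z\<in>A. (\<lambda>(a, p). a\<^sup>2 + p\<^sup>2) z = n} = {(a, p). a\<^sup>2 + p\<^sup>2 = n \<and> prime p}"
      using that by (auto simp: A_def I_def)
    then show ?thesis by (simp add: r1_def)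
  qed
  moreover have "(\<Sum>z\<in>{z\<in>A. snd z = p}. 1) = real (nat \<lfloor>sqrt (x - (real p)\<^sup>2)\<rfloor>) + 1" if p: "p \<in> J" for p
  proof -
    have "{z\<in>A. snd z = p} = (\<lambda>a. (a, p)) ` {a. (real a)\<^sup>2 \<le> x - (real p)\<^sup>2}"
      using p by (auto simp: A_def J_def)
    then have "card {z\<in>A. snd z = p} = card {a::nat. (real a)\<^sup>2 \<le> x - (real p)\<^sup>2}"
      by (simp add: card_image inj_on_def)
    moreover have "(real p)\<^sup>2 \<le> (sqrt x)\<^sup>2" using p by (intro power_mono) (auto simp: J_def)
    ultimately show ?thesis using x by (simp add: card_square_le)
  qed
  ultimately show ?thesis unfolding I_def[symmetric] J_def[symmetric] by (simp cong: sum.cong)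
qed

text \<open>At \<open>y = sqrt x\<close> one has \<open>ln y = ln x / 2\<close>, so 60 becomes 240
  and \<open>pi / 4\<close> becomes \<open>pi / 2\<close>. The remaining 10 covers the rounding:
  each prime up to \<open>sqrt x\<close> contributes an error between 0 and 1.\<close>

lemma sum_r1_bound:
  "\<forall>\<^sub>F x in at_top. \<bar>(\<Sum>n | 0 < n \<and> real n \<le> x. real (r1 n)) - pi / 2 * (x / ln x)\<bar> \<le> 250 * x / (ln x)\<^sup>2"
proof -
  have sq: "filterlim sqrt at_top at_top" by real_asymp
  have "\<forall>\<^sub>F x::real in at_top. sqrt x \<le> 10 * x / (ln x)\<^sup>2" by real_asymp
  then show ?thesis using eventually_compose_filterlim[OF prime_sum_asymp sq] eventually_gt_at_top[of 1]
  proof eventually_elim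
    case (elim x)
    have x: "x > 1" by (rule elim(3))
    let ?J = "{p. real p \<le> sqrt x \<and> prime p}"
    have s: "\<bar>(\<Sum>p\<in>?J. sqrt (x - (real p)\<^sup>2)) - pi / 2 * (x / ln x)\<bar> \<le> 240 * x / (ln x)\<^sup>2"
      using elim(2) x by (simp add: ln_sqrt power_divide)
    have fl: "0 \<le> real (nat \<lfloor>z\<rfloor>) + 1 - z \<and> real (nat \<lfloor>z\<rfloor>) + 1 - z \<le> 1" if "z \<ge> 0" for z :: real
      using that by (auto simp: of_nat_floor)
    have nn: "0 \<le> sqrt (x - (real p)\<^sup>2)" if "p \<in> ?J" for p
    proof -
      have "(real p)\<^sup>2 \<le> (sqrt x)\<^sup>2" using that by (intro power_mono) auto
      then show ?thesis using x by simp
    qed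
    have "0 \<le> (\<Sum>p\<in>?J. real (nat \<lfloor>sqrt (x - (real p)\<^sup>2)\<rfloor>) + 1 - sqrt (x - (real p)\<^sup>2))"
      using fl nn by (intro sum_nonneg) auto
    moreover have "(\<Sum>p\<in>?J. real (nat \<lfloor>sqrt (x - (real p)\<^sup>2)\<rfloor>) + 1 - sqrt (x - (real p)\<^sup>2)) \<le> (\<Sum>p\<in>?J. 1)"
      using fl nn by (intro sum_mono) auto
    moreover have "(\<Sum>p\<in>?J. 1) \<le> sqrt x"
    proof -
      have "(\<Sum>p\<in>?J. 1::real) = (\<Sum>n\<in>{0<..nat \<lfloor>sqrt x\<rfloor>}. if prime n then 1 else 0)"
        by (rule sum_nat_le_filter) simp
      also have "\<dots> \<le> (\<Sum>n\<in>{0<..nat \<lfloor>sqrt x\<rfloor>}. 1)" by (rule sum_mono) auto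
      also have "\<dots> = real (nat \<lfloor>sqrt x\<rfloor>)" by simp
      also have "\<dots> \<le> sqrt x" using x by (intro of_nat_floor) auto
      finally show ?thesis .
    qed
    moreover have "(\<Sum>p\<in>?J. real (nat \<lfloor>sqrt (x - (real p)\<^sup>2)\<rfloor>) + 1 - sqrt (x - (real p)\<^sup>2)) =
       (\<Sum>n | 0 < n \<and> real n \<le> x. real (r1 n)) - (\<Sum>p\<in>?J. sqrt (x - (real p)\<^sup>2))"
      using sum_r1_eq[of x] x by (simp only: sum_subtractf)
    ultimately have "\<bar>(\<Sum>n | 0 < n \<and> real n \<le> x. real (r1 n)) - pi / 2 * (x / ln x)\<bar> \<le> 240 * x / (ln x)\<^sup>2 + 10 * x / (ln x)\<^sup>2"
      using s elim(1) by linarith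
    then show ?case by (simp flip: add_divide_distrib)
  qed
qed

theorem lemma3p2p1:
  "\<exists>E :: real \<Rightarrow> real. E \<in> O[at_top](\<lambda>x. 1 / ln x) \<and>
     (\<forall>\<^sub>F x in at_top.
        (\<Sum>n | 0 < n \<and> real n \<le> x. real (r1 n)) = pi / 2 * (x / ln x) * (1 + E x))"
proof -
  define S where "S = (\<lambda>x::real. \<Sum>n | 0 < n \<and> real n \<le> x. real (r1 n))"
  \<comment> \<open>The exact relative error, so the product formula is immediate for
    \<open>x > 1\<close> and only the size of \<open>E\<close> has content; \<open>500 / pi\<close>
    below is 250 divided by \<open>pi / 2\<close>.\<close>
  define E where "E = (\<lambda>x. S x / (pi / 2 * (x / ln x)) - 1)"
  have "\<forall>\<^sub>F x in at_top. norm (E x) \<le> 500 / pi * norm (1 / ln x)"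
    using sum_r1_bound eventually_gt_at_top[of 1]
  proof eventually_elim
    case (elim x)
    define m where "m = pi / 2 * (x / ln x)"
    have L: "ln x > 0" using elim(2) by simp
    have m: "m > 0" using L elim(2) by (simp add: m_def)
    have "E x = S x / m - 1" by (simp only: E_def m_def)
    also have "\<dots> = (S x - m) / m" using m by (simp add: diff_divide_distrib)
    finally have "\<bar>E x\<bar> = \<bar>S x - m\<bar> / m" using m by (simp add: abs_divide)
    also have "\<dots> \<le> (250 * x / (ln x)\<^sup>2) / m"
      using elim(1) m by (intro divide_right_mono) (auto simp: S_def m_def)
    also have "\<dots> = 500 / pi * (1 / ln x)" using L elim(2) by (simp add: m_def power2_eq_square field_simps)
    finally show ?case using L by simp
  qed
  then have "E \<in> O[at_top](\<lambda>x. 1 / ln x)" by (rule bigoI)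
  moreover have "\<forall>\<^sub>F x in at_top. S x = pi / 2 * (x / ln x) * (1 + E x)"
    using eventually_gt_at_top[of 1]
    by eventually_elim (auto simp: E_def)
  ultimately show ?thesis unfolding S_def by blast
qed

end
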